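(* Let $H$ be a separable infinite-dimensional Hilbert space, let $0<a<b$, let $\varphi_1\in C[a,b]$ be a real-valued strictly increasing function, and let $T\in\mathbb{B}(H)$ satisfy $\sigma(|T|)\subset(a,b)$. Let $\mathcal{J}$ be a normed ideal of $\mathbb{B}(H)$ such that $[\varphi_1(|T|),T]\in\mathcal{J}$ and $\varphi_1$ is $\mathcal{J}$-Lipschitz on $[a,b]$. Then there exists a unique global solution $X(t)$ on $[0,\infty)$ of $$\frac{dX(t)}{dt}=[\varphi_1(|X(t)|),X(t)],\qquad X(0)=T,$$ such that $X(t)-T$ belongs to $C^1([0,\infty),\mathcal{J})$, where $\mathcal{J}$ is equipped with the norm $\|\cdot\|_{\mathcal{J}}$. The solution stays in the similarity orbit $\mathcal{O}(T)$ of $T$. If moreover $\varphi_1(|T|)\in\mathcal{J}$, it stays in $\mathcal{O}_{\mathcal{J}}(T)$.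
   Context: $\mathbb{B}(H)$ is the algebra of bounded operators on $H$ with operator norm $\|\cdot\|$; $|X|=(X^*X)^{1/2}$; $[A,B]=AB-BA$. A solution is understood to satisfy $\sigma(|X(t)|)\subset[a,b]$ for all $t$. A normed ideal is a two-sided ideal $\mathcal{J}$ of $\mathbb{B}(H)$ with a norm $\|\cdot\|_{\mathcal{J}}$ making it a Banach space such that $\|X\|_{\mathcal{J}}=\|X\|$ for every rank one operator $X$, and $\|YXZ\|_{\mathcal{J}}\le\|Y\|\,\|X\|_{\mathcal{J}}\,\|Z\|$ for $X\in\mathcal{J}$, $Y,Z\in\mathbb{B}(H)$. The case $\mathcal{J}=\mathbb{B}(H)$ with the operator norm is included. A continuous function $f$ on $[a,b]$ is $\mathcal{J}$-Lipschitz on $[a,b]$ if there is $C>0$ such that for all self-adjoint $A_1,A_2\in\mathbb{B}(H)$ with spectra in $[a,b]$ and $A_1-A_2\in\mathcal{J}$, one has $f(A_1)-f(A_2)\in\mathcal{J}$ and $\|f(A_1)-f(A_2)\|_{\mathcal{J}}\le C\|A_1-A_2\|_{\mathcal{J}}$. $\mathcal{O}(T)=\{gTg^{-1}: g\in\mathbb{B}(H)\text{ invertible}\}$; $G_{\mathcal{J}}=\{g\in\mathbb{B}(H)\text{ invertible}: g-I\in\mathcal{J}\}$; $\mathcal{O}_{\mathcal{J}}(T)=\{gTg^{-1}: g\in G_{\mathcal{J}}\}$. *)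

theory Defs
  imports "HOL-Analysis.Analysis" "HOL-Computational_Algebra.Polynomial"
begin

text \<open>
  A complex Hilbert space is a real Hilbert space together with a compatible complex scalar
  multiplication and a complex inner product (antilinear in the first argument) whose real part
  is the real inner product; the norm is therefore the one induced by the complex inner product.
\<close>

class chilbert_space = real_inner + banach +
  fixes scaleC :: "complex \<Rightarrow> 'a \<Rightarrow> 'a"  (infixr "*\<^sub>C" 75)
    and cinner :: "'a \<Rightarrow> 'a \<Rightarrow> complex"
  assumes scaleC_add_right: "z *\<^sub>C (x + y) = z *\<^sub>C x + z *\<^sub>C y"
    and scaleC_add_left: "(z + w) *\<^sub>C x = z *\<^sub>C x + w *\<^sub>C x"
    and scaleC_scaleC: "z *\<^sub>C w *\<^sub>C x = (z * w) *\<^sub>C x"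
    and scaleC_of_real: "complex_of_real r *\<^sub>C x = r *\<^sub>R x"
    and cinner_commute: "cinner x y = cnj (cinner y x)"
    and cinner_add_right: "cinner x (y + y') = cinner x y + cinner x y'"
    and cinner_scaleC_right: "cinner x (z *\<^sub>C y) = z * cinner x y"
    and inner_eq_Re_cinner: "inner x y = Re (cinner x y)"

lemma vector_space_scaleC: "vector_space (scaleC :: complex \<Rightarrow> 'h \<Rightarrow> 'h::chilbert_space)"
proof
  show "1 *\<^sub>C x = x" for x :: 'h
    using scaleC_of_real[of 1 x] by simp
qed (simp_all add: scaleC_add_right scaleC_add_left scaleC_scaleC)

lemma cinner_self: "cinner x x = complex_of_real ((norm x)\<^sup>2)"
proof (rule complex_eqI)
  show "Re (cinner x x) = Re (complex_of_real ((norm x)\<^sup>2))"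
    by (simp add: power2_norm_eq_inner inner_eq_Re_cinner)
  have "Im (cinner x x) = - Im (cinner x x)"
    by (subst cinner_commute) simp
  then show "Im (cinner x x) = Im (complex_of_real ((norm x)\<^sup>2))"
    by simp
qed

lemma norm_scaleC: "norm (z *\<^sub>C x) = cmod z * norm x"
proof -
  have "cinner (z *\<^sub>C x) (z *\<^sub>C x) = z * cnj z * cinner x x"
    by (metis cinner_commute cinner_scaleC_right complex_cnj_mult mult.assoc mult.commute complex_cnj_cnj)
  then have "complex_of_real ((norm (z *\<^sub>C x))\<^sup>2) = complex_of_real ((cmod z * norm x)\<^sup>2)"
    unfolding cinner_self by (simp add: power_mult_distrib flip: complex_norm_square)
  then have "(norm (z *\<^sub>C x))\<^sup>2 = (cmod z * norm x)\<^sup>2"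
    by (simp only: of_real_eq_iff)
  then show ?thesis
    by (simp add: power2_eq_iff_nonneg)
qed

text \<open>
  Elements of type \<open>'h \<Rightarrow>\<^sub>L 'h\<close> are only real linear, so the algebra of bounded operators of
  the complex space is the subset of the complex linear ones. It carries the operator norm of
  \<open>'h \<Rightarrow>\<^sub>L 'h\<close>.
\<close>

definition BH :: "('h::chilbert_space \<Rightarrow>\<^sub>L 'h) set" where
  "BH = {A. \<forall>z x. blinfun_apply A (z *\<^sub>C x) = z *\<^sub>C blinfun_apply A x}"

lift_definition scalar_op :: "complex \<Rightarrow> 'h::chilbert_space \<Rightarrow>\<^sub>L 'h" is "\<lambda>z x. z *\<^sub>C x"
proof -
  fix z :: complex
  show "bounded_linear (\<lambda>x::'h. z *\<^sub>C x)"
  proof (rule bounded_linear_intro)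
    show "norm (z *\<^sub>C x) \<le> norm x * cmod z" for x :: 'h
      by (simp add: norm_scaleC)
    show "z *\<^sub>C r *\<^sub>R x = r *\<^sub>R z *\<^sub>C x" for r and x :: 'h
      by (metis scaleC_of_real scaleC_scaleC mult.commute)
  qed (rule scaleC_add_right)
qed

definition commutator ::
  "('h::chilbert_space \<Rightarrow>\<^sub>L 'h) \<Rightarrow> ('h \<Rightarrow>\<^sub>L 'h) \<Rightarrow> ('h \<Rightarrow>\<^sub>L 'h)" where
  "commutator A B = (A o\<^sub>L B) - (B o\<^sub>L A)"

definition adj_op :: "('h::chilbert_space \<Rightarrow>\<^sub>L 'h) \<Rightarrow> ('h \<Rightarrow>\<^sub>L 'h)" where
  "adj_op A = (THE B. B \<in> BH \<and>
     (\<forall>x y. cinner (blinfun_apply A x) y = cinner x (blinfun_apply B y)))"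

definition selfadjoint_op :: "('h::chilbert_space \<Rightarrow>\<^sub>L 'h) \<Rightarrow> bool" where
  "selfadjoint_op A \<longleftrightarrow> A \<in> BH \<and> adj_op A = A"

definition invertible_op :: "('h::chilbert_space \<Rightarrow>\<^sub>L 'h) \<Rightarrow> bool" where
  "invertible_op g \<longleftrightarrow> g \<in> BH \<and>
     (\<exists>h\<in>BH. g o\<^sub>L h = id_blinfun \<and> h o\<^sub>L g = id_blinfun)"

definition inverse_op :: "('h::chilbert_space \<Rightarrow>\<^sub>L 'h) \<Rightarrow> ('h \<Rightarrow>\<^sub>L 'h)" where
  "inverse_op g = (THE h. h \<in> BH \<and> g o\<^sub>L h = id_blinfun \<and> h o\<^sub>L g = id_blinfun)"

definition spectrum_op :: "('h::chilbert_space \<Rightarrow>\<^sub>L 'h) \<Rightarrow> complex set" where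
  "spectrum_op A = {z. \<not> invertible_op (A - scalar_op z)}"

definition poly_op ::
  "real poly \<Rightarrow> ('h::chilbert_space \<Rightarrow>\<^sub>L 'h) \<Rightarrow> ('h \<Rightarrow>\<^sub>L 'h)" where
  "poly_op p A = (\<Sum>i\<le>degree p. coeff p i *\<^sub>R (((o\<^sub>L) A ^^ i) id_blinfun))"

text \<open>
  Continuous functional calculus of a self-adjoint operator: \<open>f(A)\<close> is the norm limit of
  \<open>p\<^sub>n(A)\<close> for polynomials \<open>p\<^sub>n\<close> converging to \<open>f\<close> uniformly on the spectrum of \<open>A\<close>. Only the
  values of \<open>f\<close> on the spectrum matter.
\<close>

definition cfc :: "(real \<Rightarrow> real) \<Rightarrow> ('h::chilbert_space \<Rightarrow>\<^sub>L 'h) \<Rightarrow> ('h \<Rightarrow>\<^sub>L 'h)" where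
  "cfc f A = (THE B. \<forall>p :: nat \<Rightarrow> real poly.
     uniform_limit {x. complex_of_real x \<in> spectrum_op A} (\<lambda>n x. poly (p n) x) f sequentially
     \<longrightarrow> (\<lambda>n. poly_op (p n) A) \<longlonglongrightarrow> B)"

definition abs_op :: "('h::chilbert_space \<Rightarrow>\<^sub>L 'h) \<Rightarrow> ('h \<Rightarrow>\<^sub>L 'h)" where
  "abs_op X = cfc sqrt (adj_op X o\<^sub>L X)"

definition rank_one_op :: "('h::chilbert_space \<Rightarrow>\<^sub>L 'h) \<Rightarrow> bool" where
  "rank_one_op X \<longleftrightarrow> X \<in> BH \<and> (\<exists>v. v \<noteq> 0 \<and> range (blinfun_apply X) = range (\<lambda>z. z *\<^sub>C v))"

definition normed_ideal ::
  "('h::chilbert_space \<Rightarrow>\<^sub>L 'h) set \<Rightarrow> (('h \<Rightarrow>\<^sub>L 'h) \<Rightarrow> real) \<Rightarrow> bool" where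
  "normed_ideal J nJ \<longleftrightarrow>
     J \<subseteq> BH \<and> 0 \<in> J \<and> (\<forall>X\<in>J. \<forall>Y\<in>J. X + Y \<in> J) \<and>
     (\<forall>X\<in>J. \<forall>z. scalar_op z o\<^sub>L X \<in> J) \<and>
     (\<forall>X\<in>J. \<forall>Y\<in>BH. Y o\<^sub>L X \<in> J \<and> X o\<^sub>L Y \<in> J) \<and>
     (\<forall>X\<in>J. 0 \<le> nJ X) \<and> (\<forall>X\<in>J. nJ X = 0 \<longleftrightarrow> X = 0) \<and>
     (\<forall>X\<in>J. \<forall>Y\<in>J. nJ (X + Y) \<le> nJ X + nJ Y) \<and>
     (\<forall>X\<in>J. \<forall>z. nJ (scalar_op z o\<^sub>L X) = cmod z * nJ X) \<and>
     (\<forall>S :: nat \<Rightarrow> ('h \<Rightarrow>\<^sub>L 'h). (\<forall>n. S n \<in> J) \<longrightarrow>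
        (\<forall>e>0. \<exists>N. \<forall>m\<ge>N. \<forall>n\<ge>N. nJ (S m - S n) < e) \<longrightarrow>
        (\<exists>L\<in>J. (\<lambda>n. nJ (S n - L)) \<longlonglongrightarrow> 0)) \<and>
     (\<forall>X. rank_one_op X \<longrightarrow> X \<in> J \<and> nJ X = norm X) \<and>
     (\<forall>X\<in>J. \<forall>Y\<in>BH. \<forall>Z\<in>BH. nJ (Y o\<^sub>L X o\<^sub>L Z) \<le> norm Y * nJ X * norm Z)"

definition ideal_lipschitz ::
  "('h::chilbert_space \<Rightarrow>\<^sub>L 'h) set \<Rightarrow> (('h \<Rightarrow>\<^sub>L 'h) \<Rightarrow> real) \<Rightarrow> real \<Rightarrow> real \<Rightarrow> (real \<Rightarrow> real) \<Rightarrow> bool"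
  where
  "ideal_lipschitz J nJ a b f \<longleftrightarrow> (\<exists>C>0. \<forall>A\<^sub>1 A\<^sub>2.
     selfadjoint_op A\<^sub>1 \<longrightarrow> selfadjoint_op A\<^sub>2 \<longrightarrow>
     spectrum_op A\<^sub>1 \<subseteq> complex_of_real ` {a..b} \<longrightarrow> spectrum_op A\<^sub>2 \<subseteq> complex_of_real ` {a..b} \<longrightarrow>
     A\<^sub>1 - A\<^sub>2 \<in> J \<longrightarrow>
     cfc f A\<^sub>1 - cfc f A\<^sub>2 \<in> J \<and> nJ (cfc f A\<^sub>1 - cfc f A\<^sub>2) \<le> C * nJ (A\<^sub>1 - A\<^sub>2))"

text \<open>
  \<open>C\<^sup>1([0,\<infinity>),J)\<close>, where \<open>J\<close> carries its own norm; derivatives at \<open>0\<close> are one-sided.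
\<close>

definition C1_ideal ::
  "('h::chilbert_space \<Rightarrow>\<^sub>L 'h) set \<Rightarrow> (('h \<Rightarrow>\<^sub>L 'h) \<Rightarrow> real) \<Rightarrow> (real \<Rightarrow> ('h \<Rightarrow>\<^sub>L 'h)) \<Rightarrow> bool" where
  "C1_ideal J nJ F \<longleftrightarrow> (\<forall>t\<ge>0. F t \<in> J) \<and>
     (\<exists>D. \<forall>t\<ge>0. D t \<in> J \<and>
        ((\<lambda>s. nJ ((F s - F t) /\<^sub>R (s - t) - D t)) \<longlongrightarrow> 0) (at t within {0..}) \<and>
        ((\<lambda>s. nJ (D s - D t)) \<longlongrightarrow> 0) (at t within {0..}))"

text \<open>
  The condition on the spectrum of \<open>|X(t)|\<close> is part of the notion of a solution; it makes
  \<open>\<phi>(|X(t)|)\<close> meaningful for \<open>\<phi>\<close> given on \<open>[a,b]\<close> only. The derivative is taken in operator norm.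
\<close>

definition flow_solution ::
  "real \<Rightarrow> real \<Rightarrow> (real \<Rightarrow> real) \<Rightarrow> ('h::chilbert_space \<Rightarrow>\<^sub>L 'h) \<Rightarrow> (real \<Rightarrow> ('h \<Rightarrow>\<^sub>L 'h)) \<Rightarrow> bool" where
  "flow_solution a b \<phi> T X \<longleftrightarrow> X 0 = T \<and>
     (\<forall>t\<ge>0. X t \<in> BH \<and> spectrum_op (abs_op (X t)) \<subseteq> complex_of_real ` {a..b} \<and>
        (X has_vector_derivative commutator (cfc \<phi> (abs_op (X t))) (X t)) (at t within {0..}))"

definition similarity_orbit :: "('h::chilbert_space \<Rightarrow>\<^sub>L 'h) \<Rightarrow> ('h \<Rightarrow>\<^sub>L 'h) set" where
  "similarity_orbit T = {g o\<^sub>L T o\<^sub>L inverse_op g | g. invertible_op g}"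

definition ideal_group :: "('h::chilbert_space \<Rightarrow>\<^sub>L 'h) set \<Rightarrow> ('h \<Rightarrow>\<^sub>L 'h) set" where
  "ideal_group J = {g. invertible_op g \<and> g - id_blinfun \<in> J}"

definition ideal_orbit ::
  "('h::chilbert_space \<Rightarrow>\<^sub>L 'h) set \<Rightarrow> ('h \<Rightarrow>\<^sub>L 'h) \<Rightarrow> ('h \<Rightarrow>\<^sub>L 'h) set" where
  "ideal_orbit J T = {g o\<^sub>L T o\<^sub>L inverse_op g | g. g \<in> ideal_group J}"

end

theory Submission
  imports Defs "HOL-Computational_Algebra.Fundamental_Theorem_Algebra"
begin

text \<open>
  Write \<open>F(X) = [\<phi>(|X|), X]\<close> for the right-hand side. The difficulty is that \<open>\<phi>\<close> need not be
  operator Lipschitz, so that \<open>F\<close> need not be locally Lipschitz for the operator norm; a Lipschitz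
  bound is available along \<open>T + J\<close> and for the norm of \<open>J\<close>. Writing \<open>X = T + Y\<close>, one therefore solves an ordinary differential equation for \<open>Y\<close> in the Banach space \<open>J\<close>.

  \<^item> Lipschitz bound. If \<open>|X|\<close> and \<open>|Y|\<close> have spectrum in \<open>[a,b]\<close> and \<open>X - Y\<close> is in \<open>J\<close>, then
    \<open>|X| - |Y|\<close> is in \<open>J\<close> with norm at most \<open>b/a\<close> times that of \<open>X - Y\<close>: the difference solves
    the Sylvester equation \<open>|X|E + E|Y| = X*X - Y*Y\<close>, whose solution is the fixed point of
    a contraction of \<open>J\<close> (\<open>abs_op_lipschitz\<close>). This uses that \<open>J\<close> is closed under adjoints, which
    follows from the polar decomposition (\<open>polar_contraction\<close>). The assumption on \<open>\<phi>\<close> then makes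
    \<open>F\<close> Lipschitz (\<open>field_lipschitz\<close>), and \<open>F(T) \<in> J\<close> makes \<open>F\<close> map into \<open>J\<close>.

  \<^item> The spectrum stays inside. For every real \<open>c\<close>, \<open>X + h F(X)\<close> equals
    \<open>(1 + h(\<phi>(|X|) - c)) X (1 - h(\<phi>(|X|) - c))\<close> up to \<open>O(h^2)\<close>. If \<open>c\<close> is the value of
    \<open>\<phi>\<close> at \<open>\<parallel>X\<parallel>\<close>, the first factor is a contraction because \<open>\<phi>\<close> is monotone, and the remaining product
    has norm at most \<open>\<parallel>X\<parallel> + o(h)\<close>. Hence \<open>\<parallel>X(t)\<parallel>\<close> never increases along the flow; taking the
    value of \<open>\<phi>\<close> at the minimum modulus of \<open>X\<close> instead, one sees that the minimum modulus never
    decreases. So the spectrum of \<open>|X(t)|\<close> stays at least as far from \<open>a\<close> and \<open>b\<close> as at time \<open>0\<close> (\<open>sol_bounds\<close>).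

  \<^item> Global existence. A Picard iteration in \<open>J\<close> (\<open>picard_local\<close>) gives a solution on an interval
    whose length depends only on that distance and on the size of \<open>F\<close> at the starting point. By
    Gronwall's inequality the latter grows at most exponentially (\<open>sol_growth\<close>), so finitely many
    steps reach any given time. Gronwall's inequality in the norm of \<open>J\<close> also gives uniqueness.

  \<^item> Orbits. Put \<open>B(t) = \<phi>(|X(t)|)\<close> and solve \<open>g' = B g\<close>, \<open>g(0) = 1\<close>. Then \<open>E = X g - g T\<close> satisfies
    \<open>E' = B E\<close> and \<open>E(0) = 0\<close>, so \<open>X = g T g\<inverse>\<close> (\<open>lax_orbit\<close>). If \<open>B\<close> takes values in a normed ideal
    and is Lipschitz there, then \<open>g - 1\<close> lies in that ideal. The
    two claims on orbits are the cases of the ideals \<open>\<B>(H)\<close> and \<open>J\<close>.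

  The functional calculus rests on the bound of \<open>\<parallel>p(A)\<parallel>\<close> by the supremum of \<open>|p|\<close> over the
  spectrum (\<open>norm_poly_op_le\<close>). Adjoints, invertibility and the polar decomposition all come from
  one representation theorem for linear functionals (\<open>riesz_range\<close>).
\<close>

section \<open>Differential inequalities\<close>

text \<open>
  For \<open>e > 0\<close> consider the last time at which \<open>w\<close> lies on or below the line of slope \<open>e\<close> through
  \<open>w 0\<close>. Before the end of the interval it cannot occur, since \<open>w\<close> stays below the line a little longer.
\<close>

lemma dini_nonincreasing:
  fixes w :: "real \<Rightarrow> real"
  assumes cont: "continuous_on {0..T} w" and T: "0 \<le> T"
    and dini: "\<And>t e. 0 \<le> t \<Longrightarrow> t < T \<Longrightarrow> 0 < e \<Longrightarrow>
      \<exists>d>0. \<forall>s. t < s \<longrightarrow> s < t + d \<longrightarrow> s \<le> T \<longrightarrow> w s \<le> w t + e * (s - t)"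
  shows "w T \<le> w 0"
proof (rule field_le_epsilon)
  fix e0 :: real assume "0 < e0"
  define e where "e = e0 / (T + 1)"
  have e: "0 < e" "e * T \<le> e0"
    using \<open>0 < e0\<close> T by (auto simp: e_def field_simps)
  have "w T \<le> w 0 + e * T"
  proof (rule ccontr)
    assume neg: "\<not> w T \<le> w 0 + e * T"
    define S where "S = {t \<in> {0..T}. w t - e * t \<le> w 0}"
    have "closed S"
      unfolding S_def
      by (intro continuous_on_closed_Collect_le continuous_intros cont closed_atLeastAtMost)
    have S0: "0 \<in> S" using T by (simp add: S_def)
    have bdd: "bdd_above S" by (auto simp: S_def bdd_above_def)
    define t where "t = Sup S"
    have tS: "t \<in> S"
      unfolding t_def using S0 bdd \<open>closed S\<close> closed_contains_Sup by blast
    then have t: "0 \<le> t" "t \<le> T" "w t - e * t \<le> w 0" by (auto simp: S_def)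
    with neg have "t < T" by (cases "t = T") auto
    obtain d where d: "d > 0" "\<And>s. t < s \<Longrightarrow> s < t + d \<Longrightarrow> s \<le> T \<Longrightarrow> w s \<le> w t + e * (s - t)"
      using dini[OF t(1) \<open>t < T\<close> e(1)] by blast
    define s where "s = min T (t + d / 2)"
    have s: "t < s" "s < t + d" "s \<le> T" using \<open>t < T\<close> d(1) by (auto simp: s_def)
    have "w s \<le> w t + e * (s - t)" by (rule d(2)[OF s])
    then have "s \<in> S" using t s by (auto simp: S_def algebra_simps)
    then have "s \<le> t" unfolding t_def by (rule cSup_upper[OF _ bdd])
    with s show False by simp
  qed
  with e show "w T \<le> w 0 + e0" by linarith
qed

text \<open>
  The factor \<open>exp (- L t)\<close> turns the growth rate \<open>L\<close> into the rate \<open>0\<close> of the previous lemma,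
  because \<open>1 + L h \<le> exp (L h)\<close>.
\<close>

lemma gronwall_dini:
  fixes u :: "real \<Rightarrow> real"
  assumes cont: "continuous_on {0..T} u" and T: "0 \<le> T" and L: "0 \<le> L"
    and nonneg: "\<And>t. 0 \<le> t \<Longrightarrow> t \<le> T \<Longrightarrow> 0 \<le> u t"
    and dini: "\<And>t e. 0 \<le> t \<Longrightarrow> t < T \<Longrightarrow> 0 < e \<Longrightarrow>
      \<exists>d>0. \<forall>s. t < s \<longrightarrow> s < t + d \<longrightarrow> s \<le> T \<longrightarrow> u s \<le> u t + (s - t) * (L * u t + e)"
  shows "u T \<le> exp (L * T) * u 0"
proof -
  have "exp (- L * T) * u T \<le> exp (- L * 0) * u 0"
  proof (rule dini_nonincreasing[where w = "\<lambda>t. exp (- L * t) * u t"])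
    show "continuous_on {0..T} (\<lambda>t. exp (- L * t) * u t)"
      by (intro continuous_intros cont)
    fix t e :: real assume t: "0 \<le> t" "t < T" and e: "0 < e"
    obtain d where d: "d > 0" "\<And>s. t < s \<Longrightarrow> s < t + d \<Longrightarrow> s \<le> T \<Longrightarrow> u s \<le> u t + (s - t) * (L * u t + e)"
      using dini[OF t e] by blast
    show "\<exists>d>0. \<forall>s. t < s \<longrightarrow> s < t + d \<longrightarrow> s \<le> T \<longrightarrow>
        exp (- L * s) * u s \<le> exp (- L * t) * u t + e * (s - t)"
    proof (intro exI[of _ d] conjI allI impI d(1))
      fix s assume s: "t < s" "s < t + d" "s \<le> T"
      have "u s \<le> u t * (1 + L * (s - t)) + e * (s - t)"
        using d(2)[OF s] by (simp add: algebra_simps)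
      also have "\<dots> \<le> u t * exp (L * (s - t)) + e * (s - t)"
        using nonneg[of t] t exp_ge_add_one_self[of "L * (s - t)"]
        by (intro add_right_mono mult_left_mono) auto
      finally have "exp (- L * s) * u s \<le> exp (- L * s) * (u t * exp (L * (s - t)) + e * (s - t))"
        by (intro mult_left_mono) auto
      also have "\<dots> = (exp (- L * s) * exp (L * (s - t))) * u t + exp (- L * s) * (e * (s - t))"
        by (simp add: algebra_simps)
      also have "exp (- L * s) * exp (L * (s - t)) = exp (- L * t)"
        by (simp add: exp_add [symmetric] algebra_simps)
      also have "exp (- L * s) * (e * (s - t)) \<le> 1 * (e * (s - t))"
        using L s t e by (intro mult_right_mono) auto
      finally show "exp (- L * s) * u s \<le> exp (- L * t) * u t + e * (s - t)" by simp
    qed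
  qed (rule T)
  then have "exp (L * T) * (exp (- L * T) * u T) \<le> exp (L * T) * u 0"
    by (intro mult_left_mono) auto
  then show ?thesis
    by (simp add: mult.assoc [symmetric] exp_add [symmetric])
qed

section \<open>Integrals and differential equations in a complete normed subspace\<close>

text \<open>
  The left Riemann sum over \<open>2^n\<close> equal cells. Splitting the interval at its midpoint, rather than
  summing over cells, makes consecutive sums comparable by induction on \<open>n\<close>.
\<close>

primrec dyadic_sum :: "(real \<Rightarrow> 'a::real_vector) \<Rightarrow> nat \<Rightarrow> real \<Rightarrow> real \<Rightarrow> 'a" where
  "dyadic_sum f 0 u v = (v - u) *\<^sub>R f u"
| "dyadic_sum f (Suc n) u v = dyadic_sum f n u ((u + v) / 2) + dyadic_sum f n ((u + v) / 2) v"

lemma dyadic_sum_integral: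
  fixes f :: "real \<Rightarrow> 'a::banach"
  assumes "u \<le> v" and "\<And>s t. s \<in> {u..v} \<Longrightarrow> t \<in> {u..v} \<Longrightarrow> norm (f s - f t) \<le> C * \<bar>s - t\<bar>"
    and C: "0 \<le> C"
  shows "norm (dyadic_sum f n u v - integral {u..v} f) \<le> C * (v - u)\<^sup>2 / 2 ^ n"
  using assms(1,2)
proof (induction n arbitrary: u v)
  case 0
  have lip: "C-lipschitz_on {u..v} f"
    using 0 C by (intro lipschitz_onI) (auto simp: dist_norm)
  then have int: "f integrable_on {u..v}"
    by (intro integrable_continuous_real lipschitz_on_continuous_on)
  have "norm (integral {u..v} (\<lambda>s. f u - f s)) \<le> (C * (v - u)) * (v - u)"
  proof (rule integral_bound[OF 0(1)])
    show "continuous_on {u..v} (\<lambda>s. f u - f s)"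
      by (intro continuous_intros lipschitz_on_continuous_on[OF lip])
    show "norm (f u - f s) \<le> C * (v - u)" if "s \<in> {u..v}" for s
      using 0(2)[of u s] that C 0(1)
      by (smt (verit, best) atLeastAtMost_iff mult_left_mono)
  qed
  moreover have "integral {u..v} (\<lambda>s. f u - f s) = (v - u) *\<^sub>R f u - integral {u..v} f"
    using int 0(1) by (subst integral_diff) auto
  ultimately show ?case by (simp add: power2_eq_square mult_ac)
next
  case (Suc n)
  define m where "m = (u + v) / 2"
  have m: "u \<le> m" "m \<le> v" "m - u = (v - u) / 2" "v - m = (v - u) / 2"
    using Suc.prems(1) by (auto simp: m_def field_simps)
  have lip: "C-lipschitz_on {u..v} f"
    using Suc.prems C by (intro lipschitz_onI) (auto simp: dist_norm)
  then have int: "f integrable_on {u..v}"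
    by (intro integrable_continuous_real lipschitz_on_continuous_on)
  have split: "integral {u..v} f = integral {u..m} f + integral {m..v} f"
    using Henstock_Kurzweil_Integration.integral_combine[OF m(1,2) int] by simp
  have "norm (dyadic_sum f n u m - integral {u..m} f) \<le> C * (m - u)\<^sup>2 / 2 ^ n"
    by (rule Suc.IH) (use m Suc.prems in auto)
  moreover have "norm (dyadic_sum f n m v - integral {m..v} f) \<le> C * (v - m)\<^sup>2 / 2 ^ n"
    by (rule Suc.IH) (use m Suc.prems in auto)
  ultimately have "norm ((dyadic_sum f n u m - integral {u..m} f) + (dyadic_sum f n m v - integral {m..v} f))
      \<le> C * (m - u)\<^sup>2 / 2 ^ n + C * (v - m)\<^sup>2 / 2 ^ n"
    by (meson add_mono norm_triangle_ineq order_trans)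
  also have "\<dots> = C * (v - u)\<^sup>2 / 2 ^ Suc n"
    unfolding m(3,4) by (simp add: power2_eq_square field_simps)
  finally show ?case
    unfolding split by (simp add: m_def [symmetric] algebra_simps)
qed

text \<open>
  A normed ideal carries its own norm, finer than the operator norm, and depends on a parameter
  that is fixed only inside a proof. It is therefore treated as a subset of an ambient Banach space
  together with a norm for which it is complete; integrals can be taken in the ambient space and
  then shown to lie in the subset.
\<close>

locale complete_normed_subspace =
  fixes K :: "'a::banach set" and nK :: "'a \<Rightarrow> real"
  assumes zero_mem: "0 \<in> K"
    and add_mem: "x \<in> K \<Longrightarrow> y \<in> K \<Longrightarrow> x + y \<in> K"
    and scale_mem: "x \<in> K \<Longrightarrow> c *\<^sub>R x \<in> K"
    and norm_le: "x \<in> K \<Longrightarrow> norm x \<le> nK x"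
    and triangle: "x \<in> K \<Longrightarrow> y \<in> K \<Longrightarrow> nK (x + y) \<le> nK x + nK y"
    and nK_scale: "x \<in> K \<Longrightarrow> nK (c *\<^sub>R x) = \<bar>c\<bar> * nK x"
    and complete: "(\<And>n. S n \<in> K) \<Longrightarrow>
      (\<And>e. 0 < e \<Longrightarrow> \<exists>N. \<forall>m\<ge>N. \<forall>n\<ge>N. nK (S m - S n) < e) \<Longrightarrow>
      \<exists>L\<in>K. (\<lambda>n. nK (S n - L)) \<longlonglongrightarrow> 0"
begin

lemma minus_mem: "x \<in> K \<Longrightarrow> - x \<in> K"
  using scale_mem[of x "-1"] by simp

lemma diff_mem: "x \<in> K \<Longrightarrow> y \<in> K \<Longrightarrow> x - y \<in> K"
  using add_mem[OF _ minus_mem, of x y] by simp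

lemma nK_minus: "x \<in> K \<Longrightarrow> nK (- x) = nK x"
  using nK_scale[of x "-1"] by simp

lemma nK_minus_commute: "x - y \<in> K \<Longrightarrow> nK (y - x) = nK (x - y)"
  using nK_minus[of "x - y"] by simp

lemma nK_zero: "nK 0 = 0"
  using nK_scale[OF zero_mem, of 0] by simp

lemma nK_nonneg: "x \<in> K \<Longrightarrow> 0 \<le> nK x"
  using norm_le[of x] norm_ge_zero[of x] by linarith

lemma triangle_diff: "x \<in> K \<Longrightarrow> y \<in> K \<Longrightarrow> nK (x - y) \<le> nK x + nK y"
  using triangle[of x "- y"] nK_minus[of y] minus_mem[of y] by simp

lemma nK_reverse_triangle: "x \<in> K \<Longrightarrow> y \<in> K \<Longrightarrow> \<bar>nK x - nK y\<bar> \<le> nK (x - y)"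
  using triangle[of "x - y" y] triangle[of "y - x" x] diff_mem[of x y] diff_mem[of y x]
    nK_minus_commute[of x y] by auto

lemma triangle3: "x - y \<in> K \<Longrightarrow> y - z \<in> K \<Longrightarrow> nK (x - z) \<le> nK (x - y) + nK (y - z)"
  using triangle[of "x - y" "y - z"] by simp

lemma diff_trans: "x - y \<in> K \<Longrightarrow> y - z \<in> K \<Longrightarrow> x - z \<in> K"
  using add_mem[of "x - y" "y - z"] by simp

text \<open>
  Convergence for the finer norm and for the ambient norm cannot have different limits. This is how
  limits produced by completeness of the subspace are identified below.
\<close>

lemma nK_limit_unique:
  assumes "\<And>n. S n - x \<in> K" "(\<lambda>n. nK (S n - x)) \<longlonglongrightarrow> 0" "S \<longlonglongrightarrow> y"
  shows "x = y"
proof -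
  have "(\<lambda>n. S n - x) \<longlonglongrightarrow> 0"
    by (rule Lim_null_comparison[OF _ assms(2)]) (simp add: norm_le assms(1))
  then have "S \<longlonglongrightarrow> x" by (simp add: LIM_zero_iff)
  from this assms(3) show ?thesis by (rule LIMSEQ_unique)
qed

lemma nK_bound_limit:
  assumes "\<And>n. S n \<in> K" "x \<in> K" "(\<lambda>n. nK (S n - x)) \<longlonglongrightarrow> 0" "\<And>n. nK (S n) \<le> B"
  shows "nK x \<le> B"
proof -
  have "(\<lambda>n. nK (S n - x) + B) \<longlonglongrightarrow> 0 + B" by (intro tendsto_intros assms(3))
  moreover have "nK x \<le> nK (S n - x) + B" for n
    using triangle_diff[of "S n" "S n - x"] assms(1)[of n] assms(2) assms(4)[of n] diff_mem[of "S n" x] by simp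
  ultimately have "nK x \<le> 0 + B"
    by (intro LIMSEQ_le_const[where a = "nK x"]) auto
  then show ?thesis by simp
qed

lemma geometric_limit:
  assumes S: "\<And>n. S (Suc n) - S n \<in> K" "S 0 \<in> K"
    and bound: "\<And>n. nK (S (Suc n) - S n) \<le> c * q ^ n" and q: "0 \<le> q" "q < 1"
  shows "\<exists>L\<in>K. (\<lambda>n. nK (S n - L)) \<longlonglongrightarrow> 0 \<and> (\<forall>n. nK (S n - L) \<le> c * q ^ n / (1 - q))"
proof -
  have SK: "S n \<in> K" for n
  proof (induction n)
    case (Suc n)
    then show ?case using add_mem[OF S(1)[of n] Suc] by simp
  qed (rule S(2))
  have c: "0 \<le> c"
    using order_trans[OF nK_nonneg[OF S(1)[of 0]] bound[of 0]] by simp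
  have step: "nK (S (n + k) - S n) \<le> c * q ^ n * (1 - q ^ k) / (1 - q)" for n k
  proof (induction k)
    case (Suc k)
    have "nK (S (n + Suc k) - S n) \<le> nK (S (Suc (n + k)) - S (n + k)) + nK (S (n + k) - S n)"
      using triangle3[of "S (Suc (n + k))" "S (n + k)" "S n"] by (simp add: SK diff_mem)
    also have "\<dots> \<le> c * q ^ (n + k) + c * q ^ n * (1 - q ^ k) / (1 - q)"
      by (rule add_mono[OF bound Suc])
    also have "\<dots> = c * q ^ n * (1 - q ^ Suc k) / (1 - q)"
      using q by (simp add: field_simps power_add)
    finally show ?case .
  qed (simp add: nK_zero)
  have far: "nK (S (n + k) - S n) \<le> c * q ^ n / (1 - q)" for n k
  proof -
    have "c * q ^ n * (1 - q ^ k) / (1 - q) \<le> c * q ^ n * 1 / (1 - q)"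
      using q c by (intro divide_right_mono mult_left_mono) auto
    with step[of n k] show ?thesis by simp
  qed
  have lim0: "(\<lambda>n. c * q ^ n / (1 - q)) \<longlonglongrightarrow> 0"
    using q by (auto intro!: tendsto_eq_intros LIMSEQ_realpow_zero)
  have "\<exists>L\<in>K. (\<lambda>n. nK (S n - L)) \<longlonglongrightarrow> 0"
  proof (rule complete[OF SK])
    fix e :: real assume "0 < e"
    then obtain N where N: "\<And>n. n \<ge> N \<Longrightarrow> c * q ^ n / (1 - q) < e / 2"
      using order_tendstoD(2)[OF lim0, of "e / 2"] by (auto simp: eventually_sequentially)
    have "nK (S m - S n) < e" if "m \<ge> N" "n \<ge> N" for m n
    proof -
      have "nK (S m - S n) \<le> nK (S m - S N) + nK (S N - S n)"
        by (rule triangle3) (simp_all add: SK diff_mem)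
      also have "nK (S N - S n) = nK (S n - S N)"
        by (rule nK_minus_commute) (simp add: SK diff_mem)
      also have "nK (S m - S N) + nK (S n - S N) < e"
      proof -
        have "nK (S m - S N) \<le> c * q ^ N / (1 - q)" using far[of N "m - N"] that(1) by simp
        moreover have "nK (S n - S N) \<le> c * q ^ N / (1 - q)" using far[of N "n - N"] that(2) by simp
        ultimately show ?thesis using N[OF order_refl] by linarith
      qed
      finally show ?thesis .
    qed
    then show "\<exists>N. \<forall>m\<ge>N. \<forall>n\<ge>N. nK (S m - S n) < e" by blast
  qed
  then obtain L where L: "L \<in> K" "(\<lambda>n. nK (S n - L)) \<longlonglongrightarrow> 0" by blast
  have "nK (S n - L) \<le> c * q ^ n / (1 - q)" for n
  proof -
    have lim: "(\<lambda>k. nK (S (k + n) - L) + c * q ^ n / (1 - q)) \<longlonglongrightarrow> 0 + c * q ^ n / (1 - q)"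
      by (intro tendsto_intros LIMSEQ_ignore_initial_segment L(2))
    have "nK (S n - L) \<le> nK (S (k + n) - L) + c * q ^ n / (1 - q)" for k
      using triangle3[of "S n" "S (k + n)" L] far[of n k] nK_minus_commute[of "S (k + n)" "S n"]
      by (simp add: SK diff_mem L add.commute)
    then show ?thesis using LIMSEQ_le_const[OF lim] by auto
  qed
  with L show ?thesis by blast
qed

lemma dyadic_sum_mem:
  "u \<le> v \<Longrightarrow> (\<And>s. s \<in> {u..v} \<Longrightarrow> f s \<in> K) \<Longrightarrow> dyadic_sum f n u v \<in> K"
proof (induction n arbitrary: u v)
  case (Suc n)
  then show ?case by (auto intro!: add_mem Suc.IH)
qed (simp add: scale_mem)

lemma dyadic_sum_bound:
  "u \<le> v \<Longrightarrow> (\<And>s. s \<in> {u..v} \<Longrightarrow> f s \<in> K \<and> nK (f s) \<le> M) \<Longrightarrow> nK (dyadic_sum f n u v) \<le> M * (v - u)"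
proof (induction n arbitrary: u v)
  case 0
  have "f u \<in> K \<and> nK (f u) \<le> M" using 0(1) by (intro 0(2)) auto
  then show ?case using 0(1) mult_left_mono[of "nK (f u)" M "v - u"] by (simp add: nK_scale mult.commute)
next
  case (Suc n)
  define m where "m = (u + v) / 2"
  have m: "u \<le> m" "m \<le> v" using Suc.prems(1) by (auto simp: m_def)
  have "nK (dyadic_sum f n u m) \<le> M * (m - u)" "nK (dyadic_sum f n m v) \<le> M * (v - m)"
    by (rule Suc.IH; use m Suc.prems(2) in auto)+
  moreover have "dyadic_sum f n u m \<in> K" "dyadic_sum f n m v \<in> K"
    by (rule dyadic_sum_mem; use m Suc.prems(2) in auto)+
  ultimately show ?case
    using triangle[of "dyadic_sum f n u m" "dyadic_sum f n m v"]
    by (simp add: m_def[symmetric] algebra_simps)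
qed

lemma dyadic_sum_step:
  assumes "u \<le> v" "\<And>s. s \<in> {u..v} \<Longrightarrow> f s \<in> K"
    "\<And>s t. s \<in> {u..v} \<Longrightarrow> t \<in> {u..v} \<Longrightarrow> nK (f s - f t) \<le> C * \<bar>s - t\<bar>"
  shows "nK (dyadic_sum f (Suc n) u v - dyadic_sum f n u v) \<le> C * (v - u)\<^sup>2 / 4 * (1 / 2) ^ n"
  using assms
proof (induction n arbitrary: u v)
  case 0
  define m where "m = (u + v) / 2"
  have m: "u \<le> m" "m \<le> v" "v - m = (v - u) / 2" "m - u = (v - u) / 2"
    using 0(1) by (auto simp: m_def field_simps)
  have e: "dyadic_sum f (Suc 0) u v - dyadic_sum f 0 u v = (v - m) *\<^sub>R (f m - f u)"
    by (simp add: m_def[symmetric] algebra_simps)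
  have "nK ((v - m) *\<^sub>R (f m - f u)) = (v - m) * nK (f m - f u)"
    using m 0(2) by (subst nK_scale) (auto intro!: diff_mem)
  also have "\<dots> \<le> (v - m) * (C * (m - u))"
    using 0(3)[of m u] m(1,2) by (intro mult_left_mono) auto
  also have "\<dots> = C * (v - u)\<^sup>2 / 4" unfolding m(3,4) by (simp add: power2_eq_square)
  finally show ?case unfolding e by simp
next
  case (Suc n)
  define m where "m = (u + v) / 2"
  have m: "u \<le> m" "m \<le> v" "m - u = (v - u) / 2" "v - m = (v - u) / 2"
    using Suc.prems(1) by (auto simp: m_def field_simps)
  let ?a = "dyadic_sum f (Suc n) u m - dyadic_sum f n u m"
  let ?b = "dyadic_sum f (Suc n) m v - dyadic_sum f n m v"
  have "nK ?a \<le> C * (m - u)\<^sup>2 / 4 * (1 / 2) ^ n" "nK ?b \<le> C * (v - m)\<^sup>2 / 4 * (1 / 2) ^ n"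
    by (rule Suc.IH; use m Suc.prems in auto)+
  moreover have "?a \<in> K" "?b \<in> K"
    by (intro diff_mem dyadic_sum_mem; use m Suc.prems in auto)+
  ultimately have "nK (?a + ?b) \<le> C * (m - u)\<^sup>2 / 4 * (1 / 2) ^ n + C * (v - m)\<^sup>2 / 4 * (1 / 2) ^ n"
    using triangle[of ?a ?b] by linarith
  also have "\<dots> = C * (v - u)\<^sup>2 / 4 * (1 / 2) ^ Suc n"
    unfolding m(3,4) by (simp add: power2_eq_square field_simps)
  also have "?a + ?b = dyadic_sum f (Suc (Suc n)) u v - dyadic_sum f (Suc n) u v"
    by (simp add: m_def[symmetric])
  finally show ?case .
qed

text \<open>
  The dyadic sums lie in \<open>K\<close>, and the bound on the change of a sum caused by halving its cells itself
  halves with each refinement. So they converge in \<open>K\<close>, necessarily to the integral, and every bound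
  on the sums passes to it.
\<close>

lemma integral_in_subspace:
  assumes uv: "u \<le> v" and f: "\<And>s. s \<in> {u..v} \<Longrightarrow> f s \<in> K"
    and lip: "\<And>s t. s \<in> {u..v} \<Longrightarrow> t \<in> {u..v} \<Longrightarrow> nK (f s - f t) \<le> C * \<bar>s - t\<bar>"
    and C: "0 \<le> C" and M: "\<And>s. s \<in> {u..v} \<Longrightarrow> nK (f s) \<le> M"
  shows "integral {u..v} f \<in> K" "nK (integral {u..v} f) \<le> M * (v - u)"
    "nK (integral {u..v} f - (v - u) *\<^sub>R f u) \<le> C * (v - u)\<^sup>2"
    "f integrable_on {u..v}"
proof -
  have "\<exists>L\<in>K. (\<lambda>n. nK (dyadic_sum f n u v - L)) \<longlonglongrightarrow> 0 \<and>
    (\<forall>n. nK (dyadic_sum f n u v - L) \<le> C * (v - u)\<^sup>2 / 4 * (1 / 2) ^ n / (1 - 1 / 2))"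
    by (rule geometric_limit[OF _ _ dyadic_sum_step[OF uv f lip]])
      (auto intro!: diff_mem dyadic_sum_mem assms simp del: dyadic_sum.simps)
  then obtain L where L: "L \<in> K" "(\<lambda>n. nK (dyadic_sum f n u v - L)) \<longlonglongrightarrow> 0"
    "\<And>n. nK (dyadic_sum f n u v - L) \<le> C * (v - u)\<^sup>2 / 4 * (1 / 2) ^ n / (1 - 1 / 2)" by blast
  have mem: "dyadic_sum f n u v \<in> K" for n
    by (rule dyadic_sum_mem) (use assms in auto)
  have nlip: "norm (f s - f t) \<le> C * \<bar>s - t\<bar>" if "s \<in> {u..v}" "t \<in> {u..v}" for s t
    using lip[OF that] norm_le[OF diff_mem[OF f f], OF that] by linarith
  show "f integrable_on {u..v}"
    by (intro integrable_continuous_real lipschitz_on_continuous_on[of C] lipschitz_onI)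
      (use nlip C in \<open>auto simp: dist_norm\<close>)
  have "(\<lambda>n. C * (v - u)\<^sup>2 / 2 ^ n) \<longlonglongrightarrow> 0"
    using LIMSEQ_divide_realpow_zero[of 2 "C * (v - u)\<^sup>2"] by simp
  then have "(\<lambda>n. dyadic_sum f n u v - integral {u..v} f) \<longlonglongrightarrow> 0"
    by (rule Lim_null_comparison[rotated])
      (use dyadic_sum_integral[OF uv nlip C] in auto)
  then have "(\<lambda>n. dyadic_sum f n u v) \<longlonglongrightarrow> integral {u..v} f" by (simp add: LIM_zero_iff)
  then have eq: "L = integral {u..v} f"
    by (rule nK_limit_unique[rotated 2]) (use L mem diff_mem in auto)
  show "integral {u..v} f \<in> K" using L(1) eq by simp
  show "nK (integral {u..v} f) \<le> M * (v - u)"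
    using nK_bound_limit[OF mem L(1,2)] dyadic_sum_bound[OF uv] f M unfolding eq by blast
  have "nK (dyadic_sum f 0 u v - L) \<le> C * (v - u)\<^sup>2"
    using L(3)[of 0] mult_nonneg_nonneg[OF C zero_le_power2[of "v - u"]] by simp
  moreover have "dyadic_sum f 0 u v - L \<in> K" using L(1) mem diff_mem by blast
  ultimately show "nK (integral {u..v} f - (v - u) *\<^sub>R f u) \<le> C * (v - u)\<^sup>2"
    using nK_minus_commute[of "dyadic_sum f 0 u v" L] eq by simp
qed

text \<open>
  Picard iteration inside the ball of radius \<open>r\<close> around \<open>x0\<close> in \<open>x0 + K\<close>, where \<open>V\<close> takes values in \<open>K\<close>.
  The solution is described by a quadratic bound on its first-order Taylor remainder, uniform in
  both times. For a Lipschitz vector field this costs nothing; it yields the derivative for \<open>nK\<close> as well as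
  for the ambient norm and, unlike a derivative, is easy to pass to limits and to glue at endpoints.
\<close>

lemma picard_local:
  fixes V :: "real \<Rightarrow> 'a \<Rightarrow> 'a" and x0 :: 'a and t0 h r L M N :: real
  defines "I \<equiv> {t0..t0 + h}" and "D \<equiv> {x. x - x0 \<in> K \<and> nK (x - x0) \<le> r}"
  assumes VK: "\<And>t x. t \<in> I \<Longrightarrow> x \<in> D \<Longrightarrow> V t x \<in> K"
    and VM: "\<And>t x. t \<in> I \<Longrightarrow> x \<in> D \<Longrightarrow> nK (V t x) \<le> M"
    and VL: "\<And>t x y. t \<in> I \<Longrightarrow> x \<in> D \<Longrightarrow> y \<in> D \<Longrightarrow> nK (V t x - V t y) \<le> L * nK (x - y)"
    and VN: "\<And>s t x. s \<in> I \<Longrightarrow> t \<in> I \<Longrightarrow> x \<in> D \<Longrightarrow> nK (V s x - V t x) \<le> N * \<bar>s - t\<bar>"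
    and h: "0 \<le> h" and r: "0 \<le> r" and N: "0 \<le> N" and L: "0 \<le> L" and M: "0 \<le> M"
    and hM: "h * M \<le> r" and hL: "h * L \<le> 1 / 2"
  shows "\<exists>x. x t0 = x0 \<and> (\<forall>t\<in>I. x t \<in> D) \<and>
    (\<forall>s\<in>I. \<forall>t\<in>I. nK (x s - x t - (s - t) *\<^sub>R V t (x t)) \<le> 2 * (N + L * M) * (s - t)\<^sup>2)"
proof -
  define C where "C = N + L * M"
  have C: "0 \<le> C" using N L M by (simp add: C_def)
  (* Admissible curves: they stay in the ball and are Lipschitz with the bound M of V, so that
     s \<mapsto> V s (x s) is Lipschitz with constant C and can be integrated in K. *)
  define adm where "adm x \<longleftrightarrow> x t0 = x0 \<and> (\<forall>t\<in>I. x t \<in> D) \<and>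
      (\<forall>s\<in>I. \<forall>t\<in>I. nK (x s - x t) \<le> M * \<bar>s - t\<bar>)" for x :: "real \<Rightarrow> 'a"
  define P where "P x t = x0 + integral {t0..t} (\<lambda>s. V s (x s))" for x t
  have D_diff: "x - y \<in> K" if "x \<in> D" "y \<in> D" for x y
    using diff_mem[of "x - x0" "y - x0"] that by (auto simp: D_def)
  have f_lip: "nK (V s (x s) - V t (x t)) \<le> C * \<bar>s - t\<bar>" if "adm x" "s \<in> I" "t \<in> I" for x s t
  proof -
    have xD: "x s \<in> D" "x t \<in> D" using that by (auto simp: adm_def)
    have "nK (V s (x s) - V t (x t)) \<le> nK (V s (x s) - V t (x s)) + nK (V t (x s) - V t (x t))"
      using that xD by (intro triangle3 diff_mem VK)
    also have "nK (V s (x s) - V t (x s)) \<le> N * \<bar>s - t\<bar>" using that xD by (intro VN)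
    also have "nK (V t (x s) - V t (x t)) \<le> L * nK (x s - x t)" using that xD by (intro VL)
    also have "L * nK (x s - x t) \<le> L * (M * \<bar>s - t\<bar>)"
      using that L by (intro mult_left_mono) (auto simp: adm_def)
    finally show ?thesis by (simp add: C_def algebra_simps)
  qed
  have P_step: "P x t - P x s \<in> K \<and> nK (P x t - P x s) \<le> M * (t - s) \<and>
      nK (P x t - P x s - (t - s) *\<^sub>R V s (x s)) \<le> C * (t - s)\<^sup>2"
    if x: "adm x" and st: "s \<in> I" "t \<in> I" "s \<le> t" for x s t
  proof -
    let ?f = "\<lambda>s. V s (x s)"
    have sub: "a \<in> I" if "a \<in> {s..t} \<or> a \<in> {t0..t}" for a using that st by (auto simp: I_def)
    have fD: "?f a \<in> K" "nK (?f a) \<le> M" if "a \<in> I" for a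
      using x that VK[of a "x a"] VM[of a "x a"] by (auto simp: adm_def)
    have t0: "t0 \<le> s" "t0 \<le> t" using st by (auto simp: I_def)
    have "?f integrable_on {t0..t}"
      by (rule integral_in_subspace[of _ _ ?f C M]) (use t0 sub fD f_lip[OF x] C in auto)
    then have "integral {t0..t} ?f = integral {t0..s} ?f + integral {s..t} ?f"
      using Henstock_Kurzweil_Integration.integral_combine[of t0 s t ?f] t0 st by simp
    then have e: "P x t - P x s = integral {s..t} ?f" by (simp add: P_def)
    show ?thesis
      unfolding e using integral_in_subspace[of s t ?f C M] st(3) sub fD f_lip[OF x] C by auto
  qed
  have t0I: "t0 \<in> I" using h by (simp add: I_def)
  have P_t0: "P x t0 = x0" for x by (simp add: P_def)
  have adm_P: "adm (P x)" if x: "adm x" for x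
    unfolding adm_def
  proof (intro conjI ballI P_t0)
    fix t assume t: "t \<in> I"
    then have "t0 \<le> t" "t - t0 \<le> h" by (auto simp: I_def)
    then have "M * (t - t0) \<le> r" using hM M mult_left_mono[of "t - t0" h M] by (simp add: mult.commute)
    then show "P x t \<in> D"
      using P_step[OF x t0I t \<open>t0 \<le> t\<close>] by (auto simp: D_def P_t0)
  next
    fix s t assume st: "s \<in> I" "t \<in> I"
    show "nK (P x s - P x t) \<le> M * \<bar>s - t\<bar>"
    proof (cases "s \<le> t")
      case True
      then show ?thesis
        using P_step[OF x st True] nK_minus_commute[of "P x t" "P x s"] by simp
    qed (use P_step[OF x st(2,1)] in simp)
  qed
  have P_est: "nK (P x s - P x t - (s - t) *\<^sub>R V t (x t)) \<le> 2 * C * (s - t)\<^sup>2"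
    if x: "adm x" and st: "s \<in> I" "t \<in> I" for x s t
  proof (cases "t \<le> s")
    case True
    then show ?thesis
      using P_step[OF x st(2,1) True] mult_nonneg_nonneg[OF C zero_le_power2[of "s - t"]] by simp
  next
    case False
    then have le: "s \<le> t" by simp
    have fK: "V s (x s) \<in> K" "V t (x t) \<in> K" using x st by (auto simp: adm_def intro: VK)
    have res: "P x t - P x s - (t - s) *\<^sub>R V s (x s) \<in> K"
      using P_step[OF x st le] by (intro diff_mem[OF _ scale_mem[OF fK(1)]]) blast
    have "P x s - P x t - (s - t) *\<^sub>R V t (x t)
        = - (P x t - P x s - (t - s) *\<^sub>R V s (x s)) + (t - s) *\<^sub>R (V t (x t) - V s (x s))"
      by (simp add: algebra_simps)
    also have "nK \<dots> \<le> nK (- (P x t - P x s - (t - s) *\<^sub>R V s (x s)))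
        + nK ((t - s) *\<^sub>R (V t (x t) - V s (x s)))"
      using res fK by (intro triangle minus_mem[OF res] scale_mem diff_mem)
    also have "nK (- (P x t - P x s - (t - s) *\<^sub>R V s (x s))) \<le> C * (t - s)\<^sup>2"
      using P_step[OF x st le] nK_minus[OF res] by simp
    also have "nK ((t - s) *\<^sub>R (V t (x t) - V s (x s))) \<le> (t - s) * (C * (t - s))"
      using f_lip[OF x st(2,1)] fK le by (simp add: nK_scale diff_mem mult_left_mono)
    finally show ?thesis by (simp add: power2_eq_square algebra_simps)
  qed
  define xs where "xs = rec_nat (\<lambda>t. x0) (\<lambda>n. P)"
  have xs0: "xs 0 = (\<lambda>t. x0)" and xsS: "xs (Suc n) = P (xs n)" for n
    by (simp_all add: xs_def)
  have adm: "adm (xs n)" for n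
  proof (induction n)
    case 0
    then show ?case using zero_mem nK_zero r M by (auto simp: xs0 adm_def D_def)
  qed (simp add: xsS adm_P)
  have xsD: "xs n t \<in> D" if "t \<in> I" for n t using adm[of n] that by (auto simp: adm_def)
  have contract: "nK (xs (Suc n) t - xs n t) \<le> r * (1 / 2) ^ n" if "t \<in> I" for n t
    using that
  proof (induction n arbitrary: t)
    case 0
    have "nK (P (xs 0) t - x0) \<le> r" using adm_P[OF adm[of 0]] 0 by (auto simp: adm_def D_def)
    then show ?case by (simp add: xsS xs0)
  next
    case (Suc n)
    let ?g = "\<lambda>s. V s (xs (Suc n) s) - V s (xs n s)"
    let ?d = "r * (1 / 2) ^ n"
    have sub: "a \<in> I" if "a \<in> {t0..t}" for a
      using Suc.prems that by (auto simp: I_def)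
    have t: "t0 \<le> t" "t - t0 \<le> h" using Suc.prems by (auto simp: I_def)
    have fK: "V s (xs m s) \<in> K" if "s \<in> I" for s m using VK xsD that by auto
    have int: "(\<lambda>s. V s (xs m s)) integrable_on {t0..t}" for m
      by (rule integral_in_subspace[of _ _ _ C M])
        (use t sub fK f_lip[OF adm] C VM xsD in auto)
    have "nK (integral {t0..t} ?g) \<le> (L * ?d) * (t - t0)"
    proof (rule integral_in_subspace(2)[of _ _ _ "2 * C"])
      show "nK (?g s) \<le> L * ?d" if "s \<in> {t0..t}" for s
      proof -
        have "nK (?g s) \<le> L * nK (xs (Suc n) s - xs n s)" using sub[OF that] xsD by (intro VL)
        also have "\<dots> \<le> L * ?d" using Suc.IH[OF sub[OF that]] L by (intro mult_left_mono)
        finally show ?thesis .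
      qed
      show "nK (?g a - ?g b) \<le> 2 * C * \<bar>a - b\<bar>" if "a \<in> {t0..t}" "b \<in> {t0..t}" for a b
      proof -
        have "?g a - ?g b = (V a (xs (Suc n) a) - V b (xs (Suc n) b)) - (V a (xs n a) - V b (xs n b))"
          by simp
        also have "nK \<dots> \<le> nK (V a (xs (Suc n) a) - V b (xs (Suc n) b)) + nK (V a (xs n a) - V b (xs n b))"
          using sub that fK by (intro triangle_diff diff_mem) auto
        also have "\<dots> \<le> C * \<bar>a - b\<bar> + C * \<bar>a - b\<bar>"
          using sub that by (intro add_mono f_lip adm) auto
        finally show ?thesis by simp
      qed
    qed (use t C sub fK diff_mem in auto)
    also have "(L * ?d) * (t - t0) \<le> (L * ?d) * h" using t L r by (intro mult_left_mono) auto
    also have "\<dots> = (h * L) * ?d" by simp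
    also have "\<dots> \<le> 1 / 2 * ?d" using hL r by (intro mult_right_mono) auto
    also have "integral {t0..t} ?g = xs (Suc (Suc n)) t - xs (Suc n) t"
      using int[of "Suc n"] int[of n] by (subst integral_diff) (simp_all add: xsS P_def[abs_def])
    finally show ?case by simp
  qed
  have "\<exists>l. l \<in> K \<and> (\<lambda>n. nK ((xs n t - x0) - l)) \<longlonglongrightarrow> 0" if t: "t \<in> I" for t
  proof -
    have "\<exists>l\<in>K. (\<lambda>n. nK ((xs n t - x0) - l)) \<longlonglongrightarrow> 0 \<and> (\<forall>n. nK ((xs n t - x0) - l) \<le> r * (1 / 2) ^ n / (1 - 1 / 2))"
      by (rule geometric_limit) (use contract[OF t] D_diff xsD[OF t] in \<open>auto simp: D_def\<close>)
    then show ?thesis by blast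
  qed
  then obtain l where l: "\<And>t. t \<in> I \<Longrightarrow> l t \<in> K" "\<And>t. t \<in> I \<Longrightarrow> (\<lambda>n. nK ((xs n t - x0) - l t)) \<longlonglongrightarrow> 0"
    by metis
  define x where "x t = (if t = t0 then x0 else x0 + l t)" for t
  have lim: "(\<lambda>n. nK (xs n t - x t)) \<longlonglongrightarrow> 0" if "t \<in> I" for t
    using l(2)[OF that] adm nK_zero by (auto simp: x_def adm_def algebra_simps)
  have xK: "x t - x0 \<in> K" if "t \<in> I" for t using l(1)[OF that] zero_mem by (auto simp: x_def)
  have xD: "x t \<in> D" if t: "t \<in> I" for t
  proof -
    have "nK (x t - x0) \<le> r"
      by (rule nK_bound_limit[where S = "\<lambda>n. xs n t - x0"])
        (use xsD[OF t] xK[OF t] lim[OF t] in \<open>auto simp: D_def algebra_simps\<close>)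
    with xK[OF t] show ?thesis by (simp add: D_def)
  qed
  have "nK (x s - x t - (s - t) *\<^sub>R V t (x t)) \<le> 2 * C * (s - t)\<^sup>2" if st: "s \<in> I" "t \<in> I" for s t
  proof (rule nK_bound_limit[where S = "\<lambda>n. xs (Suc n) s - xs (Suc n) t - (s - t) *\<^sub>R V t (xs n t)"])
    show "xs (Suc n) s - xs (Suc n) t - (s - t) *\<^sub>R V t (xs n t) \<in> K" for n
      using st xsD by (intro diff_mem scale_mem VK D_diff)
    show "x s - x t - (s - t) *\<^sub>R V t (x t) \<in> K"
      using st xD by (intro diff_mem scale_mem VK D_diff)
    show "nK (xs (Suc n) s - xs (Suc n) t - (s - t) *\<^sub>R V t (xs n t)) \<le> 2 * C * (s - t)\<^sup>2" for n
      using P_est[OF adm st] by (simp add: xsS)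
    (* The Taylor remainders of the iterates converge to that of the limit in nK. *)
    let ?R = "\<lambda>n. xs (Suc n) s - xs (Suc n) t - (s - t) *\<^sub>R V t (xs n t) - (x s - x t - (s - t) *\<^sub>R V t (x t))"
    let ?b = "\<lambda>n. nK (xs (Suc n) s - x s) + nK (xs (Suc n) t - x t) + \<bar>s - t\<bar> * (L * nK (xs n t - x t))"
    have mem: "?R n \<in> K" for n
      using st xsD xD by (intro diff_mem scale_mem VK D_diff)
    have "nK (?R n) \<le> ?b n" for n
    proof -
      have "?R n = ((xs (Suc n) s - x s) - (xs (Suc n) t - x t)) - (s - t) *\<^sub>R (V t (xs n t) - V t (x t))"
        by (simp add: algebra_simps)
      also have "nK \<dots> \<le> nK ((xs (Suc n) s - x s) - (xs (Suc n) t - x t))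
          + nK ((s - t) *\<^sub>R (V t (xs n t) - V t (x t)))"
        using st xsD xD by (intro triangle_diff diff_mem scale_mem VK D_diff)
      also have "nK ((xs (Suc n) s - x s) - (xs (Suc n) t - x t)) \<le> nK (xs (Suc n) s - x s) + nK (xs (Suc n) t - x t)"
        using st xsD xD by (intro triangle_diff D_diff)
      also have "nK ((s - t) *\<^sub>R (V t (xs n t) - V t (x t))) = \<bar>s - t\<bar> * nK (V t (xs n t) - V t (x t))"
        using st xsD xD by (intro nK_scale diff_mem VK)
      also have "\<dots> \<le> \<bar>s - t\<bar> * (L * nK (xs n t - x t))"
        using st xsD xD by (intro mult_left_mono VL) auto
      finally show ?thesis by simp
    qed
    moreover have "?b \<longlonglongrightarrow> 0 + 0 + \<bar>s - t\<bar> * (L * 0)"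
      by (intro tendsto_intros LIMSEQ_Suc lim st)
    ultimately show "(\<lambda>n. nK (?R n)) \<longlonglongrightarrow> 0"
      using nK_nonneg[OF mem]
      by (intro tendsto_sandwich[of "\<lambda>_. 0" "\<lambda>n. nK (?R n)" sequentially ?b 0]) auto
  qed
  then show ?thesis
    unfolding C_def using xD by (intro exI[of _ x]) (auto simp: x_def)
qed

end

section \<open>Operators on a complex Hilbert space and their adjoints\<close>

lemma real_linear_coeff_zero:
  fixes c d :: real
  assumes "\<And>t. 0 \<le> t * c + t\<^sup>2 * d"
  shows "c = 0"
proof (rule ccontr)
  assume "c \<noteq> 0"
  define e where "e = \<bar>d\<bar> + 1"
  have e: "0 < e" "d \<le> e" "d < e" by (auto simp: e_def)
  have "0 \<le> (- c / e) * c + (- c / e)\<^sup>2 * d" by (rule assms)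
  also have "\<dots> = (c\<^sup>2 / e) * (d / e - 1)"
    using e by (simp add: field_simps power2_eq_square)
  also have "\<dots> < 0"
    using e \<open>c \<noteq> 0\<close> by (intro mult_pos_neg) (auto simp: field_simps)
  finally show False by simp
qed

text \<open>
  The functional \<open>f\<close> factors through \<open>L\<close> as a bounded functional on the range of \<open>L\<close>. A minimising
  sequence of \<open>\<parallel>L x\<parallel>^2 / 2 - f x\<close> has Cauchy images under \<open>L\<close> by the parallelogram law, and the limit
  represents \<open>f\<close>. For \<open>L = id\<close> this is the Riesz theorem; for \<open>L = S*\<close> it solves \<open>S v = y\<close>; for \<open>L = |X|\<close> it
  produces the polar decomposition.
\<close>

lemma riesz_range:
  fixes L :: "'a::real_vector \<Rightarrow> 'b::{real_inner,complete_space}" and f :: "'a \<Rightarrow> real"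
  assumes L: "linear L" and f: "linear f" and bound: "\<And>x. \<bar>f x\<bar> \<le> K * norm (L x)"
  shows "\<exists>v\<in>closure (range L). \<forall>x. f x = inner v (L x)"
proof -
  define g where "g x = (norm (L x))\<^sup>2 / 2 - f x" for x
  have g_lower: "- (K\<^sup>2 / 2) \<le> g x" for x
  proof -
    have "0 \<le> (norm (L x) - K)\<^sup>2" by simp
    then show ?thesis using bound[of x] by (simp add: g_def power2_eq_square algebra_simps)
  qed
  have bdd: "bdd_below (range g)" using g_lower by (auto simp: bdd_below_def)
  define m where "m = Inf (range g)"
  have m: "m \<le> g x" for x unfolding m_def using bdd by (intro cInf_lower) auto
  have "\<exists>x. g x < m + 1 / real (Suc n)" for n
    using cInf_less_iff[of "range g" "m + 1 / real (Suc n)"] bdd by (auto simp: m_def)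
  then obtain x where x: "\<And>n. g (x n) < m + 1 / real (Suc n)" by metis
  have close: "(norm (L y - L z))\<^sup>2 \<le> 4 * (g y + g z - 2 * m)" for y z
  proof -
    have 1: "L ((1 / 2) *\<^sub>R (y + z)) = (1 / 2) *\<^sub>R (L y + L z)"
      and 2: "f ((1 / 2) *\<^sub>R (y + z)) = (f y + f z) / 2"
      using L f by (simp_all add: linear_scale linear_add)
    have "g ((1 / 2) *\<^sub>R (y + z)) = (norm (L y + L z))\<^sup>2 / 8 - (f y + f z) / 2"
      unfolding g_def 1 2 by (simp add: power_divide)
    moreover have "(norm (L y + L z))\<^sup>2 + (norm (L y - L z))\<^sup>2 = 2 * (norm (L y))\<^sup>2 + 2 * (norm (L z))\<^sup>2"
      by (simp add: power2_norm_eq_inner inner_simps inner_commute)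
    ultimately have "g y + g z - 2 * g ((1 / 2) *\<^sub>R (y + z)) = (norm (L y - L z))\<^sup>2 / 4"
      unfolding g_def by (simp add: field_simps)
    with m[of "(1 / 2) *\<^sub>R (y + z)"] show ?thesis by simp
  qed
  have "Cauchy (\<lambda>n. L (x n))"
  proof (rule metric_CauchyI)
    fix e :: real assume e: "0 < e"
    obtain N where N: "1 / real (Suc N) < e\<^sup>2 / 8"
      using nat_approx_posE[of "e\<^sup>2 / 8"] e by auto
    have "dist (L (x i)) (L (x j)) < e" if "i \<ge> N" "j \<ge> N" for i j
    proof -
      have le: "1 / real (Suc k) \<le> 1 / real (Suc N)" if "k \<ge> N" for k
        using that by (intro divide_left_mono) auto
      have "(norm (L (x i) - L (x j)))\<^sup>2 < e\<^sup>2"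
      proof -
        have "g (x i) < m + e\<^sup>2 / 8" "g (x j) < m + e\<^sup>2 / 8"
          using x[of i] x[of j] le[OF that(1)] le[OF that(2)] N by linarith+
        with close[of "x i" "x j"] show ?thesis by argo
      qed
      then show ?thesis
        using power_less_imp_less_base[of _ 2 e] e by (simp add: dist_norm)
    qed
    then show "\<exists>M. \<forall>i\<ge>M. \<forall>j\<ge>M. dist (L (x i)) (L (x j)) < e" by blast
  qed
  then obtain v where v: "(\<lambda>n. L (x n)) \<longlonglongrightarrow> v"
    using Cauchy_convergent convergent_def by blast
  have "f y = inner v (L y)" for y
  proof -
    have "0 \<le> t * (inner v (L y) - f y) + t\<^sup>2 * ((norm (L y))\<^sup>2 / 2)" for t
    proof (rule LIMSEQ_le_const)
      show "(\<lambda>n. 1 / real (Suc n) + t * (inner (L (x n)) (L y) - f y) + t\<^sup>2 * ((norm (L y))\<^sup>2 / 2))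
          \<longlonglongrightarrow> t * (inner v (L y) - f y) + t\<^sup>2 * ((norm (L y))\<^sup>2 / 2)"
        by (rule tendsto_eq_intros v LIMSEQ_Suc[OF lim_1_over_n] refl | simp)+
      show "\<exists>N. \<forall>n\<ge>N. 0 \<le> 1 / real (Suc n) + t * (inner (L (x n)) (L y) - f y) + t\<^sup>2 * ((norm (L y))\<^sup>2 / 2)"
      proof (intro exI[of _ 0] allI impI)
        fix n
        have e1: "L (x n + t *\<^sub>R y) = L (x n) + t *\<^sub>R L y" and e2: "f (x n + t *\<^sub>R y) = f (x n) + t * f y"
          using L f by (simp_all add: linear_scale linear_add)
        have "g (x n + t *\<^sub>R y) = g (x n) + t * (inner (L (x n)) (L y) - f y) + t\<^sup>2 * ((norm (L y))\<^sup>2 / 2)"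
          unfolding g_def e1 e2 power2_norm_eq_inner
          by (simp add: inner_simps inner_commute power2_eq_square algebra_simps)
        with m[of "x n + t *\<^sub>R y"] x[of n]
        show "0 \<le> 1 / real (Suc n) + t * (inner (L (x n)) (L y) - f y) + t\<^sup>2 * ((norm (L y))\<^sup>2 / 2)"
          by linarith
      qed
    qed
    from real_linear_coeff_zero[OF this] show ?thesis by simp
  qed
  moreover have "v \<in> closure (range L)"
    unfolding closure_sequential using v by (intro exI[of _ "\<lambda>n. L (x n)"]) auto
  ultimately show ?thesis by blast
qed

text \<open>
  The complex inner product is determined by the real one, so all arguments below use real inner
  products together with commutation with multiplication by \<open>\<i>\<close>.
\<close>

lemma Im_cinner: "Im (cinner x y) = inner (\<i> *\<^sub>C x) y"
proof -
  have "cinner (\<i> *\<^sub>C x) y = cnj (cinner y (\<i> *\<^sub>C x))" by (rule cinner_commute)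
  also have "\<dots> = - \<i> * cnj (cinner y x)" by (simp add: cinner_scaleC_right)
  also have "cnj (cinner y x) = cinner x y" by (rule cinner_commute[symmetric])
  finally show ?thesis by (simp add: inner_eq_Re_cinner)
qed

lemma scaleC_scaleR: "z *\<^sub>C (r *\<^sub>R x) = r *\<^sub>R (z *\<^sub>C x)"
  by (metis scaleC_of_real scaleC_scaleC mult.commute)

lemma scaleC_Re_Im: "z *\<^sub>C x = Re z *\<^sub>R x + Im z *\<^sub>R (\<i> *\<^sub>C x)"
proof -
  have "z *\<^sub>C x = (complex_of_real (Re z) + \<i> * complex_of_real (Im z)) *\<^sub>C x"
    by (simp flip: complex_eq)
  also have "\<dots> = Re z *\<^sub>R x + \<i> *\<^sub>C (Im z *\<^sub>R x)"
    by (simp only: scaleC_add_left scaleC_scaleC [symmetric] scaleC_of_real)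
  finally show ?thesis by (simp only: scaleC_scaleR)
qed

lemma scaleC_zero_left [simp]: "0 *\<^sub>C x = 0"
  using scaleC_of_real[of 0 x] by simp

lemma BH_iff: "A \<in> BH \<longleftrightarrow> (\<forall>x. A (\<i> *\<^sub>C x) = \<i> *\<^sub>C A x)"
proof
  assume *: "\<forall>x. A (\<i> *\<^sub>C x) = \<i> *\<^sub>C A x"
  have "A (z *\<^sub>C x) = z *\<^sub>C A x" for z x
    by (simp add: scaleC_Re_Im[of z x] scaleC_Re_Im[of z "A x"] blinfun.add_right blinfun.scaleR_right *)
  then show "A \<in> BH" by (simp add: BH_def)
qed (simp add: BH_def)

lemma BH_scaleC: "A \<in> BH \<Longrightarrow> A (z *\<^sub>C x) = z *\<^sub>C A x"
  by (simp add: BH_def)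

lemma inner_ii_left: "inner (\<i> *\<^sub>C x) y = - inner x (\<i> *\<^sub>C y)"
proof -
  have "inner x (\<i> *\<^sub>C y) = - Im (cinner x y)"
    by (simp add: inner_eq_Re_cinner cinner_scaleC_right)
  then show ?thesis by (simp add: Im_cinner)
qed

lemma scaleC_minus_right [simp]: "z *\<^sub>C (- x) = - (z *\<^sub>C x)"
  using scaleC_scaleR[of z "-1" x] by simp

lemma scaleC_diff_right: "z *\<^sub>C (x - y) = z *\<^sub>C x - z *\<^sub>C y"
  using scaleC_add_right[of z x "- y"] by simp

lemma BH_id [simp]: "id_blinfun \<in> BH"
  and BH_zero [simp]: "0 \<in> BH"
  and BH_scalar [simp]: "scalar_op z \<in> BH"
  and BH_add: "A \<in> BH \<Longrightarrow> B \<in> BH \<Longrightarrow> A + B \<in> BH"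
  and BH_diff: "A \<in> BH \<Longrightarrow> B \<in> BH \<Longrightarrow> A - B \<in> BH"
  and BH_scaleR: "A \<in> BH \<Longrightarrow> r *\<^sub>R A \<in> BH"
  and BH_compose: "A \<in> BH \<Longrightarrow> B \<in> BH \<Longrightarrow> A o\<^sub>L B \<in> BH"
  using scaleC_scaleR[of \<i> 0]
  by (auto simp: BH_iff blinfun.bilinear_simps scalar_op.rep_eq scaleC_add_right scaleC_diff_right scaleC_scaleR
    scaleC_scaleC mult.commute)

lemma closed_BH: "closed (BH :: ('h::chilbert_space \<Rightarrow>\<^sub>L 'h) set)"
proof -
  have cont: "continuous_on UNIV (\<lambda>A::'h \<Rightarrow>\<^sub>L 'h. z *\<^sub>C blinfun_apply A x)" for z and x :: 'h
  proof -
    have "continuous_on UNIV (\<lambda>A::'h \<Rightarrow>\<^sub>L 'h. blinfun_apply (scalar_op z) (blinfun_apply A x))"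
      by (intro continuous_intros)
    then show ?thesis by (simp add: scalar_op.rep_eq)
  qed
  show ?thesis
    unfolding BH_def by (intro closed_Collect_all closed_Collect_eq cont continuous_intros)
qed

lemma adjoint_exists:
  assumes A: "(A :: 'h::chilbert_space \<Rightarrow>\<^sub>L 'h) \<in> BH"
  shows "\<exists>B::'h \<Rightarrow>\<^sub>L 'h. B \<in> BH \<and> (\<forall>x y. inner (A x) y = inner x (B y)) \<and> norm B \<le> norm A"
proof -
  have "\<exists>v. \<forall>x. inner (A x) y = inner x v" for y :: 'h
  proof -
    have "\<exists>v\<in>closure (range (\<lambda>x. x)). \<forall>x. inner (A x) y = inner v x"
    proof (rule riesz_range)
      show "linear (\<lambda>x. inner (A x) y)"
        by (intro linearI) (auto simp: blinfun.bilinear_simps inner_simps)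
      have "\<bar>inner (A x) y\<bar> \<le> norm (A x) * norm y" for x by (rule Cauchy_Schwarz_ineq2)
      also have "norm (A x) * norm y \<le> (norm A * norm x) * norm y" for x
        by (intro mult_right_mono norm_blinfun) auto
      finally show "\<bar>inner (A x) y\<bar> \<le> (norm A * norm y) * norm x" for x by (simp add: mult_ac)
    qed (rule linear_ident)
    then show ?thesis by (auto simp: inner_commute)
  qed
  then obtain b where b: "\<And>x y. inner (A x) y = inner x (b y)" by metis
  have eqI: "u = v" if "\<And>x. inner x u = inner x v" for u v :: 'h
    using that[of "u - v"] inner_eq_zero_iff[of "u - v"] by (simp add: inner_diff_right)
  have bound: "norm (b y) \<le> norm A * norm y" for y
  proof -
    have "norm (b y) * norm (b y) = inner (A (b y)) y" by (simp add: b dot_square_norm power2_eq_square)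
    also have "\<dots> \<le> norm (A (b y)) * norm y" by (rule norm_cauchy_schwarz)
    also have "\<dots> \<le> norm A * norm (b y) * norm y" by (intro mult_right_mono norm_blinfun) auto
    finally show ?thesis by (cases "b y = 0") (auto simp: mult_ac)
  qed
  have bl: "bounded_linear b"
  proof (rule bounded_linear_intro)
    show "norm (b y) \<le> norm y * norm A" for y using bound[of y] by (simp add: mult.commute)
    show "b (y + z) = b y + b z" for y z by (rule eqI) (simp add: inner_simps flip: b)
    show "b (r *\<^sub>R y) = r *\<^sub>R b y" for r y by (rule eqI) (simp flip: b)
  qed
  have "Blinfun b \<in> BH"
    unfolding BH_iff bounded_linear_Blinfun_apply[OF bl]
  proof
    show "b (\<i> *\<^sub>C y) = \<i> *\<^sub>C b y" for y
    proof (rule eqI)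
      fix x
      have "inner x (b (\<i> *\<^sub>C y)) = - inner (\<i> *\<^sub>C A x) y" by (simp add: inner_ii_left flip: b)
      also have "\<dots> = - inner (A (\<i> *\<^sub>C x)) y" using A by (simp add: BH_iff)
      also have "\<dots> = inner x (\<i> *\<^sub>C b y)" by (simp add: b inner_ii_left)
      finally show "inner x (b (\<i> *\<^sub>C y)) = inner x (\<i> *\<^sub>C b y)" .
    qed
  qed
  moreover have "norm (Blinfun b) \<le> norm A"
    by (rule norm_blinfun_bound) (auto simp: bounded_linear_Blinfun_apply[OF bl] bound)
  ultimately show ?thesis using b by (metis bounded_linear_Blinfun_apply[OF bl])
qed

lemma cinner_adjoint_iff:
  assumes "A \<in> BH" "B \<in> BH"
  shows "(\<forall>x y. cinner (blinfun_apply A x) y = cinner x (blinfun_apply B y))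
    \<longleftrightarrow> (\<forall>x y. inner (A x) y = inner x (B y))"
proof
  assume *: "\<forall>x y. inner (A x) y = inner x (B y)"
  show "\<forall>x y. cinner (blinfun_apply A x) y = cinner x (blinfun_apply B y)"
  proof (intro allI complex_eqI)
    fix x y
    show "Re (cinner (blinfun_apply A x) y) = Re (cinner x (blinfun_apply B y))"
      using * by (simp flip: inner_eq_Re_cinner)
    have "inner (\<i> *\<^sub>C A x) y = inner (A (\<i> *\<^sub>C x)) y" using assms by (simp add: BH_iff)
    then show "Im (cinner (blinfun_apply A x) y) = Im (cinner x (blinfun_apply B y))"
      using * by (simp add: Im_cinner)
  qed
qed (simp add: inner_eq_Re_cinner)

lemma adj_op_unique:
  assumes A: "A \<in> BH" and B: "B \<in> BH" and adj: "\<And>x y. inner (A x) y = inner x (B y)"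
  shows "adj_op A = B"
  unfolding adj_op_def
proof (rule the_equality)
  show "B \<in> BH \<and> (\<forall>x y. cinner (blinfun_apply A x) y = cinner x (blinfun_apply B y))"
    using assms cinner_adjoint_iff[OF A B] by simp
  fix C assume C: "C \<in> BH \<and> (\<forall>x y. cinner (blinfun_apply A x) y = cinner x (blinfun_apply C y))"
  then have "inner x (C y) = inner x (B y)" for x y
    using cinner_adjoint_iff[OF A, of C] adj by simp
  then have "inner (C y - B y) (C y - B y) = 0" for y
    by (simp add: inner_diff_right)
  then show "C = B" by (intro blinfun_eqI) simp
qed

lemma
  assumes A: "A \<in> BH"
  shows adj_BH: "adj_op A \<in> BH" and adj_inner: "inner (A x) y = inner x (adj_op A y)"
    and adj_norm_le: "norm (adj_op A) \<le> norm A"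
proof -
  obtain B where B: "B \<in> BH" "\<And>x y. inner (A x) y = inner x (B y)" "norm B \<le> norm A"
    using adjoint_exists[OF A] by blast
  with adj_op_unique[OF A B(1,2)]
  show "adj_op A \<in> BH" "inner (A x) y = inner x (adj_op A y)" "norm (adj_op A) \<le> norm A" by auto
qed

lemma adj_diff: "A \<in> BH \<Longrightarrow> B \<in> BH \<Longrightarrow> adj_op (A - B) = adj_op A - adj_op B"
  by (rule adj_op_unique) (auto simp: adj_BH adj_inner BH_diff blinfun.bilinear_simps inner_simps)

lemma selfadjoint_iff: "selfadjoint_op A \<longleftrightarrow> A \<in> BH \<and> (\<forall>x y. inner (A x) y = inner x (A y))"
  unfolding selfadjoint_op_def using adj_op_unique[of A A] adj_inner[of A] by metis

lemma selfadjoint_BH: "selfadjoint_op A \<Longrightarrow> A \<in> BH"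
  and selfadjoint_inner: "selfadjoint_op A \<Longrightarrow> inner (A x) y = inner x (A y)"
  by (auto simp: selfadjoint_iff)

lemma selfadjoint_id: "selfadjoint_op id_blinfun"
  and selfadjoint_zero: "selfadjoint_op 0"
  and selfadjoint_add: "selfadjoint_op A \<Longrightarrow> selfadjoint_op B \<Longrightarrow> selfadjoint_op (A + B)"
  and selfadjoint_diff: "selfadjoint_op A \<Longrightarrow> selfadjoint_op B \<Longrightarrow> selfadjoint_op (A - B)"
  and selfadjoint_scaleR: "selfadjoint_op A \<Longrightarrow> selfadjoint_op (r *\<^sub>R A)"
  by (auto simp: selfadjoint_iff BH_add BH_diff BH_scaleR blinfun.bilinear_simps inner_simps)

lemma selfadjoint_compose:
  assumes "selfadjoint_op A" "selfadjoint_op B" "A o\<^sub>L B = B o\<^sub>L A"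
  shows "selfadjoint_op (A o\<^sub>L B)"
  unfolding selfadjoint_iff
proof (intro conjI allI)
  show "A o\<^sub>L B \<in> BH" using assms by (intro BH_compose selfadjoint_BH)
  fix x y
  have "inner ((A o\<^sub>L B) x) y = inner x ((B o\<^sub>L A) y)"
    using assms(1,2) by (simp add: selfadjoint_inner)
  then show "inner ((A o\<^sub>L B) x) y = inner x ((A o\<^sub>L B) y)" by (simp only: assms(3))
qed

lemma selfadjoint_adj_compose:
  assumes A: "A \<in> BH"
  shows "selfadjoint_op (adj_op A o\<^sub>L A)"
  unfolding selfadjoint_iff
proof (intro conjI allI)
  show "adj_op A o\<^sub>L A \<in> BH" using A by (intro BH_compose adj_BH)
  fix x y
  have "inner (adj_op A (A x)) y = inner (A x) (A y)"
    using adj_inner[OF A, of y "A x"] by (simp add: inner_commute)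
  then show "inner ((adj_op A o\<^sub>L A) x) y = inner x ((adj_op A o\<^sub>L A) y)"
    using adj_inner[OF A, of x "A y"] by simp
qed

text \<open>
  The lower bound for \<open>S\<close> gives injectivity and boundedness of the inverse. For surjectivity, \<open>S v = y\<close>
  means \<open>\<langle>y, x\<rangle> = \<langle>v, S* x\<rangle>\<close> for all \<open>x\<close>, and such a \<open>v\<close> exists because \<open>\<langle>y, x\<rangle>\<close> is bounded by a multiple
  of \<open>\<parallel>S* x\<parallel>\<close>.
\<close>

lemma invertible_from_below:
  assumes S: "S \<in> BH" and c: "0 < c" "\<And>x. c * norm x \<le> norm (S x)"
    and d: "0 < d" "\<And>x. d * norm x \<le> norm (adj_op S x)"
  shows "invertible_op S"
proof -
  have inj: "x = y" if "S x = S y" for x y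
    using c(2)[of "x - y"] c(1) that by (auto simp: blinfun.diff_right mult_le_0_iff)
  have "\<exists>v. S v = y" for y
  proof -
    have "\<exists>v\<in>closure (range (adj_op S)). \<forall>x. inner y x = inner v (adj_op S x)"
    proof (rule riesz_range)
      show "linear (adj_op S)" by (rule bounded_linear.linear, rule blinfun.bounded_linear_right)
      show "linear (inner y)" by (rule bounded_linear.linear[OF bounded_linear_inner_right])
      have "\<bar>inner y x\<bar> \<le> norm y * norm x" for x by (rule Cauchy_Schwarz_ineq2)
      also have "norm y * norm x \<le> norm y * (norm (adj_op S x) / d)" for x
        using d by (intro mult_left_mono) (auto simp: field_simps)
      finally show "\<bar>inner y x\<bar> \<le> (norm y / d) * norm (adj_op S x)" for x by simp
    qed
    then obtain v where "\<And>x. inner y x = inner (S v) x" by (auto simp: adj_inner[OF S])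
    then have "inner (S v - y) (S v - y) = 0" by (simp add: inner_diff_left)
    then show ?thesis by (intro exI[of _ v]) simp
  qed
  then obtain g where g: "\<And>y. S (g y) = y" by metis
  have bl: "bounded_linear g"
  proof (rule bounded_linear_intro)
    show "g (x + y) = g x + g y" for x y by (rule inj) (simp add: g blinfun.add_right)
    show "g (r *\<^sub>R x) = r *\<^sub>R g x" for r x by (rule inj) (simp add: g blinfun.scaleR_right)
    show "norm (g x) \<le> norm x * (1 / c)" for x using c(2)[of "g x"] c(1) by (simp add: g field_simps)
  qed
  note g_apply = bounded_linear_Blinfun_apply[OF bl]
  have "g (\<i> *\<^sub>C x) = \<i> *\<^sub>C g x" for x
    by (rule inj) (simp add: g BH_scaleC[OF S])
  then have "Blinfun g \<in> BH" by (simp add: BH_iff g_apply)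
  moreover have "S o\<^sub>L Blinfun g = id_blinfun" by (rule blinfun_eqI) (simp add: g_apply g)
  moreover have "Blinfun g o\<^sub>L S = id_blinfun"
    by (rule blinfun_eqI, rule inj) (simp add: g_apply g)
  ultimately show ?thesis using S by (auto simp: invertible_op_def)
qed

lemma invertible_bounded_below:
  assumes "invertible_op S"
  shows "\<exists>c>0. \<forall>x. c * norm x \<le> norm (S x)"
proof -
  obtain R where R: "R o\<^sub>L S = id_blinfun" using assms by (auto simp: invertible_op_def)
  have "1 / (norm R + 1) * norm x \<le> norm (S x)" for x
  proof -
    have "norm x = norm (R (S x))" by (metis R blinfun_apply_blinfun_compose id_blinfun.rep_eq)
    also have "\<dots> \<le> norm R * norm (S x)" by (rule norm_blinfun)
    also have "\<dots> \<le> (norm R + 1) * norm (S x)" by (intro mult_right_mono) auto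
    finally show ?thesis by (simp add: field_simps add_pos_nonneg)
  qed
  moreover have "0 < 1 / (norm R + 1)" by (simp add: add_nonneg_pos)
  ultimately show ?thesis by blast
qed

lemma compose_assoc: "(A o\<^sub>L B) o\<^sub>L C = A o\<^sub>L (B o\<^sub>L C)"
  by (rule blinfun_eqI) simp

lemma compose_id [simp]: "A o\<^sub>L id_blinfun = A" "id_blinfun o\<^sub>L A = A"
  by (auto intro: blinfun_eqI)

lemma inverse_op_props:
  assumes "invertible_op g"
  shows "inverse_op g \<in> BH" "g o\<^sub>L inverse_op g = id_blinfun" "inverse_op g o\<^sub>L g = id_blinfun"
proof -
  have "\<exists>!h. h \<in> BH \<and> g o\<^sub>L h = id_blinfun \<and> h o\<^sub>L g = id_blinfun"
  proof (rule ex_ex1I)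
    show "\<exists>h. h \<in> BH \<and> g o\<^sub>L h = id_blinfun \<and> h o\<^sub>L g = id_blinfun"
      using assms by (auto simp: invertible_op_def)
    fix h k assume h: "h \<in> BH \<and> g o\<^sub>L h = id_blinfun \<and> h o\<^sub>L g = id_blinfun"
      and k: "k \<in> BH \<and> g o\<^sub>L k = id_blinfun \<and> k o\<^sub>L g = id_blinfun"
    have "h = h o\<^sub>L (g o\<^sub>L k)" using k by simp
    also have "\<dots> = (h o\<^sub>L g) o\<^sub>L k" by (simp only: compose_assoc)
    also have "\<dots> = k" using h by simp
    finally show "h = k" .
  qed
  from theI'[OF this]
  show "inverse_op g \<in> BH" "g o\<^sub>L inverse_op g = id_blinfun" "inverse_op g o\<^sub>L g = id_blinfun"
    by (auto simp: inverse_op_def)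
qed

lemma invertible_compose:
  assumes "invertible_op A" "invertible_op B"
  shows "invertible_op (A o\<^sub>L B)"
proof -
  obtain A' B' where *: "A' \<in> BH" "A o\<^sub>L A' = id_blinfun" "A' o\<^sub>L A = id_blinfun"
    "B' \<in> BH" "B o\<^sub>L B' = id_blinfun" "B' o\<^sub>L B = id_blinfun"
    using assms by (auto simp: invertible_op_def)
  have "(A o\<^sub>L B) o\<^sub>L (B' o\<^sub>L A') = A o\<^sub>L ((B o\<^sub>L B') o\<^sub>L A')"
    "(B' o\<^sub>L A') o\<^sub>L (A o\<^sub>L B) = B' o\<^sub>L ((A' o\<^sub>L A) o\<^sub>L B)"
    by (simp_all only: compose_assoc)
  then have "(A o\<^sub>L B) o\<^sub>L (B' o\<^sub>L A') = id_blinfun" "(B' o\<^sub>L A') o\<^sub>L (A o\<^sub>L B) = id_blinfun"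
    using * by simp_all
  then show ?thesis
    using assms *(1,4) BH_compose unfolding invertible_op_def by blast
qed

section \<open>Spectrum and functional calculus of self-adjoint operators\<close>

interpretation op_compose: bounded_bilinear "(o\<^sub>L)"
  by (rule bounded_bilinear_blinfun_compose)

lemma norm_diff_scaleR_power2:
  "(norm (u - r *\<^sub>R v))\<^sup>2 = (norm u)\<^sup>2 - 2 * r * inner u v + r\<^sup>2 * (norm v)\<^sup>2" for u v :: "'a::real_inner"
  unfolding power2_norm_eq_inner
  by (simp add: inner_diff_left inner_diff_right inner_commute power2_eq_square)

lemma scalar_op_of_real: "scalar_op (complex_of_real r) = r *\<^sub>R id_blinfun"
  by (rule blinfun_eqI) (simp add: scalar_op.rep_eq scaleC_of_real blinfun.scaleR_left)

lemma scalar_op_zero [simp]: "scalar_op 0 = 0"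
  using scalar_op_of_real[of 0] by simp

lemma scalar_op_one [simp]: "scalar_op 1 = id_blinfun"
  using scalar_op_of_real[of 1] by simp

lemma scalar_op_commute: "A \<in> BH \<Longrightarrow> A o\<^sub>L scalar_op z = scalar_op z o\<^sub>L A"
  by (rule blinfun_eqI) (simp add: scalar_op.rep_eq BH_scaleC)

lemma inner_scaleC_left: "inner (z *\<^sub>C x) y = inner x (cnj z *\<^sub>C y)"
proof -
  have "inner (z *\<^sub>C x) y = Re z * inner x y - Im z * inner x (\<i> *\<^sub>C y)"
    by (subst scaleC_Re_Im) (simp add: inner_add_left inner_ii_left)
  also have "\<dots> = inner x (Re (cnj z) *\<^sub>R y + Im (cnj z) *\<^sub>R (\<i> *\<^sub>C y))"
    by (simp add: inner_diff_right)
  finally show ?thesis by (simp only: scaleC_Re_Im[of "cnj z" y])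
qed

lemma adj_minus_scalar:
  assumes "selfadjoint_op A"
  shows "adj_op (A - scalar_op z) = A - scalar_op (cnj z)"
  by (rule adj_op_unique)
    (use assms in \<open>auto simp: BH_diff selfadjoint_BH selfadjoint_inner blinfun.diff_left scalar_op.rep_eq
      inner_diff_left inner_diff_right inner_scaleC_left\<close>)

definition real_spectrum :: "('h::chilbert_space \<Rightarrow>\<^sub>L 'h) \<Rightarrow> real set" where
  "real_spectrum A = {x. complex_of_real x \<in> spectrum_op A}"

text \<open>
  A self-adjoint operator minus a real number is its own adjoint, so a lower bound is all that
  invertibility requires.
\<close>

lemma real_spectrum_iff:
  assumes A: "selfadjoint_op A"
  shows "r \<notin> real_spectrum A \<longleftrightarrow> (\<exists>c>0. \<forall>x. c * norm x \<le> norm (A x - r *\<^sub>R x))"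
proof -
  let ?S = "A - scalar_op (complex_of_real r)"
  have S: "?S x = A x - r *\<^sub>R x" for x
    by (simp add: blinfun.diff_left scalar_op.rep_eq scaleC_of_real)
  have adj: "adj_op ?S = ?S" using adj_minus_scalar[OF A, of "complex_of_real r"] by simp
  have "r \<notin> real_spectrum A \<longleftrightarrow> invertible_op ?S"
    by (simp add: real_spectrum_def spectrum_op_def)
  also have "\<dots> \<longleftrightarrow> (\<exists>c>0. \<forall>x. c * norm x \<le> norm (?S x))"
    using invertible_bounded_below[of ?S] invertible_from_below[of ?S] A
    unfolding adj by (metis BH_diff BH_scalar selfadjoint_BH)
  finally show ?thesis unfolding S .
qed

lemma selfadjoint_inner_ii: "selfadjoint_op A \<Longrightarrow> inner (A x) (\<i> *\<^sub>C x) = 0"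
  using inner_ii_left[of x "A x"] selfadjoint_inner[of A x "\<i> *\<^sub>C x"]
    BH_scaleC[OF selfadjoint_BH, of A \<i> x] inner_commute[of "A x" "\<i> *\<^sub>C x"] by simp

text \<open>
  For self-adjoint \<open>A\<close> and \<open>w = u + \<i> v\<close>, the vectors \<open>(A - u) x\<close> and \<open>\<i> v x\<close> are orthogonal, whence
  \<open>\<parallel>(A - w) x\<parallel> \<ge> |v| \<parallel>x\<parallel>\<close>; the same holds for the adjoint \<open>A - cnj w\<close>.
\<close>

lemma spectrum_selfadjoint_real:
  assumes A: "selfadjoint_op A"
  shows "spectrum_op A = complex_of_real ` real_spectrum A"
proof -
  have "invertible_op (A - scalar_op z)" if z: "Im z \<noteq> 0" for z
  proof -
    have below: "\<bar>Im w\<bar> * norm x \<le> norm ((A - scalar_op w) x)" for w x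
    proof -
      define B where "B = A - Re w *\<^sub>R id_blinfun"
      have "selfadjoint_op B"
        unfolding B_def by (intro selfadjoint_diff selfadjoint_scaleR selfadjoint_id A)
      have "(A - scalar_op w) x = B x - Im w *\<^sub>R (\<i> *\<^sub>C x)"
        by (simp add: B_def blinfun.diff_left blinfun.scaleR_left scalar_op.rep_eq scaleC_Re_Im[of w x])
      then have "(norm ((A - scalar_op w) x))\<^sup>2 = (norm (B x))\<^sup>2 + (\<bar>Im w\<bar> * norm x)\<^sup>2"
        using selfadjoint_inner_ii[OF \<open>selfadjoint_op B\<close>, of x]
        by (simp add: norm_diff_scaleR_power2 norm_scaleC power_mult_distrib)
      then have "(\<bar>Im w\<bar> * norm x)\<^sup>2 \<le> (norm ((A - scalar_op w) x))\<^sup>2" by simp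
      then show ?thesis by (rule power2_le_imp_le) simp
    qed
    show ?thesis
    proof (rule invertible_from_below)
      show "A - scalar_op z \<in> BH" using A by (intro BH_diff BH_scalar selfadjoint_BH[OF A])
      show "0 < \<bar>Im z\<bar>" using z by simp
      then show "0 < \<bar>Im z\<bar>" .
      show "\<bar>Im z\<bar> * norm x \<le> norm ((A - scalar_op z) x)" for x by (rule below)
      show "\<bar>Im z\<bar> * norm x \<le> norm (adj_op (A - scalar_op z) x)" for x
        using below[of "cnj z" x] by (simp add: adj_minus_scalar[OF A])
    qed
  qed
  then have "Im z = 0" if "z \<in> spectrum_op A" for z
    using that by (auto simp: spectrum_op_def)
  then have "z = complex_of_real (Re z)" if "z \<in> spectrum_op A" for z
    using that by (simp add: complex_eq_iff)
  then show ?thesis unfolding real_spectrum_def by (auto simp: image_iff) metis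
qed

lemma spectrum_subset_iff:
  assumes "selfadjoint_op A"
  shows "spectrum_op A \<subseteq> complex_of_real ` S \<longleftrightarrow> real_spectrum A \<subseteq> S"
  unfolding spectrum_selfadjoint_real[OF assms] by (auto simp: image_iff)

lemma real_spectrum_subset_cball:
  assumes A: "selfadjoint_op A" and bound: "\<And>x. norm (A x - m *\<^sub>R x) \<le> d * norm x"
  shows "real_spectrum A \<subseteq> {m - d..m + d}"
proof (rule subsetI, rule ccontr)
  fix r assume r: "r \<in> real_spectrum A" "r \<notin> {m - d..m + d}"
  then have pos: "0 < \<bar>r - m\<bar> - d" by auto
  have "(\<bar>r - m\<bar> - d) * norm x \<le> norm (A x - r *\<^sub>R x)" for x
  proof -
    have "\<bar>r - m\<bar> * norm x = norm ((A x - m *\<^sub>R x) - (A x - r *\<^sub>R x))"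
      by (simp add: abs_minus_commute flip: scaleR_diff_left)
    also have "\<dots> \<le> norm (A x - m *\<^sub>R x) + norm (A x - r *\<^sub>R x)" by (rule norm_triangle_ineq4)
    finally show ?thesis using bound[of x] by (simp add: algebra_simps)
  qed
  with pos r(1) show False using real_spectrum_iff[OF A, of r] by blast
qed

lemma compact_real_spectrum:
  assumes A: "selfadjoint_op A"
  shows "compact (real_spectrum A)"
proof -
  have "real_spectrum A \<subseteq> {0 - norm A..0 + norm A}"
    by (rule real_spectrum_subset_cball[OF A]) (simp add: norm_blinfun)
  then have "bounded (real_spectrum A)" using bounded_subset[OF bounded_closed_interval] by blast
  moreover have "open (- real_spectrum A)"
    unfolding open_dist
  proof safe
    fix r assume "r \<notin> real_spectrum A"
    then obtain c where c: "0 < c" "\<And>x. c * norm x \<le> norm (A x - r *\<^sub>R x)"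
      using real_spectrum_iff[OF A] by blast
    have "s \<notin> real_spectrum A" if s: "dist s r < c" for s
    proof -
      have "(c - \<bar>s - r\<bar>) * norm x \<le> norm (A x - s *\<^sub>R x)" for x
      proof -
        have "norm (A x - r *\<^sub>R x) = norm ((A x - s *\<^sub>R x) + (s - r) *\<^sub>R x)" by (simp add: algebra_simps)
        also have "\<dots> \<le> norm (A x - s *\<^sub>R x) + \<bar>s - r\<bar> * norm x"
          by (metis norm_triangle_ineq norm_scaleR)
        finally show ?thesis using c(2)[of x] by (simp add: algebra_simps)
      qed
      moreover have "0 < c - \<bar>s - r\<bar>" using s by (simp add: dist_real_def)
      ultimately show ?thesis using real_spectrum_iff[OF A] by blast
    qed
    then show "\<exists>e>0. \<forall>s. dist s r < e \<longrightarrow> s \<in> - real_spectrum A" using c(1) by blast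
  qed
  ultimately show ?thesis by (simp add: compact_eq_bounded_closed closed_def)
qed

text \<open>
  Let \<open>l = \<parallel>B\<parallel>\<close>. If neither \<open>l\<close> nor \<open>-l\<close> were in the spectrum, \<open>B^2 - l^2 = (B - l)(B + l)\<close> would be bounded
  below by some \<open>e > 0\<close>. Expanding \<open>\<parallel>(B^2 - l^2) x\<parallel>^2\<close> then gives \<open>\<parallel>B x\<parallel>^2 \<le> (l^2 - e^2 / l^2) \<parallel>x\<parallel>^2\<close>, contradicting
  the choice of \<open>l\<close>.
\<close>

lemma norm_mem_real_spectrum:
  assumes B: "selfadjoint_op B" and "B \<noteq> 0"
  shows "norm B \<in> real_spectrum B \<or> - norm B \<in> real_spectrum B"
proof (rule ccontr)
  define l where "l = norm B"
  have l: "0 < l" using \<open>B \<noteq> 0\<close> by (simp add: l_def)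
  assume "\<not> ?thesis"
  then obtain c d where c: "0 < c" "\<And>x. c * norm x \<le> norm (B x - l *\<^sub>R x)"
    and d: "0 < d" "\<And>x. d * norm x \<le> norm (B x - (- l) *\<^sub>R x)"
    using real_spectrum_iff[OF B] unfolding l_def by meson
  define e where "e = c * d"
  have e: "0 < e" using c d by (simp add: e_def)
  have ineq: "e\<^sup>2 * (norm x)\<^sup>2 \<le> l\<^sup>2 * (l\<^sup>2 * (norm x)\<^sup>2 - (norm (B x))\<^sup>2)" for x
  proof -
    have "c * (d * norm x) \<le> c * norm (B x + l *\<^sub>R x)"
      using d(2)[of x] c(1) by (intro mult_left_mono) auto
    also have "\<dots> \<le> norm (B (B x + l *\<^sub>R x) - l *\<^sub>R (B x + l *\<^sub>R x))" by (rule c(2))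
    also have "B (B x + l *\<^sub>R x) - l *\<^sub>R (B x + l *\<^sub>R x) = B (B x) - l\<^sup>2 *\<^sub>R x"
      by (simp add: blinfun.add_right blinfun.scaleR_right algebra_simps power2_eq_square)
    finally have "(e * norm x)\<^sup>2 \<le> (norm (B (B x) - l\<^sup>2 *\<^sub>R x))\<^sup>2"
      using c(1) d(1) by (intro power_mono) (auto simp: e_def mult.assoc intro!: mult_nonneg_nonneg)
    also have "\<dots> = (norm (B (B x)))\<^sup>2 - 2 * l\<^sup>2 * inner (B (B x)) x + l ^ 4 * (norm x)\<^sup>2"
      by (simp add: norm_diff_scaleR_power2 flip: power_mult)
    also have "inner (B (B x)) x = (norm (B x))\<^sup>2"
      using selfadjoint_inner[OF B, of "B x" x] by (simp add: power2_norm_eq_inner)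
    also have "(norm (B (B x)))\<^sup>2 \<le> (l * norm (B x))\<^sup>2"
      unfolding l_def by (intro power_mono norm_blinfun) auto
    finally show ?thesis by (simp add: power_mult_distrib algebra_simps power4_eq_xxxx power2_eq_square)
  qed
  define k where "k = l\<^sup>2 - e\<^sup>2 / l\<^sup>2"
  have Bk: "(norm (B x))\<^sup>2 \<le> k * (norm x)\<^sup>2" for x
    using ineq[of x] l by (simp add: k_def field_simps power2_eq_square)
  have "k < l\<^sup>2" using l e by (simp add: k_def)
  have k0: "0 \<le> k"
  proof -
    obtain x where "B x \<noteq> 0" using \<open>B \<noteq> 0\<close> by (metis blinfun_eqI zero_blinfun.rep_eq)
    then have "x \<noteq> 0" by auto
    then have "0 < (norm x)\<^sup>2" by simp
    moreover have "0 \<le> k * (norm x)\<^sup>2" using Bk[of x] zero_le_power2[of "norm (B x)"] by linarith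
    ultimately show ?thesis by (simp add: zero_le_mult_iff)
  qed
  have "norm B \<le> sqrt k"
  proof (rule norm_blinfun_bound)
    show "norm (B x) \<le> sqrt k * norm x" for x
      using real_sqrt_le_mono[OF Bk[of x]] by (simp add: real_sqrt_mult)
  qed (use k0 in simp)
  then have "l\<^sup>2 \<le> k" using l k0 power_mono[of l "sqrt k" 2] by (simp add: l_def)
  with \<open>k < l\<^sup>2\<close> show False by simp
qed

lemma poly_op_0 [simp]: "poly_op 0 A = 0"
  by (simp add: poly_op_def)

lemma poly_op_pCons: "poly_op (pCons c p) A = c *\<^sub>R id_blinfun + (A o\<^sub>L poly_op p A)"
proof (cases "p = 0")
  case False
  have "poly_op (pCons c p) A = (\<Sum>i\<le>Suc (degree p). coeff (pCons c p) i *\<^sub>R (((o\<^sub>L) A ^^ i) id_blinfun))"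
    using False by (simp add: poly_op_def)
  also have "\<dots> = c *\<^sub>R id_blinfun + (\<Sum>i\<le>degree p. (A o\<^sub>L (coeff p i *\<^sub>R (((o\<^sub>L) A ^^ i) id_blinfun))))"
    by (simp only: sum.atMost_Suc_shift) (simp add: op_compose.scaleR_right)
  also have "\<dots> = c *\<^sub>R id_blinfun + (A o\<^sub>L poly_op p A)"
    by (simp add: poly_op_def op_compose.sum_right)
  finally show ?thesis .
next
  case True
  then show ?thesis by (cases "c = 0") (simp_all add: poly_op_def)
qed

lemma poly_op_const: "poly_op [:c:] A = c *\<^sub>R id_blinfun"
  by (simp add: poly_op_pCons)

lemma poly_op_X: "poly_op [:0, 1:] A = A"
  by (simp add: poly_op_pCons)

lemma poly_op_add: "poly_op (p + q) A = poly_op p A + poly_op q A"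
  by (induction p q rule: poly_induct2)
    (simp_all add: poly_op_pCons op_compose.add_right scaleR_add_left)

lemma poly_op_smult: "poly_op (smult c p) A = c *\<^sub>R poly_op p A"
  by (induction p) (simp_all add: poly_op_pCons op_compose.scaleR_right scaleR_add_right)

lemma poly_op_diff: "poly_op (p - q) A = poly_op p A - poly_op q A"
  using poly_op_add[of p "smult (-1) q" A] poly_op_smult[of "-1" q A] by simp

lemma poly_op_mult: "poly_op (p * q) A = poly_op p A o\<^sub>L poly_op q A"
  by (induction p)
    (simp_all add: poly_op_pCons poly_op_add poly_op_smult compose_assoc op_compose.add_left
      op_compose.scaleR_left)

lemma poly_op_commute: "poly_op p A o\<^sub>L A = A o\<^sub>L poly_op p A"
  using poly_op_mult[of p "[:0, 1:]" A] poly_op_mult[of "[:0, 1:]" p A]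
  by (simp only: poly_op_X mult.commute[of p])

lemma selfadjoint_poly_op: "selfadjoint_op A \<Longrightarrow> selfadjoint_op (poly_op p A)"
  by (induction p)
    (simp_all add: selfadjoint_zero poly_op_pCons selfadjoint_add selfadjoint_scaleR selfadjoint_id
      selfadjoint_compose poly_op_commute)

text \<open>
  Complex coefficients are needed to split polynomials into linear factors; real polynomials embed
  by \<open>complex_poly_op_of_real\<close> below.
\<close>

definition complex_poly_op ::
  "complex poly \<Rightarrow> ('h::chilbert_space \<Rightarrow>\<^sub>L 'h) \<Rightarrow> ('h \<Rightarrow>\<^sub>L 'h)" where
  "complex_poly_op p A = fold_coeffs (\<lambda>c B. scalar_op c + (A o\<^sub>L B)) p 0"

lemma complex_poly_op_0 [simp]: "complex_poly_op 0 A = 0"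
  by (simp add: complex_poly_op_def)

lemma complex_poly_op_pCons:
  "complex_poly_op (pCons c p) A = scalar_op c + (A o\<^sub>L complex_poly_op p A)"
  by (cases "c = 0 \<and> p = 0") (auto simp: complex_poly_op_def)

lemma scalar_op_add: "scalar_op (z + w) = scalar_op z + scalar_op w"
  by (rule blinfun_eqI) (simp add: scalar_op.rep_eq scaleC_add_left blinfun.add_left)

lemma scalar_op_mult: "scalar_op (z * w) = scalar_op z o\<^sub>L scalar_op w"
  by (rule blinfun_eqI) (simp add: scalar_op.rep_eq scaleC_scaleC)

lemma complex_poly_op_add: "complex_poly_op (p + q) A = complex_poly_op p A + complex_poly_op q A"
  by (induction p q rule: poly_induct2)
    (simp_all add: complex_poly_op_pCons op_compose.add_right scalar_op_add)

lemma complex_poly_op_smult: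
  assumes "A \<in> BH"
  shows "complex_poly_op (smult c p) A = scalar_op c o\<^sub>L complex_poly_op p A"
proof (induction p)
  case (pCons d p)
  then show ?case
    by (simp add: complex_poly_op_pCons scalar_op_mult op_compose.add_right
      scalar_op_commute[OF assms] flip: compose_assoc)
qed simp

lemma complex_poly_op_of_real: "complex_poly_op (map_poly complex_of_real p) A = poly_op p A"
  by (induction p) (simp_all add: complex_poly_op_pCons poly_op_pCons map_poly_pCons scalar_op_of_real)

lemma scalar_op_invertible:
  assumes "z \<noteq> 0"
  shows "invertible_op (scalar_op z :: 'h::chilbert_space \<Rightarrow>\<^sub>L 'h)"
proof -
  have "scalar_op z o\<^sub>L scalar_op (inverse z) = (id_blinfun :: 'h \<Rightarrow>\<^sub>L 'h)"
    "scalar_op (inverse z) o\<^sub>L scalar_op z = (id_blinfun :: 'h \<Rightarrow>\<^sub>L 'h)"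
    using assms by (simp_all flip: scalar_op_mult)
  then show ?thesis unfolding invertible_op_def by (meson BH_scalar)
qed

lemma complex_poly_op_invertible:
  fixes A :: "'h::chilbert_space \<Rightarrow>\<^sub>L 'h"
  assumes A: "A \<in> BH" and "q \<noteq> 0" and "\<And>z. poly q z = 0 \<Longrightarrow> z \<notin> spectrum_op A"
  shows "invertible_op (complex_poly_op q A)"
  using assms(2,3)
proof (induction "degree q" arbitrary: q)
  case 0
  then obtain c where "q = [:c:]" by (metis degree_eq_zeroE)
  with 0 show ?case by (simp add: complex_poly_op_pCons scalar_op_invertible)
next
  case (Suc n)
  then have "\<not> constant (poly q)" by (simp add: constant_degree)
  then obtain z where z: "poly q z = 0" using fundamental_theorem_of_algebra by blast
  then obtain p where p: "q = [:- z, 1:] * p" by (auto simp: poly_eq_0_iff_dvd)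
  with Suc.prems(1) have p0: "p \<noteq> 0" by auto
  have "degree q = Suc (degree p)"
    unfolding p using p0 by (subst degree_mult_eq) auto
  then have "invertible_op (complex_poly_op p A)"
    using Suc.hyps p0 Suc.prems(2) by (intro Suc.hyps(1)) (auto simp: p)
  moreover have "invertible_op (A - scalar_op z)"
    using Suc.prems(2)[OF z] by (simp add: spectrum_op_def)
  moreover have "complex_poly_op q A = (A - scalar_op z) o\<^sub>L complex_poly_op p A"
  proof -
    have "complex_poly_op q A = complex_poly_op (smult (- z) p + pCons 0 p) A" by (simp add: p)
    also have "\<dots> = (scalar_op (- z) o\<^sub>L complex_poly_op p A) + (A o\<^sub>L complex_poly_op p A)"
      by (simp only: complex_poly_op_add complex_poly_op_smult[OF A] complex_poly_op_pCons
          scalar_op_zero add_0)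
    also have "scalar_op (- z) = (- scalar_op z :: 'h \<Rightarrow>\<^sub>L 'h)"
      using scalar_op_add[of z "- z"] by (simp add: add_eq_0_iff)
    finally show ?thesis by (simp add: op_compose.diff_left op_compose.minus_left)
  qed
  ultimately show ?case by (simp add: invertible_compose)
qed

lemma real_spectrum_nonempty:
  fixes A :: "'h::chilbert_space \<Rightarrow>\<^sub>L 'h"
  assumes A: "selfadjoint_op A" and x: "(x :: 'h) \<noteq> 0"
  shows "real_spectrum A \<noteq> {}"
proof (cases "A = 0")
  case True
  have "0 \<in> real_spectrum A"
  proof (rule ccontr)
    assume "0 \<notin> real_spectrum A"
    then obtain c where "0 < c" "c * norm x \<le> 0"
      using real_spectrum_iff[OF A, of 0] by (auto simp: True)
    with x show False by (simp add: mult_le_0_iff)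
  qed
  then show ?thesis by blast
qed (use norm_mem_real_spectrum[OF A] in blast)

lemma poly_map_poly_complex_of_real:
  "poly (map_poly complex_of_real p) (complex_of_real s) = complex_of_real (poly p s)"
  by (induction p) (simp_all add: map_poly_pCons)

text \<open>
  Unless \<open>p(A) = 0\<close>, one of \<open>l = \<plusminus>\<parallel>p(A)\<parallel>\<close> is in the spectrum of the self-adjoint operator \<open>p(A)\<close>. Since \<open>p(A) - l\<close> is not invertible, some
  root of \<open>p - l\<close> is in the spectrum of \<open>A\<close>, that is, \<open>l\<close> is a value of \<open>p\<close> there.
\<close>

lemma norm_poly_op_le:
  assumes A: "selfadjoint_op A" and c: "0 \<le> c"
    and bound: "\<And>s. s \<in> real_spectrum A \<Longrightarrow> \<bar>poly p s\<bar> \<le> c"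
  shows "norm (poly_op p A) \<le> c"
proof (cases "poly_op p A = 0")
  case False
  define B where "B = poly_op p A"
  have B: "selfadjoint_op B" "B \<noteq> 0" using False A by (auto simp: B_def selfadjoint_poly_op)
  obtain l where l: "l \<in> real_spectrum B" "\<bar>l\<bar> = norm B"
    using norm_mem_real_spectrum[OF B] by (metis abs_minus_cancel abs_norm_cancel)
  define q where "q = map_poly complex_of_real (p - [:l:])"
  have "complex_poly_op q A = B - scalar_op (complex_of_real l)"
    by (simp only: q_def complex_poly_op_of_real poly_op_diff poly_op_const B_def scalar_op_of_real)
  with l(1) have ninv: "\<not> invertible_op (complex_poly_op q A)"
    by (simp add: real_spectrum_def spectrum_op_def)
  have "\<exists>s\<in>real_spectrum A. poly p s = l"
  proof (cases "q = 0")
    case True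
    then have "p - [:l:] = 0" by (simp add: q_def map_poly_eq_0_iff)
    then have "poly p s = l" for s by (metis diff_eq_diff_eq diff_self eq_iff_diff_eq_0 poly_const_conv)
    moreover have "real_spectrum A \<noteq> {}"
    proof -
      obtain x where "B x \<noteq> 0" using B(2) by (metis blinfun_eqI zero_blinfun.rep_eq)
      then show ?thesis by (rule real_spectrum_nonempty[OF A])
    qed
    ultimately show ?thesis by blast
  next
    case False
    with complex_poly_op_invertible[OF selfadjoint_BH[OF A]] ninv
    obtain z where z: "poly q z = 0" "z \<in> spectrum_op A" by blast
    then obtain s where s: "s \<in> real_spectrum A" "z = complex_of_real s"
      using spectrum_selfadjoint_real[OF A] by blast
    have "poly q z = complex_of_real (poly (p - [:l:]) s)"
      unfolding q_def s(2) by (rule poly_map_poly_complex_of_real)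
    with z(1) have "poly p s = l" by simp
    with s(1) show ?thesis by blast
  qed
  then obtain s where "s \<in> real_spectrum A" "poly p s = l" by blast
  with bound[of s] l(2) show ?thesis by (simp add: B_def)
qed (use c in simp)

lemma Weierstrass_poly_sequence:
  fixes f :: "real \<Rightarrow> real"
  assumes "compact S" "continuous_on S f"
  shows "\<exists>p. uniform_limit S (\<lambda>n x. poly (p n) x) f sequentially"
proof -
  have "\<exists>p. \<forall>x\<in>S. \<bar>f x - poly p x\<bar> < 1 / real (Suc n)" for n
  proof -
    obtain g where g: "real_polynomial_function g" "\<And>x. x \<in> S \<Longrightarrow> norm (f x - g x) < 1 / real (Suc n)"
      using Stone_Weierstrass_real_polynomial_function[OF assms, of "1 / real (Suc n)"] by auto
    obtain a m where "g = (\<lambda>x. \<Sum>i\<le>m. a i * x ^ i)"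
      using g(1) real_polynomial_function_iff_sum by blast
    then have "g x = poly (\<Sum>i\<le>m. monom (a i) i) x" for x
      by (simp add: poly_sum poly_monom)
    with g(2) show ?thesis by (metis real_norm_def)
  qed
  then obtain p where p: "\<And>n x. x \<in> S \<Longrightarrow> \<bar>f x - poly (p n) x\<bar> < 1 / real (Suc n)" by metis
  have "uniform_limit S (\<lambda>n x. poly (p n) x) f sequentially"
  proof (rule uniform_limitI)
    fix e :: real assume "0 < e"
    then obtain N where N: "1 / real (Suc N) < e" using nat_approx_posE by blast
    have "\<forall>x\<in>S. dist (poly (p n) x) (f x) < e" if "n \<ge> N" for n
    proof
      fix x assume x: "x \<in> S"
      have "1 / real (Suc n) \<le> 1 / real (Suc N)" using that by (intro divide_left_mono) auto
      with p[OF x, of n] N show "dist (poly (p n) x) (f x) < e"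
        by (simp add: dist_real_def abs_minus_commute)
    qed
    then show "\<forall>\<^sub>F n in sequentially. \<forall>x\<in>S. dist (poly (p n) x) (f x) < e"
      by (auto simp: eventually_sequentially)
  qed
  then show ?thesis by blast
qed

lemma poly_op_uniform_diff:
  assumes A: "selfadjoint_op A"
    and p: "uniform_limit (real_spectrum A) (\<lambda>n x. poly (p n) x) f sequentially"
    and q: "uniform_limit (real_spectrum A) (\<lambda>n x. poly (q n) x) f sequentially"
    and e: "0 < e"
  shows "\<exists>N. \<forall>m\<ge>N. \<forall>n\<ge>N. norm (poly_op (p m) A - poly_op (q n) A) < e"
proof -
  have e4: "0 < e / 4" using e by simp
  obtain M where M: "\<And>n x. n \<ge> M \<Longrightarrow> x \<in> real_spectrum A \<Longrightarrow> dist (poly (p n) x) (f x) < e / 4"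
    using uniform_limitD[OF p e4] unfolding eventually_sequentially by blast
  obtain N where N: "\<And>n x. n \<ge> N \<Longrightarrow> x \<in> real_spectrum A \<Longrightarrow> dist (poly (q n) x) (f x) < e / 4"
    using uniform_limitD[OF q e4] unfolding eventually_sequentially by blast
  have "norm (poly_op (p m) A - poly_op (q n) A) < e" if "m \<ge> max M N" "n \<ge> max M N" for m n
  proof -
    have "norm (poly_op (p m - q n) A) \<le> e / 2"
    proof (rule norm_poly_op_le[OF A])
      fix s assume s: "s \<in> real_spectrum A"
      have "\<bar>poly (p m) s - f s\<bar> < e / 4" "\<bar>poly (q n) s - f s\<bar> < e / 4"
        using M[of m s] N[of n s] that s by (auto simp: dist_real_def)
      then show "\<bar>poly (p m - q n) s\<bar> \<le> e / 2"
        unfolding poly_diff by arith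
    qed (use e in simp)
    then show ?thesis using e by (simp add: poly_op_diff)
  qed
  then show ?thesis by blast
qed

text \<open>
  By the norm bound for polynomials, polynomials that converge uniformly on the spectrum give a Cauchy
  sequence of operators, and the limit depends only on \<open>f\<close>. The algebraic properties of
  \<open>cfc\<close> below are obtained by approximating with one such sequence.
\<close>

lemma cfc_limit:
  assumes A: "selfadjoint_op A" and f: "continuous_on (real_spectrum A) f"
    and p: "uniform_limit (real_spectrum A) (\<lambda>n x. poly (p n) x) f sequentially"
  shows "(\<lambda>n. poly_op (p n) A) \<longlonglongrightarrow> cfc f A"
proof -
  have "Cauchy (\<lambda>n. poly_op (p n) A)"
    using poly_op_uniform_diff[OF A p p] by (intro CauchyI) blast
  then obtain B where B: "(\<lambda>n. poly_op (p n) A) \<longlonglongrightarrow> B"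
    using Cauchy_convergent convergent_def by blast
  have all: "(\<lambda>n. poly_op (q n) A) \<longlonglongrightarrow> B"
    if q: "uniform_limit (real_spectrum A) (\<lambda>n x. poly (q n) x) f sequentially" for q
  proof (rule Lim_transform[OF B])
    show "(\<lambda>n. poly_op (q n) A - poly_op (p n) A) \<longlonglongrightarrow> 0"
      using poly_op_uniform_diff[OF A q p] by (intro LIMSEQ_I) (simp, blast)
  qed
  have "cfc f A = B"
    unfolding cfc_def real_spectrum_def[symmetric]
  proof (rule the_equality)
    fix C assume "\<forall>p. uniform_limit (real_spectrum A) (\<lambda>n x. poly (p n) x) f sequentially
      \<longrightarrow> (\<lambda>n. poly_op (p n) A) \<longlonglongrightarrow> C"
    with p B show "C = B" by (metis LIMSEQ_unique)
  qed (use all in blast)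
  with B show ?thesis by simp
qed

lemma cfc_sequence:
  assumes "selfadjoint_op A" "continuous_on (real_spectrum A) f"
  obtains p where "uniform_limit (real_spectrum A) (\<lambda>n x. poly (p n) x) f sequentially"
    "(\<lambda>n. poly_op (p n) A) \<longlonglongrightarrow> cfc f A"
  using Weierstrass_poly_sequence[OF compact_real_spectrum] cfc_limit assms by metis

lemma closed_selfadjoint:
  assumes "\<And>n. selfadjoint_op (A n)" "A \<longlonglongrightarrow> B"
  shows "selfadjoint_op B"
  unfolding selfadjoint_iff
proof (intro conjI allI)
  show "B \<in> BH" using closed_sequentially[OF closed_BH _ assms(2)] assms(1) selfadjoint_BH by blast
  fix x y
  have 1: "(\<lambda>n. inner (A n x) y) \<longlonglongrightarrow> inner (B x) y"
    by (intro tendsto_intros assms(2))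
  have "(\<lambda>n. inner x (A n y)) \<longlonglongrightarrow> inner x (B y)"
    by (intro tendsto_intros assms(2))
  then have "(\<lambda>n. inner (A n x) y) \<longlonglongrightarrow> inner x (B y)"
    by (simp add: selfadjoint_inner[OF assms(1)])
  with 1 show "inner (B x) y = inner x (B y)" by (rule LIMSEQ_unique)
qed

lemma cfc_selfadjoint:
  assumes "selfadjoint_op A" "continuous_on (real_spectrum A) f"
  shows "selfadjoint_op (cfc f A)"
  using cfc_sequence[OF assms] closed_selfadjoint selfadjoint_poly_op[OF assms(1)] by metis

lemma cfc_cong:
  assumes "selfadjoint_op A" "\<And>x. x \<in> real_spectrum A \<Longrightarrow> f x = g x"
  shows "cfc f A = cfc g A"
proof -
  have "uniform_limit (real_spectrum A) F f sequentially \<longleftrightarrow> uniform_limit (real_spectrum A) F g sequentially" for F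
    by (rule uniform_limit_cong') (use assms(2) in auto)
  then show ?thesis unfolding cfc_def real_spectrum_def[symmetric] by simp
qed

lemma cfc_poly:
  assumes "selfadjoint_op A"
  shows "cfc (poly p) A = poly_op p A"
proof -
  have "(\<lambda>n. poly_op p A) \<longlonglongrightarrow> cfc (poly p) A"
    by (rule cfc_limit[OF assms]) (auto intro!: continuous_intros uniform_limit_const)
  then show ?thesis by (simp add: LIMSEQ_const_iff)
qed

lemma cfc_const:
  assumes "selfadjoint_op A"
  shows "cfc (\<lambda>x. c) A = c *\<^sub>R id_blinfun"
proof -
  have "poly [:c:] = (\<lambda>x. c)" by (rule ext) simp
  then show ?thesis using cfc_poly[OF assms, of "[:c:]"] by (simp only: poly_op_const)
qed

lemma cfc_ident:
  assumes "selfadjoint_op A"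
  shows "cfc (\<lambda>x. x) A = A"
proof -
  have "poly [:0, 1:] = (\<lambda>x::real. x)" by (rule ext) simp
  then show ?thesis using cfc_poly[OF assms, of "[:0, 1:]"] by (simp only: poly_op_X)
qed

lemma cfc_add:
  assumes A: "selfadjoint_op A" and f: "continuous_on (real_spectrum A) f"
    and g: "continuous_on (real_spectrum A) g"
  shows "cfc (\<lambda>x. f x + g x) A = cfc f A + cfc g A"
proof -
  obtain p where p: "uniform_limit (real_spectrum A) (\<lambda>n x. poly (p n) x) f sequentially"
    "(\<lambda>n. poly_op (p n) A) \<longlonglongrightarrow> cfc f A" by (rule cfc_sequence[OF A f])
  obtain q where q: "uniform_limit (real_spectrum A) (\<lambda>n x. poly (q n) x) g sequentially"
    "(\<lambda>n. poly_op (q n) A) \<longlonglongrightarrow> cfc g A" by (rule cfc_sequence[OF A g])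
  have "(\<lambda>n. poly_op (p n + q n) A) \<longlonglongrightarrow> cfc (\<lambda>x. f x + g x) A"
    by (rule cfc_limit[OF A]) (auto intro!: continuous_intros f g uniform_limit_intros p q)
  moreover have "(\<lambda>n. poly_op (p n + q n) A) \<longlonglongrightarrow> cfc f A + cfc g A"
    unfolding poly_op_add by (intro tendsto_intros p q)
  ultimately show ?thesis by (rule LIMSEQ_unique)
qed

lemma cfc_mult:
  assumes A: "selfadjoint_op A" and f: "continuous_on (real_spectrum A) f"
    and g: "continuous_on (real_spectrum A) g"
  shows "cfc (\<lambda>x. f x * g x) A = cfc f A o\<^sub>L cfc g A"
proof -
  obtain p where p: "uniform_limit (real_spectrum A) (\<lambda>n x. poly (p n) x) f sequentially"
    "(\<lambda>n. poly_op (p n) A) \<longlonglongrightarrow> cfc f A" by (rule cfc_sequence[OF A f])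
  obtain q where q: "uniform_limit (real_spectrum A) (\<lambda>n x. poly (q n) x) g sequentially"
    "(\<lambda>n. poly_op (q n) A) \<longlonglongrightarrow> cfc g A" by (rule cfc_sequence[OF A g])
  have "bounded (f ` real_spectrum A)" "bounded (g ` real_spectrum A)"
    by (intro compact_imp_bounded compact_continuous_image compact_real_spectrum A f g)+
  then have "(\<lambda>n. poly_op (p n * q n) A) \<longlonglongrightarrow> cfc (\<lambda>x. f x * g x) A"
    by (intro cfc_limit[OF A]) (auto intro!: continuous_intros f g uniform_lim_mult p q)
  moreover have "(\<lambda>n. poly_op (p n * q n) A) \<longlonglongrightarrow> (cfc f A o\<^sub>L cfc g A)"
    unfolding poly_op_mult
    by (rule bounded_bilinear.tendsto[OF bounded_bilinear_blinfun_compose p(2) q(2)])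
  ultimately show ?thesis by (rule LIMSEQ_unique)
qed

lemma cfc_norm_le:
  assumes A: "selfadjoint_op A" and f: "continuous_on (real_spectrum A) f"
    and c: "0 \<le> c" "\<And>s. s \<in> real_spectrum A \<Longrightarrow> \<bar>f s\<bar> \<le> c"
  shows "norm (cfc f A) \<le> c"
proof (rule field_le_epsilon)
  fix e :: real assume e: "0 < e"
  obtain p where p: "uniform_limit (real_spectrum A) (\<lambda>n x. poly (p n) x) f sequentially"
    "(\<lambda>n. poly_op (p n) A) \<longlonglongrightarrow> cfc f A" by (rule cfc_sequence[OF A f])
  have "\<forall>\<^sub>F n in sequentially. norm (poly_op (p n) A) \<le> c + e"
    using uniform_limitD[OF p(1) e]
  proof eventually_elim
    case (elim n)
    show ?case
    proof (rule norm_poly_op_le[OF A])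
      fix s assume "s \<in> real_spectrum A"
      then show "\<bar>poly (p n) s\<bar> \<le> c + e" using elim c(2)[of s] by (auto simp: dist_real_def)
    qed (use c e in simp)
  qed
  then show "norm (cfc f A) \<le> c + e"
    by (rule Lim_norm_ubound[OF sequentially_bot p(2)])
qed

text \<open>
  \<open>f - (m + M)/2\<close> is bounded by \<open>(M - m)/2\<close> on the spectrum, which bounds the distance of \<open>f(A)\<close> to a
  multiple of the identity; the triangle inequality gives the two-sided estimate of \<open>\<parallel>f(A) x\<parallel>\<close>.
\<close>

lemma cfc_bounds:
  assumes A: "selfadjoint_op A" and f: "continuous_on (real_spectrum A) f"
    and mM: "m \<le> M" "\<And>s. s \<in> real_spectrum A \<Longrightarrow> m \<le> f s \<and> f s \<le> M"
  shows "norm (cfc f A x - ((m + M) / 2) *\<^sub>R x) \<le> ((M - m) / 2) * norm x"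
    and "m * norm x \<le> norm (cfc f A x)"
    and "0 \<le> m \<Longrightarrow> norm (cfc f A x) \<le> M * norm x"
proof -
  have "cfc f A - ((m + M) / 2) *\<^sub>R id_blinfun = cfc (\<lambda>x. f x + (- ((m + M) / 2))) A"
    using cfc_add[OF A f continuous_on_const, of "- ((m + M) / 2)"] cfc_const[OF A, of "- ((m + M) / 2)"]
    by simp
  also have "norm \<dots> \<le> (M - m) / 2"
  proof (rule cfc_norm_le[OF A])
    fix s assume "s \<in> real_spectrum A"
    from mM(2)[OF this] show "\<bar>f s + - ((m + M) / 2)\<bar> \<le> (M - m) / 2" by argo
  qed (use mM in \<open>auto intro!: continuous_intros f\<close>)
  finally have "norm ((cfc f A - ((m + M) / 2) *\<^sub>R id_blinfun) x) \<le> ((M - m) / 2) * norm x"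
    by (meson norm_blinfun mult_right_mono norm_ge_zero order_trans)
  then show main: "norm (cfc f A x - ((m + M) / 2) *\<^sub>R x) \<le> ((M - m) / 2) * norm x"
    by (simp add: blinfun.diff_left blinfun.scaleR_left)
  have tri: "\<bar>norm (cfc f A x) - norm (((m + M) / 2) *\<^sub>R x)\<bar> \<le> ((M - m) / 2) * norm x"
    using norm_triangle_ineq3 main order_trans by blast
  have n: "norm (((m + M) / 2) *\<^sub>R x) = \<bar>(m + M) / 2\<bar> * norm x" by simp
  have "m * norm x = ((m + M) / 2) * norm x - ((M - m) / 2) * norm x" by (simp add: field_simps)
  moreover have "((m + M) / 2) * norm x \<le> \<bar>(m + M) / 2\<bar> * norm x" by (intro mult_right_mono abs_ge_self) auto
  ultimately show "m * norm x \<le> norm (cfc f A x)" using tri unfolding n by linarith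
  show "norm (cfc f A x) \<le> M * norm x" if "0 \<le> m"
  proof -
    have "\<bar>(m + M) / 2\<bar> = (m + M) / 2" using that mM(1) by simp
    moreover have "M * norm x = ((m + M) / 2) * norm x + ((M - m) / 2) * norm x" by (simp add: field_simps)
    ultimately show ?thesis using tri unfolding n by linarith
  qed
qed

section \<open>The modulus of an operator\<close>

lemma inner_adj_compose_self:
  assumes "X \<in> BH"
  shows "inner ((adj_op X o\<^sub>L X) x) x = (norm (X x))\<^sup>2"
  using adj_inner[OF assms, of x "X x"] by (simp add: power2_norm_eq_inner inner_commute)

lemma real_spectrum_nonneg:
  assumes A: "selfadjoint_op A" and pos: "\<And>x. 0 \<le> inner (A x) x"
  shows "real_spectrum A \<subseteq> {0..}"
proof (rule subsetI, rule ccontr)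
  fix r assume r: "r \<in> real_spectrum A" "r \<notin> {0..}"
  have "- r * norm x \<le> norm (A x - r *\<^sub>R x)" for x
  proof (cases "x = 0")
    case False
    have "(- r * norm x) * norm x = inner (- (r *\<^sub>R x)) x" by (simp add: dot_square_norm power2_eq_square)
    also have "\<dots> \<le> inner (A x - r *\<^sub>R x) x" using pos[of x] by (simp add: inner_diff_left)
    also have "\<dots> \<le> norm (A x - r *\<^sub>R x) * norm x" by (rule norm_cauchy_schwarz)
    finally show ?thesis using False by (simp only: mult_le_cancel_right) simp
  qed simp
  moreover have "0 < - r" using r(2) by simp
  ultimately show False using r(1) real_spectrum_iff[OF A, of r] by blast
qed

text \<open>
  The square root of \<open>X*X\<close> is itself the square of a self-adjoint operator, namely of the fourth root,
  hence nonnegative.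
\<close>

lemma
  assumes X: "X \<in> BH"
  shows abs_op_selfadjoint: "selfadjoint_op (abs_op X)"
    and abs_op_square: "abs_op X o\<^sub>L abs_op X = adj_op X o\<^sub>L X"
    and abs_op_nonneg: "0 \<le> inner (abs_op X x) x"
proof -
  define Q where "Q = adj_op X o\<^sub>L X"
  have Q: "selfadjoint_op Q" unfolding Q_def by (rule selfadjoint_adj_compose[OF X])
  have pos: "real_spectrum Q \<subseteq> {0..}"
    by (rule real_spectrum_nonneg[OF Q]) (simp add: Q_def inner_adj_compose_self[OF X] del: blinfun_apply_blinfun_compose)
  have cont: "continuous_on (real_spectrum Q) sqrt" "continuous_on (real_spectrum Q) (\<lambda>x. sqrt (sqrt x))"
    by (intro continuous_intros)+
  have P: "abs_op X = cfc sqrt Q" by (simp add: abs_op_def Q_def)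
  show "selfadjoint_op (abs_op X)" unfolding P by (rule cfc_selfadjoint[OF Q cont(1)])
  have "cfc (\<lambda>x. sqrt x * sqrt x) Q = cfc (\<lambda>x. x) Q"
    by (rule cfc_cong[OF Q]) (use pos in auto)
  then show "abs_op X o\<^sub>L abs_op X = adj_op X o\<^sub>L X"
    unfolding P using cfc_mult[OF Q cont(1) cont(1)] cfc_ident[OF Q] by (simp add: Q_def)
  define R where "R = cfc (\<lambda>x. sqrt (sqrt x)) Q"
  have R: "selfadjoint_op R" unfolding R_def by (rule cfc_selfadjoint[OF Q cont(2)])
  have "cfc (\<lambda>x. sqrt (sqrt x) * sqrt (sqrt x)) Q = cfc sqrt Q"
    by (rule cfc_cong[OF Q]) (use pos in auto)
  then have "abs_op X = R o\<^sub>L R"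
    unfolding P R_def using cfc_mult[OF Q cont(2) cont(2)] by simp
  then have "inner (abs_op X x) x = inner (R x) (R x)"
    using selfadjoint_inner[OF R, of "R x" x] by simp
  then show "0 \<le> inner (abs_op X x) x" by simp
qed

lemma norm_abs_op:
  assumes X: "X \<in> BH"
  shows "norm (abs_op X x) = norm (X x)"
proof -
  have "(norm (abs_op X x))\<^sup>2 = inner ((abs_op X o\<^sub>L abs_op X) x) x"
    using selfadjoint_inner[OF abs_op_selfadjoint[OF X], of "abs_op X x" x] by (simp add: power2_norm_eq_inner)
  also have "\<dots> = (norm (X x))\<^sup>2"
    unfolding abs_op_square[OF X] by (rule inner_adj_compose_self[OF X])
  finally show ?thesis by simp
qed

text \<open>
  Replaces the spectral condition on \<open>|X|\<close> by inequalities between norms, which are stable under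
  perturbations of \<open>X\<close>.
\<close>

lemma abs_op_spectrum_iff:
  assumes X: "X \<in> BH" and m: "0 \<le> m" "m \<le> M"
  shows "real_spectrum (abs_op X) \<subseteq> {m..M} \<longleftrightarrow> (\<forall>x. m * norm x \<le> norm (X x) \<and> norm (X x) \<le> M * norm x)"
proof
  note P = abs_op_selfadjoint[OF X]
  assume "real_spectrum (abs_op X) \<subseteq> {m..M}"
  then have "m * norm x \<le> norm (cfc (\<lambda>x. x) (abs_op X) x)" "norm (cfc (\<lambda>x. x) (abs_op X) x) \<le> M * norm x" for x
    by (intro cfc_bounds[OF P] continuous_intros m; use m in auto)+
  then show "\<forall>x. m * norm x \<le> norm (X x) \<and> norm (X x) \<le> M * norm x"
    by (simp add: cfc_ident[OF P] norm_abs_op[OF X])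
next
  note P = abs_op_selfadjoint[OF X]
  assume *: "\<forall>x. m * norm x \<le> norm (X x) \<and> norm (X x) \<le> M * norm x"
  show "real_spectrum (abs_op X) \<subseteq> {m..M}"
  proof (rule subsetI, rule ccontr)
    fix r assume r: "r \<in> real_spectrum (abs_op X)" "r \<notin> {m..M}"
    have "0 \<le> r" using real_spectrum_nonneg[OF P abs_op_nonneg[OF X]] r(1) by auto
    have tri: "\<bar>norm (X x) - r * norm x\<bar> \<le> norm (abs_op X x - r *\<^sub>R x)" for x
      using norm_triangle_ineq3[of "abs_op X x" "r *\<^sub>R x"] \<open>0 \<le> r\<close> by (simp add: norm_abs_op[OF X])
    have "max (m - r) (r - M) * norm x \<le> norm (abs_op X x - r *\<^sub>R x)" for x
      using tri[of x] * by (auto simp: max_def algebra_simps abs_le_iff intro: order_trans)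
    moreover have "0 < max (m - r) (r - M)" using r(2) by auto
    ultimately show False using r(1) real_spectrum_iff[OF P, of r] by blast
  qed
qed

lemma closure_range_sequence:
  fixes f :: "'a \<Rightarrow> 'b::metric_space"
  assumes "v \<in> closure (range f)"
  shows "\<exists>y. (\<lambda>n. f (y n)) \<longlonglongrightarrow> v"
proof -
  have "\<exists>z. (\<forall>n. z n \<in> range f) \<and> z \<longlonglongrightarrow> v"
    using assms by (simp only: closure_sequential)
  then obtain z where z: "\<forall>n. z n \<in> range f" "z \<longlonglongrightarrow> v" by blast
  from z(1) have "\<forall>n. \<exists>y. z n = f y" by auto
  from choice[OF this] obtain y where "\<forall>n. z n = f (y n)" by blast
  then have "z = (\<lambda>n. f (y n))" by (intro ext) blast
  with z(2) have "(\<lambda>n. f (y n)) \<longlonglongrightarrow> v" by (simp only:)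
  then show ?thesis by blast
qed

lemma subspace_closure:
  fixes S :: "'a::real_normed_vector set"
  assumes S: "subspace S"
  shows "subspace (closure S)"
proof (rule subspaceI)
  show "0 \<in> closure S" using subspace_0[OF S] closure_subset by blast
  fix x y c assume "x \<in> closure S"
  then obtain u where u: "\<And>n. u n \<in> S" "u \<longlonglongrightarrow> x" unfolding closure_sequential by blast
  show "c *\<^sub>R x \<in> closure S"
    unfolding closure_sequential using u
    by (intro exI[of _ "\<lambda>n. c *\<^sub>R u n"]) (auto intro!: tendsto_intros subspace_scale[OF S])
  assume "y \<in> closure S"
  then obtain v where v: "\<And>n. v n \<in> S" "v \<longlonglongrightarrow> y" unfolding closure_sequential by blast
  show "x + y \<in> closure S"
    unfolding closure_sequential using u v
    by (intro exI[of _ "\<lambda>n. u n + v n"]) (auto intro!: tendsto_intros subspace_add[OF S])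
qed

text \<open>
  \<open>W\<close> is the adjoint of the partial isometry of the polar decomposition. For each \<open>y\<close>, \<open>W y\<close> is the vector in
  the closure of the range of \<open>P = |X|\<close> that represents the functional \<open>P x \<mapsto> \<langle>y, X x\<rangle>\<close>, so that \<open>P W = X*\<close>.
  Since \<open>P\<close> is injective on that closure, \<open>W X = P\<close> follows from \<open>P W X = X*X = P^2\<close>, and therefore
  \<open>X* = P W = W X W\<close>.
\<close>

lemma polar_contraction:
  fixes X :: "'h::chilbert_space \<Rightarrow>\<^sub>L 'h"
  assumes X: "X \<in> BH"
  shows "\<exists>W\<in>BH. norm W \<le> 1 \<and> adj_op X = W o\<^sub>L X o\<^sub>L W"
proof -
  define P where "P = abs_op X"
  have P: "selfadjoint_op P" unfolding P_def by (rule abs_op_selfadjoint[OF X])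
  have nP: "norm (P x) = norm (X x)" for x unfolding P_def by (rule norm_abs_op[OF X])
  define V where "V = closure (range P)"
  have subV: "subspace V"
    unfolding V_def
    by (intro subspace_closure linear_subspace_image subspace_UNIV bounded_linear.linear blinfun.bounded_linear_right)
  have sep: "v = 0" if v: "v \<in> V" "P v = 0" for v
  proof -
    obtain y where y: "(\<lambda>n. P (y n)) \<longlonglongrightarrow> v"
      using closure_range_sequence[OF v(1)[unfolded V_def]] by blast
    have "(\<lambda>n. inner v (P (y n))) \<longlonglongrightarrow> inner v v" by (intro tendsto_intros y)
    moreover have "inner v (P z) = 0" for z
      using v(2) selfadjoint_inner[OF P, of v z] by simp
    ultimately show "v = 0" by (simp add: LIMSEQ_const_iff)
  qed
  have eqV: "u = v" if "u \<in> V" "v \<in> V" "P u = P v" for u v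
    using sep[of "u - v"] subspace_diff[OF subV that(1,2)] that(3) by (simp add: blinfun.diff_right)
  have "\<exists>v\<in>V. \<forall>x. inner y (X x) = inner v (P x)" for y
    unfolding V_def
  proof (rule riesz_range)
    show "linear P" by (intro bounded_linear.linear blinfun.bounded_linear_right)
    show "linear (\<lambda>x. inner y (X x))"
      by (intro linearI) (simp_all add: blinfun.add_right blinfun.scaleR_right inner_add_right)
    show "\<bar>inner y (X x)\<bar> \<le> norm y * norm (P x)" for x
      unfolding nP by (rule Cauchy_Schwarz_ineq2)
  qed
  then have "\<forall>y. \<exists>v. v \<in> V \<and> (\<forall>x. inner y (X x) = inner v (P x))" by blast
  from choice[OF this] obtain w
    where w: "\<And>y. w y \<in> V" "\<And>y x. inner y (X x) = inner (w y) (P x)" by blast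
  have Pw: "P (w y) = adj_op X y" for y
  proof -
    have "inner (P (w y) - adj_op X y) x = 0" for x
      using w(2)[of y x] adj_inner[OF X, of x y] selfadjoint_inner[OF P, of "w y" x]
      by (simp add: inner_diff_left inner_diff_right inner_commute)
    from this[of "P (w y) - adj_op X y"] show ?thesis by simp
  qed
  have w_norm: "norm (w y) \<le> norm y" for y
  proof -
    obtain z where z: "(\<lambda>n. P (z n)) \<longlonglongrightarrow> w y"
      using closure_range_sequence[OF w(1)[unfolded V_def]] by blast
    have "inner (w y) (w y) \<le> norm y * norm (w y)"
    proof (rule LIMSEQ_le)
      show "(\<lambda>n. inner (w y) (P (z n))) \<longlonglongrightarrow> inner (w y) (w y)"
        "(\<lambda>n. norm y * norm (P (z n))) \<longlonglongrightarrow> norm y * norm (w y)"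
        by (intro tendsto_intros z)+
      have "inner (w y) (P x) \<le> norm y * norm (P x)" for x
        unfolding nP w(2)[symmetric] by (rule norm_cauchy_schwarz)
      then show "\<exists>N. \<forall>n\<ge>N. inner (w y) (P (z n)) \<le> norm y * norm (P (z n))" by blast
    qed
    then show ?thesis by (cases "w y = 0") (auto simp: dot_square_norm power2_eq_square)
  qed
  have adj: "adj_op X \<in> BH" by (rule adj_BH[OF X])
  have bl: "bounded_linear w"
  proof (rule bounded_linear_intro)
    show "w (x + y) = w x + w y" for x y
      by (rule eqV) (simp_all add: w subspace_add[OF subV] Pw blinfun.add_right)
    show "w (r *\<^sub>R x) = r *\<^sub>R w x" for r x
      by (rule eqV) (simp_all add: w subspace_scale[OF subV] Pw blinfun.scaleR_right)
    show "norm (w x) \<le> norm x * 1" for x using w_norm[of x] by simp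
  qed
  define W where "W = Blinfun w"
  have W: "W x = w x" for x by (simp add: W_def bounded_linear_Blinfun_apply[OF bl])
  have iV: "\<i> *\<^sub>C v \<in> V" if vV: "v \<in> V" for v
  proof -
    obtain z where z: "(\<lambda>n. P (z n)) \<longlonglongrightarrow> v"
      using closure_range_sequence[OF vV[unfolded V_def]] by blast
    have "(\<lambda>n. scalar_op \<i> (P (z n))) \<longlonglongrightarrow> scalar_op \<i> v" by (intro tendsto_intros z)
    then have "(\<lambda>n. P (\<i> *\<^sub>C z n)) \<longlonglongrightarrow> \<i> *\<^sub>C v"
      by (simp add: scalar_op.rep_eq BH_scaleC[OF selfadjoint_BH[OF P]])
    then show ?thesis
      unfolding V_def closure_sequential by (intro exI[of _ "\<lambda>n. P (\<i> *\<^sub>C z n)"]) auto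
  qed
  have "w (\<i> *\<^sub>C x) = \<i> *\<^sub>C w x" for x
    by (rule eqV) (simp_all add: w(1) iV Pw BH_scaleC[OF selfadjoint_BH[OF P]] BH_scaleC[OF adj])
  then have "W \<in> BH" by (simp add: BH_iff W)
  moreover have "norm W \<le> 1" by (rule norm_blinfun_bound) (simp_all add: W w_norm)
  moreover have "adj_op X = W o\<^sub>L X o\<^sub>L W"
  proof (rule blinfun_eqI)
    have WX: "w (X x) = P x" for x
    proof (rule eqV)
      show "P x \<in> V" unfolding V_def by (rule subsetD[OF closure_subset]) simp
      have "(abs_op X o\<^sub>L abs_op X) x = (adj_op X o\<^sub>L X) x" by (simp only: abs_op_square[OF X])
      then have "P (P x) = adj_op X (X x)" by (simp add: P_def)
      then show "P (w (X x)) = P (P x)" by (simp only: Pw)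
    qed (rule w(1))
    show "adj_op X y = (W o\<^sub>L X o\<^sub>L W) y" for y by (simp add: W WX Pw)
  qed
  ultimately show ?thesis by blast
qed

section \<open>Normed ideals\<close>

lemma norm_id_blinfun_le: "norm (id_blinfun :: 'a::real_normed_vector \<Rightarrow>\<^sub>L 'a) \<le> 1"
  by (rule norm_blinfun_bound) auto

locale operator_ideal =
  fixes J :: "('h::chilbert_space \<Rightarrow>\<^sub>L 'h) set" and nJ :: "('h \<Rightarrow>\<^sub>L 'h) \<Rightarrow> real"
  assumes ideal: "normed_ideal J nJ"
begin

lemma
  shows J_BH: "X \<in> J \<Longrightarrow> X \<in> BH"
    and J_zero: "0 \<in> J"
    and J_add: "X \<in> J \<Longrightarrow> Y \<in> J \<Longrightarrow> X + Y \<in> J"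
    and J_scalar: "X \<in> J \<Longrightarrow> scalar_op z o\<^sub>L X \<in> J"
    and J_left: "X \<in> J \<Longrightarrow> Y \<in> BH \<Longrightarrow> Y o\<^sub>L X \<in> J"
    and J_right: "X \<in> J \<Longrightarrow> Y \<in> BH \<Longrightarrow> X o\<^sub>L Y \<in> J"
    and nJ_sandwich: "X \<in> J \<Longrightarrow> Y \<in> BH \<Longrightarrow> Z \<in> BH \<Longrightarrow> nJ (Y o\<^sub>L X o\<^sub>L Z) \<le> norm Y * nJ X * norm Z"
    and nJ_ge_0: "X \<in> J \<Longrightarrow> 0 \<le> nJ X"
    and nJ_add: "X \<in> J \<Longrightarrow> Y \<in> J \<Longrightarrow> nJ (X + Y) \<le> nJ X + nJ Y"
    and nJ_scalar: "X \<in> J \<Longrightarrow> nJ (scalar_op z o\<^sub>L X) = cmod z * nJ X"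
    and nJ_rank_one: "rank_one_op X \<Longrightarrow> nJ X = norm X"
    and J_complete: "(\<And>n. S n \<in> J) \<Longrightarrow>
      (\<And>e. 0 < e \<Longrightarrow> \<exists>N. \<forall>m\<ge>N. \<forall>n\<ge>N. nJ (S m - S n) < e) \<Longrightarrow> \<exists>L\<in>J. (\<lambda>n. nJ (S n - L)) \<longlonglongrightarrow> 0"
proof -
  have *: "J \<subseteq> BH" "0 \<in> J" "\<forall>X\<in>J. \<forall>Y\<in>J. X + Y \<in> J"
    "\<forall>X\<in>J. \<forall>z. scalar_op z o\<^sub>L X \<in> J" "\<forall>X\<in>J. \<forall>Y\<in>BH. Y o\<^sub>L X \<in> J \<and> X o\<^sub>L Y \<in> J"
    "\<forall>X\<in>J. 0 \<le> nJ X" "\<forall>X\<in>J. \<forall>Y\<in>J. nJ (X + Y) \<le> nJ X + nJ Y"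
    "\<forall>X\<in>J. \<forall>z. nJ (scalar_op z o\<^sub>L X) = cmod z * nJ X"
    "\<forall>S :: nat \<Rightarrow> ('h \<Rightarrow>\<^sub>L 'h). (\<forall>n. S n \<in> J) \<longrightarrow>
        (\<forall>e>0. \<exists>N. \<forall>m\<ge>N. \<forall>n\<ge>N. nJ (S m - S n) < e) \<longrightarrow> (\<exists>L\<in>J. (\<lambda>n. nJ (S n - L)) \<longlonglongrightarrow> 0)"
    "\<forall>X. rank_one_op X \<longrightarrow> X \<in> J \<and> nJ X = norm X"
    "\<forall>X\<in>J. \<forall>Y\<in>BH. \<forall>Z\<in>BH. nJ (Y o\<^sub>L X o\<^sub>L Z) \<le> norm Y * nJ X * norm Z"
    using ideal unfolding normed_ideal_def by - (elim conjE, assumption)+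
  show "X \<in> J \<Longrightarrow> X \<in> BH" using *(1) by (rule subsetD)
  show "0 \<in> J" by (rule *(2))
  show "X \<in> J \<Longrightarrow> Y \<in> J \<Longrightarrow> X + Y \<in> J" using *(3) by simp
  show "X \<in> J \<Longrightarrow> scalar_op z o\<^sub>L X \<in> J" using *(4) by simp
  show "X \<in> J \<Longrightarrow> Y \<in> BH \<Longrightarrow> Y o\<^sub>L X \<in> J" "X \<in> J \<Longrightarrow> Y \<in> BH \<Longrightarrow> X o\<^sub>L Y \<in> J" using *(5) by simp_all
  show "X \<in> J \<Longrightarrow> Y \<in> BH \<Longrightarrow> Z \<in> BH \<Longrightarrow> nJ (Y o\<^sub>L X o\<^sub>L Z) \<le> norm Y * nJ X * norm Z" using *(11) by simp
  show "X \<in> J \<Longrightarrow> 0 \<le> nJ X" using *(6) by simp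
  show "X \<in> J \<Longrightarrow> Y \<in> J \<Longrightarrow> nJ (X + Y) \<le> nJ X + nJ Y" using *(7) by simp
  show "X \<in> J \<Longrightarrow> nJ (scalar_op z o\<^sub>L X) = cmod z * nJ X" using *(8) by simp
  show "rank_one_op X \<Longrightarrow> nJ X = norm X" using *(10) by simp
  show "\<exists>L\<in>J. (\<lambda>n. nJ (S n - L)) \<longlonglongrightarrow> 0"
    if "\<And>n. S n \<in> J" "\<And>e. 0 < e \<Longrightarrow> \<exists>N. \<forall>m\<ge>N. \<forall>n\<ge>N. nJ (S m - S n) < e"
    by (rule *(9)[rule_format]) (use that in auto)
qed

lemma nJ_left: "X \<in> J \<Longrightarrow> Y \<in> BH \<Longrightarrow> nJ (Y o\<^sub>L X) \<le> norm Y * nJ X"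
proof -
  assume X: "X \<in> J" and Y: "Y \<in> BH"
  have "nJ (Y o\<^sub>L X) \<le> norm Y * nJ X * norm (id_blinfun :: 'h \<Rightarrow>\<^sub>L 'h)"
    using nJ_sandwich[OF X Y BH_id] by simp
  also have "\<dots> \<le> norm Y * nJ X * 1"
    using nJ_ge_0[OF X] by (intro mult_left_mono norm_id_blinfun_le) auto
  finally show ?thesis by simp
qed

lemma nJ_right: "X \<in> J \<Longrightarrow> Y \<in> BH \<Longrightarrow> nJ (X o\<^sub>L Y) \<le> nJ X * norm Y"
proof -
  assume X: "X \<in> J" and Y: "Y \<in> BH"
  have "nJ (X o\<^sub>L Y) \<le> norm (id_blinfun :: 'h \<Rightarrow>\<^sub>L 'h) * (nJ X * norm Y)"
    using nJ_sandwich[OF X BH_id Y] by (simp add: mult.assoc)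
  also have "\<dots> \<le> 1 * (nJ X * norm Y)"
    using nJ_ge_0[OF X] by (intro mult_right_mono norm_id_blinfun_le) auto
  finally show ?thesis by simp
qed

text \<open>
  For \<open>y = X x\<close> compress \<open>X\<close> by the rank one operators \<open>\<langle>y, \<cdot>\<rangle> y\<close> and \<open>\<langle>x, \<cdot>\<rangle> x\<close>: the result has rank one, so
  its operator norm equals its ideal norm, and the latter is controlled by that of \<open>X\<close>.
\<close>

lemma norm_le_nJ:
  assumes X: "X \<in> J"
  shows "norm X \<le> nJ X"
proof -
  define rk where "rk u v = Blinfun (\<lambda>z. cinner u z *\<^sub>C v)" for u v :: 'h
  have cinner_norm: "cmod (cinner u z) \<le> norm u * norm z" for u z :: 'h
  proof (cases "cinner u z = 0")
    case False
    define c where "c = cnj (cinner u z) / cmod (cinner u z)"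
    have c: "cmod c = 1" using False by (simp add: c_def norm_divide)
    have "c * cinner u z = cmod (cinner u z)"
      using False by (simp add: c_def mult.commute[of "cnj _"] flip: complex_norm_square) (simp add: power2_eq_square)
    then have "cmod (cinner u z) = inner u (c *\<^sub>C z)"
      by (simp add: inner_eq_Re_cinner cinner_scaleC_right)
    also have "\<dots> \<le> norm u * norm (c *\<^sub>C z)" by (rule norm_cauchy_schwarz)
    finally show ?thesis by (simp add: norm_scaleC c)
  qed simp
  have bl: "bounded_linear (\<lambda>z. cinner u z *\<^sub>C v)" for u v :: 'h
  proof (rule bounded_linear_intro)
    show "cinner u (x + y) *\<^sub>C v = cinner u x *\<^sub>C v + cinner u y *\<^sub>C v" for x y
      by (simp add: cinner_add_right scaleC_add_left)
    show "cinner u (r *\<^sub>R x) *\<^sub>C v = r *\<^sub>R cinner u x *\<^sub>C v" for r x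
      using cinner_scaleC_right[of u "complex_of_real r" x]
      by (simp add: scaleC_of_real flip: scaleC_scaleC)
    show "norm (cinner u x *\<^sub>C v) \<le> norm x * (norm u * norm v)" for x
      using mult_right_mono[OF cinner_norm[of u x], of "norm v"] by (simp add: norm_scaleC mult_ac)
  qed
  note rk = bounded_linear_Blinfun_apply[OF bl, folded rk_def]
  have rkBH: "rk u v \<in> BH" for u v
    by (simp add: BH_iff rk cinner_scaleC_right scaleC_scaleC)
  have rk_norm: "norm (rk u u) \<le> (norm u)\<^sup>2" for u
    by (rule norm_blinfun_bound)
      (use mult_right_mono[OF cinner_norm, of "norm u" u] in \<open>auto simp: rk norm_scaleC power2_eq_square mult_ac\<close>)
  have main: "(norm (X x))\<^sup>2 \<le> nJ X * norm x * norm (X x)" for x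
  proof (cases "X x = 0")
    case False
    then have x: "x \<noteq> 0" by auto
    define y where "y = X x"
    define R where "R = rk y y o\<^sub>L X o\<^sub>L rk x x"
    have y: "norm y > 0" using False by (simp add: y_def)
    define l where "l = (norm y)\<^sup>2"
    have R: "R z = (cinner x z * l) *\<^sub>C y" for z
      unfolding R_def l_def
      by (simp add: rk BH_scaleC[OF J_BH[OF X]] y_def[symmetric] cinner_scaleC_right cinner_self)
    have RBH: "R \<in> BH" unfolding R_def by (intro BH_compose rkBH J_BH X)
    have "rank_one_op R"
      unfolding rank_one_op_def
    proof (intro conjI exI[of _ y] RBH)
      show "range (blinfun_apply R) = range (\<lambda>z. z *\<^sub>C y)"
      proof (intro equalityI subsetI)
        fix u assume "u \<in> range (\<lambda>z. z *\<^sub>C y)"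
        then obtain z where z: "u = z *\<^sub>C y" by blast
        have "R ((z / ((norm x)\<^sup>2 * l)) *\<^sub>C x) = u"
          using x y by (simp add: R z cinner_scaleC_right cinner_self l_def)
        then show "u \<in> range (blinfun_apply R)" by (metis rangeI)
      qed (auto simp: R)
    qed (use y in auto)
    then have "nJ R = norm R" by (rule nJ_rank_one)
    have "(norm x)\<^sup>2 * (norm y)\<^sup>2 * norm y = norm (R x)"
      by (simp add: R cinner_self norm_scaleC norm_mult norm_power l_def)
    also have "\<dots> \<le> norm R * norm x" by (rule norm_blinfun)
    also have "\<dots> \<le> ((norm y)\<^sup>2 * nJ X * (norm x)\<^sup>2) * norm x"
    proof (intro mult_right_mono)
    have "nJ R \<le> norm (rk y y) * nJ X * norm (rk x x)"
      unfolding R_def by (intro nJ_sandwich X rkBH)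
    then have "norm R \<le> norm (rk y y) * nJ X * norm (rk x x)" by (simp only: \<open>nJ R = norm R\<close>)
    also have "\<dots> \<le> (norm y)\<^sup>2 * nJ X * (norm x)\<^sup>2"
      using nJ_ge_0[OF X] by (intro mult_mono rk_norm) (auto intro: mult_nonneg_nonneg)
    finally show "norm R \<le> (norm y)\<^sup>2 * nJ X * (norm x)\<^sup>2" .
    qed simp
    finally have "((norm x)\<^sup>2 * norm y) * (norm y)\<^sup>2 \<le> ((norm x)\<^sup>2 * norm y) * (nJ X * norm x * norm y)"
      by (simp add: power2_eq_square mult_ac)
    then show ?thesis using x y unfolding y_def[symmetric] by (simp add: mult_le_cancel_left)
  qed simp
  show ?thesis
  proof (rule norm_blinfun_bound)
    show "norm (X x) \<le> nJ X * norm x" for x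
      using main[of x] nJ_ge_0[OF X] by (cases "X x = 0") (auto simp: power2_eq_square)
  qed (rule nJ_ge_0[OF X])
qed

sublocale complete_normed_subspace J nJ
proof
  have sc: "scalar_op (complex_of_real c) o\<^sub>L x = c *\<^sub>R x" for c and x :: "'h \<Rightarrow>\<^sub>L 'h"
    by (simp add: scalar_op_of_real op_compose.scaleR_left)
  show "c *\<^sub>R x \<in> J" "nJ (c *\<^sub>R x) = \<bar>c\<bar> * nJ x" if "x \<in> J" for c x
    using J_scalar[OF that, of "complex_of_real c"] nJ_scalar[OF that, of "complex_of_real c"] by (simp_all add: sc)
qed (fact J_zero J_add nJ_add norm_le_nJ J_complete)+

lemma adj_mem:
  assumes X: "X \<in> J"
  shows "adj_op X \<in> J" "nJ (adj_op X) \<le> nJ X"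
proof -
  obtain W where W: "W \<in> BH" "norm W \<le> 1" "adj_op X = W o\<^sub>L X o\<^sub>L W"
    using polar_contraction[OF J_BH[OF X]] by blast
  show "adj_op X \<in> J" unfolding W(3) by (intro J_left J_right X W)
  have "nJ (adj_op X) \<le> norm W * nJ X * norm W" unfolding W(3) by (rule nJ_sandwich[OF X W(1,1)])
  also have "\<dots> \<le> 1 * nJ X * 1" using W(2) nJ_ge_0[OF X] by (intro mult_mono) auto
  finally show "nJ (adj_op X) \<le> nJ X" by simp
qed

text \<open>
  \<open>E\<close> is the fixed point of an affine map that contracts with factor \<open>q\<close> both in \<open>J\<close> and in operator norm. The
  iterates from \<open>0\<close> stay in \<open>J\<close>, converge there, and converge to \<open>E\<close> in operator norm.
\<close>

lemma averaged_fixed_point_mem: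
  assumes R: "R1 \<in> BH" "R2 \<in> BH" "norm R1 \<le> q" "norm R2 \<le> q" and q: "q < 1"
    and G: "G \<in> J" and E: "E = (1 / 2) *\<^sub>R ((R1 o\<^sub>L E) + (E o\<^sub>L R2)) + G"
  shows "E \<in> J" "nJ E \<le> nJ G / (1 - q)"
proof -
  have q0: "0 \<le> q" using R(3) norm_ge_zero[of R1] by linarith
  define f where "f Z = (1 / 2) *\<^sub>R ((R1 o\<^sub>L Z) + (Z o\<^sub>L R2))" for Z
  have f_diff: "f (Y - Z) = f Y - f Z" for Y Z
    by (simp add: f_def op_compose.diff_left op_compose.diff_right scaleR_add_right scaleR_diff_right)
  have f_mem: "f Z \<in> J" if "Z \<in> J" for Z
    unfolding f_def by (intro scale_mem add_mem J_left J_right that R)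
  have f_nJ: "nJ (f Z) \<le> q * nJ Z" if Z: "Z \<in> J" for Z
  proof -
    have "nJ (f Z) = 1 / 2 * nJ ((R1 o\<^sub>L Z) + (Z o\<^sub>L R2))"
      unfolding f_def by (subst nK_scale) (auto intro: add_mem J_left J_right Z R)
    also have "\<dots> \<le> 1 / 2 * (nJ (R1 o\<^sub>L Z) + nJ (Z o\<^sub>L R2))"
      by (intro mult_left_mono triangle J_left J_right Z R) auto
    also have "\<dots> \<le> 1 / 2 * (norm R1 * nJ Z + nJ Z * norm R2)"
      by (intro mult_left_mono add_mono nJ_left nJ_right Z R) auto
    also have "\<dots> \<le> 1 / 2 * (q * nJ Z + nJ Z * q)"
      using nJ_ge_0[OF Z] by (intro mult_left_mono add_mono mult_right_mono R) auto
    finally show ?thesis by simp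
  qed
  have f_norm: "norm (f Z) \<le> q * norm Z" for Z
  proof -
    have "norm (f Z) = 1 / 2 * norm ((R1 o\<^sub>L Z) + (Z o\<^sub>L R2))" by (simp add: f_def)
    also have "\<dots> \<le> 1 / 2 * (norm R1 * norm Z + norm Z * norm R2)"
      by (intro mult_left_mono order_trans[OF norm_triangle_ineq] add_mono norm_blinfun_compose) auto
    also have "\<dots> \<le> 1 / 2 * (q * norm Z + norm Z * q)"
      by (intro mult_left_mono add_mono mult_right_mono R) auto
    finally show ?thesis by simp
  qed
  define S where "S = rec_nat 0 (\<lambda>_ Z. f Z + G)"
  have S0: "S 0 = 0" and SS: "S (Suc n) = f (S n) + G" for n by (simp_all add: S_def)
  have SJ: "S n \<in> J" for n by (induction n) (auto simp: S0 SS zero_mem intro!: add_mem f_mem G)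
  have step: "nJ (S (Suc n) - S n) \<le> nJ G * q ^ n" for n
  proof (induction n)
    case 0
    then show ?case by (simp add: SS S0 f_def)
  next
    case (Suc n)
    have "S (Suc (Suc n)) - S (Suc n) = f (S (Suc n) - S n)"
      unfolding f_diff by (simp only: SS) simp
    also have "nJ \<dots> \<le> q * nJ (S (Suc n) - S n)" by (intro f_nJ diff_mem SJ)
    also have "\<dots> \<le> q * (nJ G * q ^ n)" by (intro mult_left_mono Suc q0)
    finally show ?case by (simp add: mult_ac)
  qed
  obtain L where L: "L \<in> J" "(\<lambda>n. nJ (S n - L)) \<longlonglongrightarrow> 0" "\<And>n. nJ (S n - L) \<le> nJ G * q ^ n / (1 - q)"
    using geometric_limit[of S "nJ G" q] step SJ diff_mem q0 q by blast
  have "f E + G = E" unfolding f_def by (rule E[symmetric])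
  then have E': "f E = E - G" by (simp add: eq_diff_eq)
  have "norm (S n - E) \<le> q ^ n * norm E" for n
  proof (induction n)
    case (Suc n)
    have "S (Suc n) - E = f (S n - E)"
      unfolding f_diff using E' by (simp add: SS)
    also have "norm \<dots> \<le> q * norm (S n - E)" by (rule f_norm)
    also have "\<dots> \<le> q * (q ^ n * norm E)" by (intro mult_left_mono Suc q0)
    finally show ?case by simp
  qed (simp add: S0)
  moreover have "(\<lambda>n. q ^ n * norm E) \<longlonglongrightarrow> 0"
    using q0 q by (intro tendsto_mult_left_zero LIMSEQ_realpow_zero) auto
  ultimately have "(\<lambda>n. S n - E) \<longlonglongrightarrow> 0" by (intro Lim_null_comparison[of "\<lambda>n. S n - E"]) auto
  then have "S \<longlonglongrightarrow> E" by (simp add: LIM_zero_iff)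
  then have "L = E" by (intro nK_limit_unique[of S]) (auto intro: diff_mem SJ L)
  with L show "E \<in> J" by simp
  show "nJ E \<le> nJ G / (1 - q)"
    using L(3)[of 0] \<open>L = E\<close> nK_minus[OF \<open>E \<in> J\<close>] by (simp add: S0)
qed

text \<open>
  Let \<open>P = |X|\<close>, \<open>Q = |Y|\<close>. The difference \<open>E = P - Q\<close> satisfies \<open>P E + E Q = X*X - Y*Y\<close>; solving for \<open>E\<close> as
  \<open>E = ((1 - P/b) E + E (1 - Q/b)) / 2 + (X*X - Y*Y) / (2b)\<close> puts it in the form of the previous lemma, with
  \<open>q = 1 - a/b\<close> because the spectra lie in \<open>[a,b]\<close>.
\<close>

lemma abs_op_lipschitz:
  assumes ab: "0 < a" "a < b"
    and X: "X \<in> BH" "\<And>x. a * norm x \<le> norm (X x) \<and> norm (X x) \<le> b * norm x"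
    and Y: "Y \<in> BH" "\<And>x. a * norm x \<le> norm (Y x) \<and> norm (Y x) \<le> b * norm x"
    and XY: "X - Y \<in> J"
  shows "abs_op X - abs_op Y \<in> J" "nJ (abs_op X - abs_op Y) \<le> b / a * nJ (X - Y)"
proof -
  define q where "q = 1 - a / b"
  have q: "0 \<le> q" "q < 1" using ab by (auto simp: q_def)
  define R where "R Z = id_blinfun - (1 / b) *\<^sub>R abs_op Z" for Z :: "'h \<Rightarrow>\<^sub>L 'h"
  have R: "R Z \<in> BH" "norm (R Z) \<le> q"
    if Z: "Z \<in> BH" "\<And>x. a * norm x \<le> norm (Z x) \<and> norm (Z x) \<le> b * norm x" for Z
  proof -
    note P = abs_op_selfadjoint[OF Z(1)]
    show "R Z \<in> BH" unfolding R_def by (intro BH_diff BH_scaleR BH_id selfadjoint_BH P)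
    have sp: "real_spectrum (abs_op Z) \<subseteq> {a..b}"
      using abs_op_spectrum_iff[OF Z(1), of a b] ab Z(2) by auto
    have c: "continuous_on (real_spectrum (abs_op Z)) (\<lambda>x. (- (1 / b)) * x)"
      "continuous_on (real_spectrum (abs_op Z)) (\<lambda>x. - (1 / b))"
      "continuous_on (real_spectrum (abs_op Z)) (\<lambda>x. 1 :: real)"
      "continuous_on (real_spectrum (abs_op Z)) (\<lambda>x. x)"
      by (intro continuous_intros)+
    have "cfc (\<lambda>x. 1 + (- (1 / b)) * x) (abs_op Z) = R Z"
      unfolding cfc_add[OF P c(3) c(1)] cfc_mult[OF P c(2) c(4)] cfc_const[OF P] cfc_ident[OF P]
      by (simp add: R_def op_compose.minus_left op_compose.scaleR_left)
    moreover have "norm (cfc (\<lambda>x. 1 + (- (1 / b)) * x) (abs_op Z)) \<le> q"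
    proof (rule cfc_norm_le[OF P _ q(1)])
      show "continuous_on (real_spectrum (abs_op Z)) (\<lambda>x. 1 + (- (1 / b)) * x)"
        by (intro continuous_intros)
      fix s assume "s \<in> real_spectrum (abs_op Z)"
      then have "a / b \<le> s / b" "s / b \<le> 1" using sp ab by (auto intro!: divide_right_mono)
      then show "\<bar>1 + (- (1 / b)) * s\<bar> \<le> q" by (simp add: q_def)
    qed
    ultimately show "norm (R Z) \<le> q" by simp
  qed
  define D where "D = (adj_op X o\<^sub>L X) - (adj_op Y o\<^sub>L Y)"
  have D_eq: "D = (adj_op X o\<^sub>L (X - Y)) + (adj_op (X - Y) o\<^sub>L Y)"
    by (simp add: D_def adj_diff X Y op_compose.diff_left op_compose.diff_right)
  have D: "D \<in> J" unfolding D_eq by (intro add_mem J_left J_right adj_mem XY adj_BH X Y)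
  have nX: "norm (adj_op X) \<le> b" and nY: "norm Y \<le> b"
    using adj_norm_le[OF X(1)] norm_blinfun_bound[of b X] norm_blinfun_bound[of b Y] X(2) Y(2) ab by force+
  have "nJ D \<le> nJ (adj_op X o\<^sub>L (X - Y)) + nJ (adj_op (X - Y) o\<^sub>L Y)"
    unfolding D_eq by (intro triangle J_left J_right adj_mem XY adj_BH X Y)
  also have "\<dots> \<le> norm (adj_op X) * nJ (X - Y) + nJ (adj_op (X - Y)) * norm Y"
    by (intro add_mono nJ_left nJ_right adj_mem XY adj_BH X Y)
  also have "\<dots> \<le> b * nJ (X - Y) + nJ (X - Y) * b"
    using nX nY nJ_ge_0[OF XY] adj_mem[OF XY] ab by (intro add_mono mult_mono) auto
  finally have nD: "nJ D \<le> 2 * b * nJ (X - Y)" by simp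
  define E where "E = abs_op X - abs_op Y"
  have "D = (abs_op X o\<^sub>L E) + (E o\<^sub>L abs_op Y)"
    by (simp add: D_def E_def op_compose.diff_left op_compose.diff_right flip: abs_op_square X(1) Y(1))
      (simp add: abs_op_square X Y)
  then have "E = (1 / 2) *\<^sub>R ((R X o\<^sub>L E) + (E o\<^sub>L R Y)) + (1 / (2 * b)) *\<^sub>R D"
    using ab
    by (simp add: R_def op_compose.diff_left op_compose.diff_right op_compose.scaleR_left
        op_compose.scaleR_right scaleR_add_right scaleR_diff_right flip: scaleR_add_left)
  from averaged_fixed_point_mem[OF R(1)[OF X] R(1)[OF Y] R(2)[OF X] R(2)[OF Y] q(2) scale_mem[OF D] this]
  have E: "E \<in> J" "nJ E \<le> nJ ((1 / (2 * b)) *\<^sub>R D) / (1 - q)" by auto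
  show "abs_op X - abs_op Y \<in> J" using E(1) by (simp add: E_def)
  have "nJ ((1 / (2 * b)) *\<^sub>R D) / (1 - q) = nJ D / (2 * a)"
    using ab D by (simp add: nK_scale q_def field_simps)
  also have "\<dots> \<le> (2 * b * nJ (X - Y)) / (2 * a)" using nD ab by (intro divide_right_mono) auto
  finally show "nJ (abs_op X - abs_op Y) \<le> b / a * nJ (X - Y)"
    using E(2) by (simp add: E_def)
qed

end

section \<open>The vector field and its effect on the spectrum of the modulus\<close>

lemma quadratic_remainder_derivative:
  fixes X :: "real \<Rightarrow> 'a::real_normed_vector"
  assumes "\<And>s. s \<in> S \<Longrightarrow> norm (X s - X t - (s - t) *\<^sub>R d) \<le> K * (s - t)\<^sup>2"
  shows "(X has_vector_derivative d) (at t within S)"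
  unfolding has_vector_derivative_def has_derivative_within
proof (intro conjI bounded_linear_scaleR_left)
  show "((\<lambda>y. (1 / norm (y - t)) *\<^sub>R (X y - (X t + (y - t) *\<^sub>R d))) \<longlongrightarrow> 0) (at t within S)"
  proof (rule Lim_null_comparison)
    show "((\<lambda>y. K * norm (y - t)) \<longlongrightarrow> 0) (at t within S)"
      by (rule tendsto_eq_intros refl | simp)+
    have "norm ((1 / norm (y - t)) *\<^sub>R (X y - (X t + (y - t) *\<^sub>R d))) \<le> K * norm (y - t)"
      if y: "y \<in> S" "y \<noteq> t" for y
    proof -
      have "norm ((1 / norm (y - t)) *\<^sub>R (X y - (X t + (y - t) *\<^sub>R d)))
          = norm (X y - X t - (y - t) *\<^sub>R d) / norm (y - t)"
        unfolding norm_scaleR diff_diff_eq[symmetric] by simp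
      also have "\<dots> \<le> K * (y - t)\<^sup>2 / norm (y - t)"
        using assms[OF y(1)] by (intro divide_right_mono) auto
      also have "(y - t)\<^sup>2 = norm (y - t) * norm (y - t)" by (simp add: power2_eq_square)
      also have "K * (norm (y - t) * norm (y - t)) / norm (y - t) = K * norm (y - t)"
        using nonzero_mult_div_cancel_right[of "norm (y - t)" "K * norm (y - t)"] y(2)
        by (simp only: mult.assoc) simp
      finally show ?thesis .
    qed
    then show "\<forall>\<^sub>F y in at t within S. norm ((1 / norm (y - t)) *\<^sub>R (X y - (X t + (y - t) *\<^sub>R d))) \<le> K * norm (y - t)"
      by (auto simp: eventually_at_filter)
  qed
qed

lemma continuous_on_linear_quadratic:
  fixes u :: "real \<Rightarrow> real"
  assumes "\<And>s t. s \<in> S \<Longrightarrow> t \<in> S \<Longrightarrow> \<bar>u s - u t\<bar> \<le> c t * \<bar>s - t\<bar> + K * (s - t)\<^sup>2"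
  shows "continuous_on S u"
  unfolding continuous_on_def
proof
  fix t assume t: "t \<in> S"
  have "((\<lambda>s. u s - u t) \<longlongrightarrow> 0) (at t within S)"
  proof (rule Lim_null_comparison)
    show "\<forall>\<^sub>F s in at t within S. norm (u s - u t) \<le> c t * \<bar>s - t\<bar> + K * (s - t)\<^sup>2"
      using assms t by (auto simp: eventually_at_filter)
    show "((\<lambda>s. c t * \<bar>s - t\<bar> + K * (s - t)\<^sup>2) \<longlongrightarrow> 0) (at t within S)"
      by (rule tendsto_eq_intros refl | simp)+
  qed
  then show "(u \<longlongrightarrow> u t) (at t within S)" by (simp add: LIM_zero_iff)
qed

text \<open>
  The minimum modulus of an operator; for bounded operators on a Hilbert space it is the least point of
  the spectrum of the modulus, as the norm is the greatest.
\<close>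

definition lower_bound :: "('h::real_normed_vector \<Rightarrow>\<^sub>L 'h) \<Rightarrow> real" where
  "lower_bound X = Inf ((\<lambda>x. norm (X x)) ` {x. norm x = 1})"

lemma lower_bound_le: "lower_bound X * norm x \<le> norm (X x)"
proof (cases "x = 0")
  case False
  have "lower_bound X \<le> norm (X ((1 / norm x) *\<^sub>R x))"
    unfolding lower_bound_def by (rule cInf_lower) (use False in \<open>auto intro!: bdd_belowI[of _ 0]\<close>)
  also have "\<dots> = norm (X x) / norm x" by (simp add: blinfun.scaleR_right)
  finally show ?thesis using False by (simp add: field_simps)
qed simp

lemma lower_bound_ge:
  fixes X :: "'h::real_normed_vector \<Rightarrow>\<^sub>L 'h"
  assumes "(z :: 'h) \<noteq> 0" "\<And>x. c * norm x \<le> norm (X x)"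
  shows "c \<le> lower_bound X"
  unfolding lower_bound_def
proof (rule cInf_greatest)
  have "norm ((1 / norm z) *\<^sub>R z) = 1" using assms(1) by simp
  then show "(\<lambda>x. norm (blinfun_apply X x)) ` {x. norm x = 1} \<noteq> {}" by blast
  fix y assume "y \<in> (\<lambda>x. norm (blinfun_apply X x)) ` {x. norm x = 1}"
  then obtain x where "y = norm (X x)" "norm x = 1" by blast
  with assms(2)[of x] show "c \<le> y" by simp
qed

lemma lower_bound_perturb:
  fixes X Y :: "'h::real_normed_vector \<Rightarrow>\<^sub>L 'h"
  assumes "(z :: 'h) \<noteq> 0"
  shows "lower_bound Y - norm (X - Y) \<le> lower_bound X"
proof (rule lower_bound_ge[OF assms])
  fix x
  have "norm (Y x) - norm (X x) \<le> norm ((X - Y) x)"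
    using norm_triangle_ineq2[of "Y x" "X x"] by (simp add: blinfun.diff_left norm_minus_commute)
  also have "\<dots> \<le> norm (X - Y) * norm x" by (rule norm_blinfun)
  finally show "(lower_bound Y - norm (X - Y)) * norm x \<le> norm (X x)"
    using lower_bound_le[of Y x] by (simp add: left_diff_distrib)
qed

text \<open>
  The data of the initial value problem. \<open>C\<close> is the Lipschitz constant of \<open>\<phi>\<close> in the ideal norm and \<open>\<Phi>\<close> a
  bound of \<open>\<phi>\<close> on \<open>[a,b]\<close>, named so that all later estimates are explicit.
\<close>

locale ideal_flow = operator_ideal J nJ
  for J :: "('h::chilbert_space \<Rightarrow>\<^sub>L 'h) set" and nJ +
  fixes T :: "'h \<Rightarrow>\<^sub>L 'h" and a b C \<Phi> :: real and \<phi> :: "real \<Rightarrow> real"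
  assumes nontrivial: "\<exists>x::'h. x \<noteq> 0"
    and ab: "0 < a" "a < b"
    and phi_cont: "continuous_on {a..b} \<phi>"
    and phi_mono: "mono_on {a..b} \<phi>"
    and phi_bound: "\<And>s. s \<in> {a..b} \<Longrightarrow> \<bar>\<phi> s\<bar> \<le> \<Phi>"
    and T_BH: "T \<in> BH"
    and T_spectrum: "real_spectrum (abs_op T) \<subseteq> {a<..<b}"
    and comm: "commutator (cfc \<phi> (abs_op T)) T \<in> J"
    and C: "0 \<le> C"
    and lip: "\<And>A1 A2. selfadjoint_op A1 \<Longrightarrow> selfadjoint_op A2 \<Longrightarrow>
      real_spectrum A1 \<subseteq> {a..b} \<Longrightarrow> real_spectrum A2 \<subseteq> {a..b} \<Longrightarrow> A1 - A2 \<in> J \<Longrightarrow>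
      cfc \<phi> A1 - cfc \<phi> A2 \<in> J \<and> nJ (cfc \<phi> A1 - cfc \<phi> A2) \<le> C * nJ (A1 - A2)"
begin

definition flow_domain :: "('h \<Rightarrow>\<^sub>L 'h) set" where
  "flow_domain = {X \<in> BH. X - T \<in> J \<and> (\<forall>x. a * norm x \<le> norm (X x) \<and> norm (X x) \<le> b * norm x)}"

definition generator :: "('h \<Rightarrow>\<^sub>L 'h) \<Rightarrow> ('h \<Rightarrow>\<^sub>L 'h)" where
  "generator X = cfc \<phi> (abs_op X)"

definition flow_field :: "('h \<Rightarrow>\<^sub>L 'h) \<Rightarrow> ('h \<Rightarrow>\<^sub>L 'h)" where
  "flow_field X = commutator (generator X) X"

lemma
  assumes X: "X \<in> flow_domain"
  shows dom_BH: "X \<in> BH" and dom_J: "X - T \<in> J"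
    and dom_bounds: "a * norm x \<le> norm (X x)" "norm (X x) \<le> b * norm x"
    and dom_spectrum: "real_spectrum (abs_op X) \<subseteq> {a..b}"
    and dom_norm: "norm X \<le> b"
    and dom_phi_cont: "continuous_on (real_spectrum (abs_op X)) \<phi>"
proof -
  show *: "X \<in> BH" "X - T \<in> J" "a * norm x \<le> norm (X x)" "norm (X x) \<le> b * norm x"
    for x using X by (auto simp: flow_domain_def)
  show "norm X \<le> b" using ab * by (intro norm_blinfun_bound) auto
  show "real_spectrum (abs_op X) \<subseteq> {a..b}"
    using abs_op_spectrum_iff[OF *(1), of a b] ab * by auto
  then show "continuous_on (real_spectrum (abs_op X)) \<phi>"
    using phi_cont continuous_on_subset by blast
qed

lemma dom_iff:
  assumes "X \<in> BH" "X - T \<in> J"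
  shows "X \<in> flow_domain \<longleftrightarrow> spectrum_op (abs_op X) \<subseteq> complex_of_real ` {a..b}"
  using assms abs_op_spectrum_iff[OF assms(1), of a b] ab spectrum_subset_iff[OF abs_op_selfadjoint[OF assms(1)]]
  by (auto simp: flow_domain_def)

lemma dom_diff: "X \<in> flow_domain \<Longrightarrow> Y \<in> flow_domain \<Longrightarrow> X - Y \<in> J"
  using diff_mem[OF dom_J dom_J, of X Y] by simp

lemma gen_selfadjoint: "X \<in> flow_domain \<Longrightarrow> selfadjoint_op (generator X)"
  unfolding generator_def by (intro cfc_selfadjoint abs_op_selfadjoint dom_BH dom_phi_cont)

lemma gen_BH: "X \<in> flow_domain \<Longrightarrow> generator X \<in> BH"
  by (intro selfadjoint_BH gen_selfadjoint)

lemma Phi_nonneg: "0 \<le> \<Phi>"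
  using phi_bound[of a] ab by simp

lemma norm_gen: "X \<in> flow_domain \<Longrightarrow> norm (generator X) \<le> \<Phi>"
  unfolding generator_def using dom_spectrum[of X]
  by (intro cfc_norm_le abs_op_selfadjoint dom_BH dom_phi_cont Phi_nonneg phi_bound) auto

definition LB where "LB = C * (b / a)"
definition L where "L = 2 * b * LB + 2 * \<Phi>"

lemma LB_nonneg: "0 \<le> LB" using C ab by (simp add: LB_def)
lemma L_nonneg: "0 \<le> L" using LB_nonneg ab Phi_nonneg by (simp add: L_def)

lemma gen_lipschitz:
  assumes X: "X \<in> flow_domain" and Y: "Y \<in> flow_domain"
  shows "generator X - generator Y \<in> J" "nJ (generator X - generator Y) \<le> LB * nJ (X - Y)"
proof -
  note A = abs_op_lipschitz[OF ab dom_BH[OF X] _ dom_BH[OF Y] _ dom_diff[OF X Y]]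
  have A: "abs_op X - abs_op Y \<in> J" "nJ (abs_op X - abs_op Y) \<le> b / a * nJ (X - Y)"
    using dom_bounds X Y by (intro A; blast)+
  note l = lip[OF abs_op_selfadjoint[OF dom_BH[OF X]] abs_op_selfadjoint[OF dom_BH[OF Y]]
      dom_spectrum[OF X] dom_spectrum[OF Y] A(1), folded generator_def]
  show "generator X - generator Y \<in> J" using l by blast
  have "nJ (generator X - generator Y) \<le> C * nJ (abs_op X - abs_op Y)" using l by blast
  also have "\<dots> \<le> C * (b / a * nJ (X - Y))" by (intro mult_left_mono A C)
  finally show "nJ (generator X - generator Y) \<le> LB * nJ (X - Y)" by (simp add: LB_def)
qed

lemma field_lipschitz:
  assumes X: "X \<in> flow_domain" and Y: "Y \<in> flow_domain"
  shows "flow_field X - flow_field Y \<in> J" "nJ (flow_field X - flow_field Y) \<le> L * nJ (X - Y)"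
proof -
  let ?G = "generator X - generator Y" and ?D = "X - Y"
  have G: "?G \<in> J" "nJ ?G \<le> LB * nJ ?D" and D: "?D \<in> J"
    using gen_lipschitz[OF X Y] dom_diff[OF X Y] by auto
  have BH: "X \<in> BH" "generator Y \<in> BH" using X Y by (auto intro: dom_BH gen_BH)
  have eq: "flow_field X - flow_field Y = ((?G o\<^sub>L X) - (X o\<^sub>L ?G)) + ((generator Y o\<^sub>L ?D) - (?D o\<^sub>L generator Y))"
    by (simp add: flow_field_def commutator_def op_compose.diff_left op_compose.diff_right)
  show "flow_field X - flow_field Y \<in> J"
    unfolding eq by (intro add_mem diff_mem J_left J_right G D BH)
  have "nJ (flow_field X - flow_field Y) \<le> nJ ((?G o\<^sub>L X) - (X o\<^sub>L ?G)) + nJ ((generator Y o\<^sub>L ?D) - (?D o\<^sub>L generator Y))"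
    unfolding eq by (intro triangle diff_mem J_left J_right G D BH)
  also have "\<dots> \<le> (nJ (?G o\<^sub>L X) + nJ (X o\<^sub>L ?G)) + (nJ (generator Y o\<^sub>L ?D) + nJ (?D o\<^sub>L generator Y))"
    by (intro add_mono triangle_diff J_left J_right G D BH)
  also have "\<dots> \<le> (nJ ?G * norm X + norm X * nJ ?G) + (norm (generator Y) * nJ ?D + nJ ?D * norm (generator Y))"
    by (intro add_mono nJ_left nJ_right G D BH)
  also have "\<dots> \<le> ((LB * nJ ?D) * b + b * (LB * nJ ?D)) + (\<Phi> * nJ ?D + nJ ?D * \<Phi>)"
    using G nJ_ge_0 D dom_norm[OF X] norm_gen[OF Y] ab LB_nonneg Phi_nonneg
    by (intro add_mono mult_mono) auto
  finally show "nJ (flow_field X - flow_field Y) \<le> L * nJ ?D" by (simp add: L_def algebra_simps)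
qed

lemma T_interior: "\<exists>m M. a < m \<and> M < b \<and> m \<le> M \<and> (\<forall>x. m * norm x \<le> norm (T x) \<and> norm (T x) \<le> M * norm x)"
proof -
  note P = abs_op_selfadjoint[OF T_BH]
  let ?S = "real_spectrum (abs_op T)"
  obtain z :: 'h where "z \<noteq> 0" using nontrivial by blast
  then have ne: "?S \<noteq> {}" by (rule real_spectrum_nonempty[OF P])
  obtain m where m: "m \<in> ?S" "\<And>s. s \<in> ?S \<Longrightarrow> m \<le> s"
    using compact_attains_inf[OF compact_real_spectrum[OF P] ne] by blast
  obtain M where M: "M \<in> ?S" "\<And>s. s \<in> ?S \<Longrightarrow> s \<le> M"
    using compact_attains_sup[OF compact_real_spectrum[OF P] ne] by blast
  have "?S \<subseteq> {m..M}" using m M by auto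
  moreover have "a < m" "M < b" "m \<le> M" using m M T_spectrum by auto
  ultimately show ?thesis
    using abs_op_spectrum_iff[OF T_BH, of m M] ab by (intro exI[of _ m] exI[of _ M]) auto
qed

lemma T_dom: "T \<in> flow_domain"
  using dom_iff[OF T_BH] zero_mem spectrum_subset_iff[OF abs_op_selfadjoint[OF T_BH]] T_spectrum
  by force

lemma field_mem: "X \<in> flow_domain \<Longrightarrow> flow_field X \<in> J"
  using add_mem[OF field_lipschitz(1)[OF _ T_dom, of X], of "flow_field T"] comm
  by (simp add: flow_field_def generator_def)

text \<open>
  Adding a scalar to the generator does not change the commutator, so \<open>c\<close> is at our disposal.
\<close>

lemma field_shift:
  fixes h c :: real
  defines "G X \<equiv> generator X - c *\<^sub>R id_blinfun"
  shows "X + h *\<^sub>R flow_field X = ((id_blinfun + h *\<^sub>R G X) o\<^sub>L (X o\<^sub>L (id_blinfun - h *\<^sub>R G X))) + (h\<^sup>2) *\<^sub>R (G X o\<^sub>L (X o\<^sub>L G X))"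
  by (simp add: G_def flow_field_def commutator_def op_compose.add_left op_compose.add_right op_compose.diff_left
      op_compose.diff_right op_compose.scaleR_left op_compose.scaleR_right algebra_simps power2_eq_square)

lemma cfc_affine_gen:
  assumes X: "X \<in> flow_domain"
  shows "cfc (\<lambda>s. 1 + h * (\<phi> s - c)) (abs_op X) = id_blinfun + h *\<^sub>R (generator X - c *\<^sub>R id_blinfun)"
    and "cfc (\<lambda>s. s * (1 + h * (\<phi> s - c))) (abs_op X) = abs_op X o\<^sub>L (id_blinfun + h *\<^sub>R (generator X - c *\<^sub>R id_blinfun))"
    and "continuous_on (real_spectrum (abs_op X)) (\<lambda>s. 1 + h * (\<phi> s - c))"
proof -
  note P = abs_op_selfadjoint[OF dom_BH[OF X]] and f = dom_phi_cont[OF X]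
  show c: "continuous_on (real_spectrum (abs_op X)) (\<lambda>s. 1 + h * (\<phi> s - c))"
    by (intro continuous_intros f)
  have "cfc (\<lambda>s. 1 + h * (\<phi> s - c)) (abs_op X) = cfc (\<lambda>s. h * \<phi> s + (1 - h * c)) (abs_op X)"
    by (simp add: algebra_simps)
  also have "\<dots> = cfc (\<lambda>s. h * \<phi> s) (abs_op X) + cfc (\<lambda>s. 1 - h * c) (abs_op X)"
    by (rule cfc_add[OF P]) (intro continuous_intros f)+
  also have "cfc (\<lambda>s. h * \<phi> s) (abs_op X) = cfc (\<lambda>s. h) (abs_op X) o\<^sub>L cfc \<phi> (abs_op X)"
    by (rule cfc_mult[OF P]) (intro continuous_intros f)+
  finally show 1: "cfc (\<lambda>s. 1 + h * (\<phi> s - c)) (abs_op X) = id_blinfun + h *\<^sub>R (generator X - c *\<^sub>R id_blinfun)"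
    by (simp add: cfc_const[OF P] generator_def op_compose.scaleR_left algebra_simps)
  have "cfc (\<lambda>s. s * (1 + h * (\<phi> s - c))) (abs_op X)
      = cfc (\<lambda>s. s) (abs_op X) o\<^sub>L cfc (\<lambda>s. 1 + h * (\<phi> s - c)) (abs_op X)"
    by (rule cfc_mult[OF P]) (intro continuous_intros c)+
  then show "cfc (\<lambda>s. s * (1 + h * (\<phi> s - c))) (abs_op X) = abs_op X o\<^sub>L (id_blinfun + h *\<^sub>R (generator X - c *\<^sub>R id_blinfun))"
    by (simp only: 1 cfc_ident[OF P])
qed

lemma second_order_bound:
  assumes X: "X \<in> flow_domain" and c: "\<bar>c\<bar> \<le> \<Phi>"
  defines "G \<equiv> generator X - c *\<^sub>R id_blinfun"
  shows "norm ((h\<^sup>2) *\<^sub>R (G o\<^sub>L (X o\<^sub>L G))) \<le> h\<^sup>2 * (4 * \<Phi>\<^sup>2 * b)"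
proof -
  have "norm G \<le> norm (generator X) + norm (c *\<^sub>R (id_blinfun :: 'h \<Rightarrow>\<^sub>L 'h))" unfolding G_def by (rule norm_triangle_ineq4)
  also have "norm (c *\<^sub>R (id_blinfun :: 'h \<Rightarrow>\<^sub>L 'h)) \<le> \<Phi> * 1"
    unfolding norm_scaleR using c Phi_nonneg by (intro mult_mono norm_id_blinfun_le) auto
  finally have G: "norm G \<le> 2 * \<Phi>" using norm_gen[OF X] by simp
  have "norm (G o\<^sub>L (X o\<^sub>L G)) \<le> norm G * norm (X o\<^sub>L G)" by (rule norm_blinfun_compose)
  also have "\<dots> \<le> norm G * (norm X * norm G)" by (intro mult_left_mono norm_blinfun_compose) auto
  also have "\<dots> \<le> (2 * \<Phi>) * (b * (2 * \<Phi>))"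
    using G dom_norm[OF X] ab Phi_nonneg by (intro mult_mono) auto
  finally have "h\<^sup>2 * norm (G o\<^sub>L (X o\<^sub>L G)) \<le> h\<^sup>2 * ((2 * \<Phi>) * (b * (2 * \<Phi>)))"
    by (rule mult_left_mono) simp
  then show ?thesis by (simp add: power2_eq_square mult_ac)
qed

lemma phi_near:
  assumes r: "r \<in> {a..b}" and e: "0 < e"
  obtains d where "0 < d" "\<And>s. s \<in> {a..b} \<Longrightarrow> \<bar>s - r\<bar> < d \<Longrightarrow> \<bar>\<phi> s - \<phi> r\<bar> \<le> e"
proof -
  obtain d where "0 < d" "\<forall>s\<in>{a..b}. dist s r < d \<longrightarrow> dist (\<phi> s) (\<phi> r) < e"
    using phi_cont r e unfolding continuous_on_iff by blast
  then show ?thesis by (intro that[of d]) (auto simp: dist_real_def less_imp_le)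
qed

lemma small_step:
  assumes "0 < \<eta>" "0 < e"
  obtains d where "0 < d" "\<And>h. 0 < h \<Longrightarrow> h < d \<Longrightarrow> 2 * \<Phi> * h \<le> 1 \<and> 2 * \<Phi> * h * b \<le> \<eta> \<and> h\<^sup>2 * (4 * \<Phi>\<^sup>2 * b) \<le> h * e"
proof -
  have 1: "0 < 2 * \<Phi> + 1" "0 < 2 * \<Phi> * b + 1" "0 < 4 * \<Phi>\<^sup>2 * b + 1"
    using Phi_nonneg ab by (auto intro!: add_nonneg_pos)
  define d where "d = min (1 / (2 * \<Phi> + 1)) (min (\<eta> / (2 * \<Phi> * b + 1)) (e / (4 * \<Phi>\<^sup>2 * b + 1)))"
  have "2 * \<Phi> * h \<le> 1 \<and> 2 * \<Phi> * h * b \<le> \<eta> \<and> h\<^sup>2 * (4 * \<Phi>\<^sup>2 * b) \<le> h * e" if h: "0 < h" "h < d" for h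
  proof -
    have "h * (2 * \<Phi> + 1) < 1" "h * (2 * \<Phi> * b + 1) < \<eta>" "h * (4 * \<Phi>\<^sup>2 * b + 1) < e"
      using h 1 by (auto simp: d_def pos_less_divide_eq)
    then have *: "2 * \<Phi> * h \<le> 1" "2 * \<Phi> * h * b \<le> \<eta>" "h * (4 * \<Phi>\<^sup>2 * b) \<le> e"
      using h by (auto simp: algebra_simps)
    have "h\<^sup>2 * (4 * \<Phi>\<^sup>2 * b) = h * (h * (4 * \<Phi>\<^sup>2 * b))" by (simp add: power2_eq_square)
    also have "\<dots> \<le> h * e" using * h by (intro mult_left_mono) auto
    finally show ?thesis using * by simp
  qed
  moreover have "0 < d" using 1 assms by (simp add: d_def)
  ultimately show ?thesis using that by blast
qed

text \<open>
  With \<open>c = \<phi>(r)\<close>, \<open>r = \<parallel>X\<parallel>\<close>, monotonicity makes \<open>\<phi>(|X|) - c\<close> nonpositive, so the left factor in \<open>field_shift\<close>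
  is a contraction. The norm of the remaining product is at most the supremum over spectral values \<open>s \<le> r\<close> of
  \<open>s (1 + h (c - \<phi>(s)))\<close>. Near \<open>r\<close> the gain is \<open>o(h)\<close> by continuity of \<open>\<phi>\<close>; away from \<open>r\<close> the deficit \<open>r - s\<close>
  outweighs the gain \<open>O(h)\<close>.
\<close>

lemma norm_step:
  assumes X: "X \<in> flow_domain" and e: "0 < e"
  shows "\<exists>d>0. \<forall>h. 0 < h \<longrightarrow> h < d \<longrightarrow> norm (X + h *\<^sub>R flow_field X) \<le> norm X + h * e"
proof -
  define r where "r = norm X"
  obtain z :: 'h where z: "z \<noteq> 0" using nontrivial by blast
  have "a * norm z \<le> norm X * norm z" using dom_bounds(1)[OF X] norm_blinfun order_trans by blast
  then have r: "a \<le> r" "r \<le> b" using z dom_norm[OF X] by (auto simp: r_def)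
  define c where "c = \<phi> r"
  have c: "\<bar>c\<bar> \<le> \<Phi>" unfolding c_def by (rule phi_bound) (use r in auto)
  have sp: "real_spectrum (abs_op X) \<subseteq> {a..r}"
    using abs_op_spectrum_iff[OF dom_BH[OF X], of a r] ab r dom_bounds(1)[OF X] by (auto simp: r_def norm_blinfun)
  note P = abs_op_selfadjoint[OF dom_BH[OF X]]
  have eb: "0 < e / 2 / b" using e ab by simp
  obtain \<eta> where \<eta>: "0 < \<eta>" "\<And>s. s \<in> {a..b} \<Longrightarrow> \<bar>s - r\<bar> < \<eta> \<Longrightarrow> \<bar>\<phi> s - \<phi> r\<bar> \<le> e / 2 / b"
    using phi_near[OF _ eb, of r] r by auto
  obtain d where d: "0 < d" "\<And>h. 0 < h \<Longrightarrow> h < d \<Longrightarrow>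
      2 * \<Phi> * h \<le> 1 \<and> 2 * \<Phi> * h * b \<le> \<eta> \<and> h\<^sup>2 * (4 * \<Phi>\<^sup>2 * b) \<le> h * (e / 2)"
    using small_step[OF \<eta>(1), of "e / 2"] e by auto
  have "norm (X + h *\<^sub>R flow_field X) \<le> norm X + h * e" if h: "0 < h" "h < d" for h
  proof -
    note d = d(2)[OF h]
    have he: "0 \<le> h * (e / 2)" using h e by simp
    define G where "G = generator X - c *\<^sub>R id_blinfun"
    have phi: "- 2 * \<Phi> \<le> \<phi> s - c" "\<phi> s - c \<le> 0" if "s \<in> real_spectrum (abs_op X)" for s
    proof -
      have s: "s \<in> {a..b}" "s \<le> r" using that sp r by auto
      show "- 2 * \<Phi> \<le> \<phi> s - c" using phi_bound[OF s(1)] c by (auto simp: abs_le_iff)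
      show "\<phi> s - c \<le> 0" using monotone_onD[OF phi_mono s(1), of r] r s by (simp add: c_def)
    qed
    have A: "norm (id_blinfun + h *\<^sub>R G) \<le> 1"
      unfolding G_def cfc_affine_gen(1)[OF X, symmetric]
    proof (rule cfc_norm_le[OF P cfc_affine_gen(3)[OF X]])
      fix s assume "s \<in> real_spectrum (abs_op X)"
      note phi = phi[OF this]
      have "h * (- 2 * \<Phi>) \<le> h * (\<phi> s - c)" using phi(1) by (rule mult_left_mono) (use h in simp)
      moreover have "h * (\<phi> s - c) \<le> 0" using phi(2) h by (intro mult_nonneg_nonpos) auto
      ultimately      show "\<bar>1 + h * (\<phi> s - c)\<bar> \<le> 1" using d by (simp add: abs_le_iff algebra_simps)
    qed simp
    have "norm (abs_op X o\<^sub>L (id_blinfun + (- h) *\<^sub>R G)) \<le> r + h * (e / 2)"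
      unfolding G_def cfc_affine_gen(2)[OF X, symmetric]
    proof (rule cfc_norm_le[OF P])
      show "continuous_on (real_spectrum (abs_op X)) (\<lambda>s. s * (1 + (- h) * (\<phi> s - c)))"
        by (intro continuous_intros dom_phi_cont[OF X])
      show "0 \<le> r + h * (e / 2)" using r ab h e by simp
      fix s assume sS: "s \<in> real_spectrum (abs_op X)"
      then have s: "a \<le> s" "s \<le> r" "s \<le> b" using sp r by auto
      have inc: "0 \<le> h * (c - \<phi> s)" using phi(2)[OF sS] h by (intro mult_nonneg_nonneg) auto
      have "s + s * (h * (c - \<phi> s)) \<le> r + h * (e / 2)"
      proof (cases "r - s < \<eta>")
        case True
        then have "c - \<phi> s \<le> e / 2 / b" using \<eta>(2)[of s] s by (simp add: c_def abs_le_iff)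
        then have "h * (c - \<phi> s) \<le> h * (e / 2 / b)" using h by (intro mult_left_mono) auto
        then have "s * (h * (c - \<phi> s)) \<le> b * (h * (e / 2 / b))"
          by (rule mult_mono[OF s(3) _ _ inc]) (use ab in simp)
        also have "\<dots> = h * (e / 2)" using ab by simp
        finally show ?thesis using s by simp
      next
        case False
        have "h * (c - \<phi> s) \<le> h * (2 * \<Phi>)" using phi(1)[OF sS] h by (intro mult_left_mono) auto
        then have "s * (h * (c - \<phi> s)) \<le> b * (h * (2 * \<Phi>))"
          by (rule mult_mono[OF s(3) _ _ inc]) (use ab in simp)
        also have "\<dots> \<le> \<eta>" using d by (simp add: mult_ac)
        finally show ?thesis using False he s by linarith
      qed
      moreover have "0 \<le> s + s * (h * (c - \<phi> s))" using mult_nonneg_nonneg[OF _ inc, of s] s ab by linarith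
      moreover have "s * (1 + (- h) * (\<phi> s - c)) = s + s * (h * (c - \<phi> s))" by (simp add: algebra_simps)
      ultimately show "\<bar>s * (1 + (- h) * (\<phi> s - c))\<bar> \<le> r + h * (e / 2)" by simp
    qed
    then have "norm ((abs_op X o\<^sub>L (id_blinfun + (- h) *\<^sub>R G)) x) \<le> (r + h * (e / 2)) * norm x" for x
      by (meson norm_blinfun mult_right_mono norm_ge_zero order_trans)
    then have "norm (X o\<^sub>L (id_blinfun - h *\<^sub>R G)) \<le> r + h * (e / 2)"
      using r ab h e by (intro norm_blinfun_bound) (auto simp: norm_abs_op[OF dom_BH[OF X]])
    then have "norm ((id_blinfun + h *\<^sub>R G) o\<^sub>L (X o\<^sub>L (id_blinfun - h *\<^sub>R G))) \<le> 1 * (r + h * (e / 2))"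
      using order_trans[OF norm_blinfun_compose mult_mono[OF A]] by simp
    moreover have "norm ((h\<^sup>2) *\<^sub>R (G o\<^sub>L (X o\<^sub>L G))) \<le> h * (e / 2)"
      using second_order_bound[OF X c, of h] d unfolding G_def by linarith
    ultimately have "norm (X + h *\<^sub>R flow_field X) \<le> 1 * (r + h * (e / 2)) + h * (e / 2)"
      unfolding field_shift[of X h c] G_def[symmetric] by (intro order_trans[OF norm_triangle_ineq] add_mono)
    then show ?thesis by (simp add: r_def field_simps)
  qed
  with d(1) show ?thesis by blast
qed

text \<open>
  The mirror image of the previous lemma: with \<open>c\<close> the value of \<open>\<phi>\<close> at the minimum modulus, the left
  factor is expansive and the remaining product loses only \<open>o(h)\<close>.
\<close>

lemma lower_bound_step:
  assumes X: "X \<in> flow_domain" and e: "0 < e"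
  shows "\<exists>d>0. \<forall>h. 0 < h \<longrightarrow> h < d \<longrightarrow> lower_bound X - h * e \<le> lower_bound (X + h *\<^sub>R flow_field X)"
proof -
  define r where "r = lower_bound X"
  obtain z :: 'h where z: "z \<noteq> 0" using nontrivial by blast
  have "r * norm z \<le> b * norm z"
    unfolding r_def using lower_bound_le[of X z] dom_bounds(2)[OF X, of z] by linarith
  then have r: "a \<le> r" "r \<le> b"
    using z lower_bound_ge[OF z dom_bounds(1)[OF X]] by (auto simp: r_def)
  define c where "c = \<phi> r"
  have c: "\<bar>c\<bar> \<le> \<Phi>" unfolding c_def by (rule phi_bound) (use r in auto)
  have sp: "real_spectrum (abs_op X) \<subseteq> {r..b}"
    using abs_op_spectrum_iff[OF dom_BH[OF X], of r b] ab r dom_bounds(2)[OF X] by (auto simp: r_def lower_bound_le)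
  note P = abs_op_selfadjoint[OF dom_BH[OF X]]
  have eb: "0 < e / 2 / b" using e ab by simp
  obtain \<eta> where \<eta>: "0 < \<eta>" "\<And>s. s \<in> {a..b} \<Longrightarrow> \<bar>s - r\<bar> < \<eta> \<Longrightarrow> \<bar>\<phi> s - \<phi> r\<bar> \<le> e / 2 / b"
    using phi_near[OF _ eb, of r] r by auto
  obtain d where d: "0 < d" "\<And>h. 0 < h \<Longrightarrow> h < d \<Longrightarrow>
      2 * \<Phi> * h \<le> 1 \<and> 2 * \<Phi> * h * b \<le> \<eta> \<and> h\<^sup>2 * (4 * \<Phi>\<^sup>2 * b) \<le> h * (e / 2)"
    using small_step[OF \<eta>(1), of "e / 2"] e by auto
  have "r - h * e \<le> lower_bound (X + h *\<^sub>R flow_field X)" if h: "0 < h" "h < d" for h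
  proof -
    note d = d(2)[OF h]
    have he: "0 \<le> h * (e / 2)" using h e by simp
    define G where "G = generator X - c *\<^sub>R id_blinfun"
    have phi: "0 \<le> h * (\<phi> s - c)" "h * (\<phi> s - c) \<le> 2 * \<Phi> * h" if "s \<in> real_spectrum (abs_op X)" for s
    proof -
      have s: "s \<in> {a..b}" "r \<le> s" using that sp r by auto
      have "\<phi> s - c \<le> 2 * \<Phi>" using phi_bound[OF s(1)] c by (auto simp: abs_le_iff)
      then show "h * (\<phi> s - c) \<le> 2 * \<Phi> * h" using h mult_left_mono[of "\<phi> s - c" "2 * \<Phi>" h] by (simp add: mult_ac)
      show "0 \<le> h * (\<phi> s - c)"
        using monotone_onD[OF phi_mono _ s(1), of r] r s h by (simp add: c_def)
    qed
    have A: "norm y \<le> norm ((id_blinfun + h *\<^sub>R G) y)" for y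
    proof -
      have "1 * norm y \<le> norm (cfc (\<lambda>s. 1 + h * (\<phi> s - c)) (abs_op X) y)"
        by (rule cfc_bounds(2)[OF P cfc_affine_gen(3)[OF X], of 1 "1 + 2 * \<Phi> * h"])
          (use phi Phi_nonneg h in auto)
      then show ?thesis by (simp add: cfc_affine_gen(1)[OF X] G_def)
    qed
    have "(r - h * (e / 2)) * norm x \<le> norm (cfc (\<lambda>s. s * (1 + (- h) * (\<phi> s - c))) (abs_op X) x)" for x
    proof (rule cfc_bounds(2)[OF P])
      show "continuous_on (real_spectrum (abs_op X)) (\<lambda>s. s * (1 + (- h) * (\<phi> s - c)))"
        by (intro continuous_intros dom_phi_cont[OF X])
      show "r - h * (e / 2) \<le> b" using r he by linarith
      fix s assume sS: "s \<in> real_spectrum (abs_op X)"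
      then have s: "a \<le> s" "r \<le> s" "s \<le> b" using sp r by auto
      have "r - h * (e / 2) \<le> s - s * (h * (\<phi> s - c))"
      proof (cases "s - r < \<eta>")
        case True
        then have "\<phi> s - c \<le> e / 2 / b" using \<eta>(2)[of s] s by (simp add: c_def abs_le_iff)
        then have "h * (\<phi> s - c) \<le> h * (e / 2 / b)" using h by (intro mult_left_mono) auto
        then have "s * (h * (\<phi> s - c)) \<le> b * (h * (e / 2 / b))"
          by (rule mult_mono[OF s(3) _ _ phi(1)[OF sS]]) (use ab in simp)
        also have "\<dots> = h * (e / 2)" using ab by simp
        finally show ?thesis using s by simp
      next
        case False
        have "s * (h * (\<phi> s - c)) \<le> b * (2 * \<Phi> * h)"
          by (rule mult_mono[OF s(3) phi(2)[OF sS] _ phi(1)[OF sS]]) (use ab in simp)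
        also have "\<dots> \<le> \<eta>" using d by (simp add: mult_ac)
        finally show ?thesis using False he s by linarith
      qed
      moreover have "s - s * (h * (\<phi> s - c)) \<le> b"
        using s ab mult_nonneg_nonneg[of s, OF _ phi(1)[OF sS]] by linarith
      moreover have "s * (1 + (- h) * (\<phi> s - c)) = s - s * (h * (\<phi> s - c))" by (simp add: algebra_simps)
      ultimately show "r - h * (e / 2) \<le> s * (1 + (- h) * (\<phi> s - c)) \<and> s * (1 + (- h) * (\<phi> s - c)) \<le> b" by simp
    qed
    then have B: "(r - h * (e / 2)) * norm x \<le> norm (X ((id_blinfun - h *\<^sub>R G) x))" for x
      unfolding cfc_affine_gen(2)[OF X] by (simp add: norm_abs_op[OF dom_BH[OF X]] G_def)
    have S: "norm ((h\<^sup>2) *\<^sub>R (G o\<^sub>L (X o\<^sub>L G))) \<le> h * (e / 2)"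
      using second_order_bound[OF X c, of h] d unfolding G_def by linarith
    show ?thesis
    proof (rule lower_bound_ge[OF z])
      fix x
      let ?M = "(id_blinfun + h *\<^sub>R G) o\<^sub>L (X o\<^sub>L (id_blinfun - h *\<^sub>R G))"
      let ?R = "(h\<^sup>2) *\<^sub>R (G o\<^sub>L (X o\<^sub>L G))"
      have "(r - h * (e / 2)) * norm x \<le> norm (?M x)"
        using order_trans[OF B[of x] A[of "X ((id_blinfun - h *\<^sub>R G) x)"]] by simp
      moreover have "norm (?R x) \<le> h * (e / 2) * norm x"
        using S by (meson norm_blinfun mult_right_mono norm_ge_zero order_trans)
      moreover have "norm (?M x) - norm (?R x) \<le> norm (?M x + ?R x)" by (rule norm_diff_ineq)
      ultimately have "(r - h * (e / 2)) * norm x - h * (e / 2) * norm x \<le> norm ((?M + ?R) x)"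
        by (simp add: blinfun.add_left)
      then show "(r - h * e) * norm x \<le> norm ((X + h *\<^sub>R flow_field X) x)"
        unfolding field_shift[of X h c] G_def[symmetric] by (simp add: algebra_simps)
    qed
  qed
  with d(1) show ?thesis unfolding r_def by blast
qed

section \<open>Solutions: invariant bounds, continuation and uniqueness\<close>

text \<open>
  Solutions on a bounded interval, with the uniform quadratic Taylor remainder that Picard iteration
  provides.
\<close>

definition sol :: "real \<Rightarrow> (real \<Rightarrow> 'h \<Rightarrow>\<^sub>L 'h) \<Rightarrow> bool" where
  "sol \<tau> X \<longleftrightarrow> X 0 = T \<and> (\<forall>t\<in>{0..\<tau>}. X t \<in> flow_domain) \<and>
    (\<exists>K\<ge>0. \<forall>s\<in>{0..\<tau>}. \<forall>t\<in>{0..\<tau>}. nJ (X s - X t - (s - t) *\<^sub>R flow_field (X t)) \<le> K * (s - t)\<^sup>2)"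

lemma sol_mono: "sol \<tau> X \<Longrightarrow> \<tau>' \<le> \<tau> \<Longrightarrow> sol \<tau>' X"
  unfolding sol_def by fastforce

lemma sol_dom: "sol \<tau> X \<Longrightarrow> 0 \<le> t \<Longrightarrow> t \<le> \<tau> \<Longrightarrow> X t \<in> flow_domain"
  by (simp add: sol_def)

lemma sol_0: "sol \<tau> X \<Longrightarrow> X 0 = T"
  by (simp add: sol_def)

lemma remainder_mem: "x \<in> flow_domain \<Longrightarrow> y \<in> flow_domain \<Longrightarrow> z \<in> flow_domain \<Longrightarrow> x - y - c *\<^sub>R flow_field z \<in> J"
  by (intro diff_mem[OF dom_diff scale_mem] field_mem)

lemma sol_remainder:
  assumes "sol \<tau> X"
  obtains K where "0 \<le> K"
    "\<And>s t. s \<in> {0..\<tau>} \<Longrightarrow> t \<in> {0..\<tau>} \<Longrightarrow> nJ (X s - X t - (s - t) *\<^sub>R flow_field (X t)) \<le> K * (s - t)\<^sup>2"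
    "\<And>s t. s \<in> {0..\<tau>} \<Longrightarrow> t \<in> {0..\<tau>} \<Longrightarrow> norm (X s - X t - (s - t) *\<^sub>R flow_field (X t)) \<le> K * (s - t)\<^sup>2"
    "\<And>s t. s \<in> {0..\<tau>} \<Longrightarrow> t \<in> {0..\<tau>} \<Longrightarrow> nJ (X s - X t) \<le> \<bar>s - t\<bar> * nJ (flow_field (X t)) + K * (s - t)\<^sup>2"
proof -
  obtain K where K: "0 \<le> K"
    "\<And>s t. s \<in> {0..\<tau>} \<Longrightarrow> t \<in> {0..\<tau>} \<Longrightarrow> nJ (X s - X t - (s - t) *\<^sub>R flow_field (X t)) \<le> K * (s - t)\<^sup>2"
    using assms unfolding sol_def by blast
  have d: "X t \<in> flow_domain" if "t \<in> {0..\<tau>}" for t using assms that by (simp add: sol_def)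
  show ?thesis
  proof (rule that[OF K])
    fix s t assume st: "s \<in> {0..\<tau>}" "t \<in> {0..\<tau>}"
    have m: "X s - X t - (s - t) *\<^sub>R flow_field (X t) \<in> J" using st d by (intro remainder_mem)
    show "norm (X s - X t - (s - t) *\<^sub>R flow_field (X t)) \<le> K * (s - t)\<^sup>2"
      using K(2)[OF st] norm_le[OF m] by linarith
    have "nJ (X s - X t) \<le> nJ (X s - X t - (s - t) *\<^sub>R flow_field (X t)) + nJ ((s - t) *\<^sub>R flow_field (X t))"
      using triangle[OF m scale_mem[OF field_mem[OF d[OF st(2)]]], of "s - t"] by simp
    then show "nJ (X s - X t) \<le> \<bar>s - t\<bar> * nJ (flow_field (X t)) + K * (s - t)\<^sup>2"
      using K(2)[OF st] nK_scale[OF field_mem[OF d[OF st(2)]], of "s - t"] by simp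
  qed
qed

lemma sol_derivative:
  assumes "sol \<tau> X" "t \<in> {0..\<tau>}"
  shows "(X has_vector_derivative flow_field (X t)) (at t within {0..\<tau>})"
proof -
  obtain K where
    "\<And>s t. s \<in> {0..\<tau>} \<Longrightarrow> t \<in> {0..\<tau>} \<Longrightarrow> norm (X s - X t - (s - t) *\<^sub>R flow_field (X t)) \<le> K * (s - t)\<^sup>2"
    by (rule sol_remainder[OF assms(1)], rule that)
  then show ?thesis using assms(2) by (intro quadratic_remainder_derivative)
qed

text \<open>
  The one-step estimates say that \<open>\<parallel>X(t)\<parallel>\<close> and the negative of the minimum modulus have upper Dini
  derivative at most \<open>0\<close>.
\<close>

lemma sol_bounds:
  assumes sol: "sol \<tau> X" and \<tau>: "0 \<le> \<tau>"
  shows "norm (X \<tau>) \<le> norm T" "lower_bound T \<le> lower_bound (X \<tau>)"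
proof -
  obtain z :: 'h where z: "z \<noteq> 0" using nontrivial by blast
  obtain K where K: "0 \<le> K"
    "\<And>s t. s \<in> {0..\<tau>} \<Longrightarrow> t \<in> {0..\<tau>} \<Longrightarrow> norm (X s - X t - (s - t) *\<^sub>R flow_field (X t)) \<le> K * (s - t)\<^sup>2"
    by (rule sol_remainder[OF sol], rule that)
  have dist: "norm (X s - X t) \<le> norm (flow_field (X t)) * \<bar>s - t\<bar> + K * (s - t)\<^sup>2"
    if "s \<in> {0..\<tau>}" "t \<in> {0..\<tau>}" for s t
    using norm_triangle_ineq2[of "X s - X t" "(s - t) *\<^sub>R flow_field (X t)"] K(2)[OF that] by (simp add: mult.commute)
  have lb: "\<bar>lower_bound X' - lower_bound Y\<bar> \<le> norm (X' - Y)" for X' Y :: "'h \<Rightarrow>\<^sub>L 'h"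
    using lower_bound_perturb[OF z, of X' Y] lower_bound_perturb[OF z, of Y X'] by (simp add: norm_minus_commute abs_le_iff)
  have cont: "continuous_on {0..\<tau>} (\<lambda>t. norm (X t))" "continuous_on {0..\<tau>} (\<lambda>t. - lower_bound (X t))"
  proof -
    have *: "\<bar>norm (X s) - norm (X t)\<bar> \<le> norm (flow_field (X t)) * \<bar>s - t\<bar> + K * (s - t)\<^sup>2"
      "\<bar>- lower_bound (X s) - - lower_bound (X t)\<bar> \<le> norm (flow_field (X t)) * \<bar>s - t\<bar> + K * (s - t)\<^sup>2"
      if "s \<in> {0..\<tau>}" "t \<in> {0..\<tau>}" for s t
      using dist[OF that] lb[of "X s" "X t"] norm_triangle_ineq3[of "X s" "X t"] by linarith+
    show "continuous_on {0..\<tau>} (\<lambda>t. norm (X t))" by (rule continuous_on_linear_quadratic[OF *(1)])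
    show "continuous_on {0..\<tau>} (\<lambda>t. - lower_bound (X t))" by (rule continuous_on_linear_quadratic[OF *(2)])
  qed
  have rem: "\<exists>d>0. \<forall>s. t < s \<longrightarrow> s < t + d \<longrightarrow> s \<le> \<tau> \<longrightarrow>
      norm (X s - (X t + (s - t) *\<^sub>R flow_field (X t))) \<le> (s - t) * (e / 2)" if t: "0 \<le> t" "t < \<tau>" and e: "0 < e" for t e
  proof (intro exI[of _ "e / 2 / (K + 1)"] conjI allI impI)
    fix s assume s: "t < s" "s < t + e / 2 / (K + 1)" "s \<le> \<tau>"
    have "norm (X s - (X t + (s - t) *\<^sub>R flow_field (X t))) \<le> K * (s - t)\<^sup>2"
      using K(2)[of s t] s t by (simp add: algebra_simps)
    also have "\<dots> = (s - t) * (K * (s - t))" by (simp add: power2_eq_square)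
    also have "\<dots> \<le> (s - t) * (e / 2)"
    proof (rule mult_left_mono)
      have "(K + 1) * (s - t) \<le> e / 2" using s K(1) by (simp add: field_simps)
      then show "K * (s - t) \<le> e / 2" using s by (simp add: algebra_simps)
    qed (use s in simp)
    finally show "norm (X s - (X t + (s - t) *\<^sub>R flow_field (X t))) \<le> (s - t) * (e / 2)" .
  qed (use e K in simp)
  have "norm (X \<tau>) \<le> norm (X 0)"
  proof (rule dini_nonincreasing[OF cont(1) \<tau>])
    fix t e :: real assume t: "0 \<le> t" "t < \<tau>" and e: "0 < e"
    obtain d where d: "0 < d" "\<And>s. t < s \<Longrightarrow> s < t + d \<Longrightarrow> s \<le> \<tau> \<Longrightarrow>
        norm (X s - (X t + (s - t) *\<^sub>R flow_field (X t))) \<le> (s - t) * (e / 2)" using rem[OF t e] by blast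
    have "X t \<in> flow_domain" "0 < e / 2" using sol_dom[OF sol] t e by auto
    from norm_step[OF this] obtain d' where d': "0 < d'" "\<And>h. 0 < h \<Longrightarrow> h < d' \<Longrightarrow>
        norm (X t + h *\<^sub>R flow_field (X t)) \<le> norm (X t) + h * (e / 2)" by blast
    show "\<exists>d>0. \<forall>s. t < s \<longrightarrow> s < t + d \<longrightarrow> s \<le> \<tau> \<longrightarrow> norm (X s) \<le> norm (X t) + e * (s - t)"
    proof (intro exI[of _ "min d d'"] conjI allI impI)
      fix s assume s: "t < s" "s < t + min d d'" "s \<le> \<tau>"
      have "norm (X s) - norm (X t + (s - t) *\<^sub>R flow_field (X t)) \<le> (s - t) * (e / 2)"
        using norm_triangle_ineq2[of "X s" "X t + (s - t) *\<^sub>R flow_field (X t)"] d(2)[of s] s by linarith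
      moreover have "norm (X t + (s - t) *\<^sub>R flow_field (X t)) \<le> norm (X t) + (s - t) * (e / 2)"
        using d'(2)[of "s - t"] s by auto
      ultimately show "norm (X s) \<le> norm (X t) + e * (s - t)" by (simp add: field_simps)
    qed (use d d' in simp)
  qed
  then show "norm (X \<tau>) \<le> norm T" by (simp add: sol_0[OF sol])
  have "- lower_bound (X \<tau>) \<le> - lower_bound (X 0)"
  proof (rule dini_nonincreasing[OF cont(2) \<tau>])
    fix t e :: real assume t: "0 \<le> t" "t < \<tau>" and e: "0 < e"
    obtain d where d: "0 < d" "\<And>s. t < s \<Longrightarrow> s < t + d \<Longrightarrow> s \<le> \<tau> \<Longrightarrow>
        norm (X s - (X t + (s - t) *\<^sub>R flow_field (X t))) \<le> (s - t) * (e / 2)" using rem[OF t e] by blast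
    have "X t \<in> flow_domain" "0 < e / 2" using sol_dom[OF sol] t e by auto
    from lower_bound_step[OF this] obtain d' where d': "0 < d'" "\<And>h. 0 < h \<Longrightarrow> h < d' \<Longrightarrow>
        lower_bound (X t) - h * (e / 2) \<le> lower_bound (X t + h *\<^sub>R flow_field (X t))" by blast
    show "\<exists>d>0. \<forall>s. t < s \<longrightarrow> s < t + d \<longrightarrow> s \<le> \<tau> \<longrightarrow> - lower_bound (X s) \<le> - lower_bound (X t) + e * (s - t)"
    proof (intro exI[of _ "min d d'"] conjI allI impI)
      fix s assume s: "t < s" "s < t + min d d'" "s \<le> \<tau>"
      have "lower_bound (X t + (s - t) *\<^sub>R flow_field (X t)) - lower_bound (X s) \<le> (s - t) * (e / 2)"
        using lb[of "X s" "X t + (s - t) *\<^sub>R flow_field (X t)"] d(2)[OF s(1) _ s(3)] s(2) by linarith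
      moreover have "lower_bound (X t) - (s - t) * (e / 2) \<le> lower_bound (X t + (s - t) *\<^sub>R flow_field (X t))"
        using d'(2)[of "s - t"] s by auto
      ultimately show "- lower_bound (X s) \<le> - lower_bound (X t) + e * (s - t)" by (simp add: field_simps)
    qed (use d d' in simp)
  qed
  then show "lower_bound T \<le> lower_bound (X \<tau>)" by (simp add: sol_0[OF sol])
qed

text \<open>
  The majorant \<open>L \<parallel>X(t) - T\<parallel> + \<parallel>F(T)\<parallel>\<close> of \<open>\<parallel>F(X(t))\<parallel>\<close> (norms of \<open>J\<close>) satisfies the differential inequality
  \<open>u' \<le> L u\<close>.
\<close>

lemma sol_growth:
  assumes sol: "sol \<tau> X" and \<tau>: "0 \<le> \<tau>"
  shows "nJ (flow_field (X \<tau>)) \<le> exp (L * \<tau>) * nJ (flow_field T)"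
proof -
  obtain K where K: "0 \<le> K"
    "\<And>s t. s \<in> {0..\<tau>} \<Longrightarrow> t \<in> {0..\<tau>} \<Longrightarrow> nJ (X s - X t) \<le> \<bar>s - t\<bar> * nJ (flow_field (X t)) + K * (s - t)\<^sup>2"
    by (rule sol_remainder[OF sol], rule that)
  define u where "u t = L * nJ (X t - T) + nJ (flow_field T)" for t
  have d: "X t \<in> flow_domain" if "t \<in> {0..\<tau>}" for t using sol_dom[OF sol] that by simp
  have field_u: "nJ (flow_field (X t)) \<le> u t" if t: "t \<in> {0..\<tau>}" for t
  proof -
    have "nJ (flow_field (X t)) \<le> nJ (flow_field (X t) - flow_field T) + nJ (flow_field T)"
      using triangle[OF field_lipschitz(1)[OF d[OF t] T_dom] field_mem[OF T_dom]] by simp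
    with field_lipschitz(2)[OF d[OF t] T_dom] show ?thesis by (simp add: u_def)
  qed
  have u_diff: "\<bar>u s - u t\<bar> \<le> L * nJ (X s - X t)" if "s \<in> {0..\<tau>}" "t \<in> {0..\<tau>}" for s t
  proof -
    have "\<bar>nJ (X s - T) - nJ (X t - T)\<bar> \<le> nJ ((X s - T) - (X t - T))"
      using that d by (intro nK_reverse_triangle dom_J)
    then have "L * \<bar>nJ (X s - T) - nJ (X t - T)\<bar> \<le> L * nJ (X s - X t)"
      using L_nonneg by (intro mult_left_mono) auto
    then show ?thesis using L_nonneg by (simp add: u_def abs_mult flip: right_diff_distrib)
  qed
  have u_step: "\<bar>u s - u t\<bar> \<le> (L * nJ (flow_field (X t))) * \<bar>s - t\<bar> + (L * K) * (s - t)\<^sup>2"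
    if "s \<in> {0..\<tau>}" "t \<in> {0..\<tau>}" for s t
  proof -
    have "L * nJ (X s - X t) \<le> L * (\<bar>s - t\<bar> * nJ (flow_field (X t)) + K * (s - t)\<^sup>2)"
      using K(2)[OF that] L_nonneg by (rule mult_left_mono)
    with u_diff[OF that] show ?thesis by (simp add: algebra_simps)
  qed
  have "u \<tau> \<le> exp (L * \<tau>) * u 0"
  proof (rule gronwall_dini[OF _ \<tau> L_nonneg])
    show "continuous_on {0..\<tau>} u" using u_step by (rule continuous_on_linear_quadratic)
    show "0 \<le> u t" if "0 \<le> t" "t \<le> \<tau>" for t
      using that d[of t] L_nonneg nJ_ge_0[OF dom_J, of "X t"] nJ_ge_0[OF field_mem[OF T_dom]] by (simp add: u_def)
    fix t e :: real assume t: "0 \<le> t" "t < \<tau>" and e: "0 < e"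
    have LK: "0 \<le> L * K" using L_nonneg K by simp
    show "\<exists>d>0. \<forall>s. t < s \<longrightarrow> s < t + d \<longrightarrow> s \<le> \<tau> \<longrightarrow> u s \<le> u t + (s - t) * (L * u t + e)"
    proof (intro exI[of _ "e / (L * K + 1)"] conjI allI impI)
      fix s assume s: "t < s" "s < t + e / (L * K + 1)" "s \<le> \<tau>"
      have "u s - u t \<le> (L * nJ (flow_field (X t))) * (s - t) + (L * K) * (s - t)\<^sup>2"
        using u_step[of s t] s t by auto
      also have "(L * nJ (flow_field (X t))) * (s - t) \<le> (L * u t) * (s - t)"
        using field_u[of t] t s L_nonneg by (intro mult_right_mono mult_left_mono) auto
      also have "(L * K) * (s - t)\<^sup>2 \<le> e * (s - t)"
      proof -
        have "(L * K + 1) * (s - t) \<le> e" using s LK by (simp add: field_simps)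
        then have "L * K * (s - t) \<le> e" using s by (simp add: algebra_simps)
        then have "L * K * (s - t) * (s - t) \<le> e * (s - t)" using s by (intro mult_right_mono) auto
        then show ?thesis by (simp add: power2_eq_square mult_ac)
      qed
      finally show "u s \<le> u t + (s - t) * (L * u t + e)" by (simp add: algebra_simps)
    qed (use e LK in simp)
  qed
  moreover have "u 0 = nJ (flow_field T)" by (simp add: u_def sol_0[OF sol] nK_zero)
  ultimately show ?thesis using field_u[of \<tau>] \<tau> by simp
qed

text \<open>
  By \<open>sol_bounds\<close> the ball of radius \<open>r\<close> around \<open>X \<tau>\<close> stays in the domain of the vector field, however large
  \<open>\<tau>\<close> is. The length \<open>h\<close> of the added interval depends on \<open>\<tau>\<close> only through the bound \<open>A\<close> of the vector field
  at \<open>X \<tau>\<close>.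
\<close>

lemma sol_extend:
  assumes mM: "\<And>x. m * norm x \<le> norm (T x)" "\<And>x. norm (T x) \<le> M * norm x" and M0: "0 \<le> M"
    and r: "0 \<le> r" "a + r \<le> m" "M + r \<le> b"
    and A: "0 \<le> A" and h: "0 \<le> h" "h * (A + L * r) \<le> r" "h * L \<le> 1 / 2"
    and sol: "sol \<tau> X" and \<tau>: "0 \<le> \<tau>" and XA: "nJ (flow_field (X \<tau>)) \<le> A"
  shows "\<exists>Y. sol (\<tau> + h) Y"
proof -
  obtain z :: 'h where z: "z \<noteq> 0" using nontrivial by blast
  define x0 where "x0 = X \<tau>"
  define D where "D = {x. x - x0 \<in> J \<and> nJ (x - x0) \<le> r}"
  have x0: "x0 \<in> flow_domain" unfolding x0_def using sol_dom[OF sol \<tau>] by simp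
  have up: "norm x0 \<le> M"
    using sol_bounds(1)[OF sol \<tau>] norm_blinfun_bound[OF M0 mM(2)] unfolding x0_def by simp
  have low: "m \<le> lower_bound x0"
    using sol_bounds(2)[OF sol \<tau>] lower_bound_ge[OF z mM(1)] unfolding x0_def by simp
  have D_dom: "x \<in> flow_domain" if x: "x \<in> D" for x
  proof -
    have xJ: "x - x0 \<in> J" "norm (x - x0) \<le> r" using x norm_le[of "x - x0"] by (auto simp: D_def)
    have xT: "x - T \<in> J" by (rule diff_trans[OF xJ(1) dom_J[OF x0]])
    have "x = (x - T) + T" by simp
    then have xBH: "x \<in> BH" using BH_add[OF J_BH[OF xT] T_BH] by simp
    have "norm x \<le> b" using norm_triangle_ineq2[of x x0] up xJ r by linarith
    then have "norm (x v) \<le> b * norm v" for v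
      by (meson norm_blinfun mult_right_mono norm_ge_zero order_trans)
    moreover have "a \<le> lower_bound x"
      using lower_bound_perturb[OF z, of x0 x] low xJ r by linarith
    then have "a * norm v \<le> norm (x v)" for v
      using lower_bound_le[of x v] by (meson mult_right_mono norm_ge_zero order_trans)
    ultimately show ?thesis using xBH xT by (simp add: flow_domain_def)
  qed
  have x0D: "x0 \<in> D" using zero_mem nK_zero r by (simp add: D_def)
  have "\<exists>x. x \<tau> = x0 \<and> (\<forall>t\<in>{\<tau>..\<tau> + h}. x t \<in> {x. x - x0 \<in> J \<and> nJ (x - x0) \<le> r}) \<and>
    (\<forall>s\<in>{\<tau>..\<tau> + h}. \<forall>t\<in>{\<tau>..\<tau> + h}.
      nJ (x s - x t - (s - t) *\<^sub>R flow_field (x t)) \<le> 2 * (0 + L * (A + L * r)) * (s - t)\<^sup>2)"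
  proof (rule picard_local; (fold D_def)?)
    show "flow_field x \<in> J" if "x \<in> D" for x using field_mem D_dom that by blast
    show "nJ (flow_field x - flow_field y) \<le> L * nJ (x - y)" if "x \<in> D" "y \<in> D" for x y
      using field_lipschitz(2) D_dom that by blast
    show "nJ (flow_field x) \<le> A + L * r" if x: "x \<in> D" for x
    proof -
      have "nJ (flow_field x) \<le> nJ (flow_field x - flow_field x0) + nJ (flow_field x0)"
        using triangle[OF field_lipschitz(1)[OF D_dom[OF x] x0] field_mem[OF x0]] by simp
      also have "nJ (flow_field x - flow_field x0) \<le> L * nJ (x - x0)" by (rule field_lipschitz(2)[OF D_dom[OF x] x0])
      also have "\<dots> \<le> L * r" using x L_nonneg by (intro mult_left_mono) (auto simp: D_def)
      finally show ?thesis using XA by (simp add: x0_def)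
    qed
  qed (use h r A L_nonneg nK_zero in \<open>auto intro!: add_nonneg_nonneg\<close>)
  then obtain x where x: "x \<tau> = x0" "\<And>t. t \<in> {\<tau>..\<tau> + h} \<Longrightarrow> x t \<in> D"
    "\<And>s t. s \<in> {\<tau>..\<tau> + h} \<Longrightarrow> t \<in> {\<tau>..\<tau> + h} \<Longrightarrow>
      nJ (x s - x t - (s - t) *\<^sub>R flow_field (x t)) \<le> 2 * (0 + L * (A + L * r)) * (s - t)\<^sup>2"
    unfolding D_def by blast
  obtain K where K: "0 \<le> K"
    "\<And>s t. s \<in> {0..\<tau>} \<Longrightarrow> t \<in> {0..\<tau>} \<Longrightarrow> nJ (X s - X t - (s - t) *\<^sub>R flow_field (X t)) \<le> K * (s - t)\<^sup>2"
    by (rule sol_remainder[OF sol], rule that)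
  define K2 where "K2 = K + 2 * (0 + L * (A + L * r))"
  have K2: "0 \<le> K2" "K \<le> K2" "2 * (0 + L * (A + L * r)) \<le> K2"
    using K(1) L_nonneg A r by (auto simp: K2_def)
  define Y where "Y t = (if t \<le> \<tau> then X t else x t)" for t
  have Y\<tau>: "Y \<tau> = x0" by (simp add: Y_def x0_def)
  have Yx: "Y t = x t" if "\<tau> \<le> t" for t using that x(1) by (auto simp: Y_def x0_def)
  have Ydom: "Y t \<in> flow_domain" if "t \<in> {0..\<tau> + h}" for t
    using that sol_dom[OF sol, of t] D_dom[OF x(2), of t] by (auto simp: Y_def)
  have same: "nJ (Y s - Y t - (s - t) *\<^sub>R flow_field (Y t)) \<le> K2 * (s - t)\<^sup>2"
    if "s \<in> {0..\<tau>} \<and> t \<in> {0..\<tau>} \<or> s \<in> {\<tau>..\<tau> + h} \<and> t \<in> {\<tau>..\<tau> + h}" for s t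
    using that
  proof
    assume st: "s \<in> {0..\<tau>} \<and> t \<in> {0..\<tau>}"
    have "K * (s - t)\<^sup>2 \<le> K2 * (s - t)\<^sup>2" by (intro mult_right_mono K2) simp
    with K(2)[of s t] st show ?thesis by (simp add: Y_def)
  next
    assume st: "s \<in> {\<tau>..\<tau> + h} \<and> t \<in> {\<tau>..\<tau> + h}"
    have "2 * (0 + L * (A + L * r)) * (s - t)\<^sup>2 \<le> K2 * (s - t)\<^sup>2" by (intro mult_right_mono K2) simp
    with x(3)[of s t] st show ?thesis by (simp add: Yx)
  qed
  define Q where "Q = A + K2 * (\<tau> + h)"
  have Q: "0 \<le> Q" using A K2 \<tau> h by (simp add: Q_def)
  have Yinc: "nJ (Y \<tau> - Y t) \<le> Q * \<bar>\<tau> - t\<bar>" if t: "t \<in> {0..\<tau> + h}" for t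
  proof -
    have \<tau>I: "\<tau> \<in> {0..\<tau> + h}" using \<tau> h by simp
    have "nJ (Y \<tau> - Y t) = nJ (Y t - Y \<tau>)"
      by (intro nK_minus_commute dom_diff Ydom t \<tau>I)
    also have "\<dots> \<le> nJ (Y t - Y \<tau> - (t - \<tau>) *\<^sub>R flow_field (Y \<tau>)) + nJ ((t - \<tau>) *\<^sub>R flow_field (Y \<tau>))"
      using triangle[OF remainder_mem[OF Ydom[OF t] Ydom[OF \<tau>I] Ydom[OF \<tau>I]] scale_mem[OF field_mem[OF Ydom[OF \<tau>I]]], of "t - \<tau>" "t - \<tau>"]
      by simp
    also have "nJ (Y t - Y \<tau> - (t - \<tau>) *\<^sub>R flow_field (Y \<tau>)) \<le> K2 * (t - \<tau>)\<^sup>2"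
      using t \<tau> h by (intro same) auto
    also have "K2 * (t - \<tau>)\<^sup>2 = (K2 * \<bar>\<tau> - t\<bar>) * \<bar>\<tau> - t\<bar>" by (simp add: power2_eq_square abs_if algebra_simps)
    also have "\<dots> \<le> (K2 * (\<tau> + h)) * \<bar>\<tau> - t\<bar>"
      using K2 t \<tau> h by (intro mult_right_mono mult_left_mono) (auto simp: abs_le_iff)
    also have "nJ ((t - \<tau>) *\<^sub>R flow_field (Y \<tau>)) = \<bar>\<tau> - t\<bar> * nJ (flow_field (Y \<tau>))"
      by (simp add: nK_scale[OF field_mem[OF Ydom[OF \<tau>I]]] abs_minus_commute)
    also have "\<dots> \<le> \<bar>\<tau> - t\<bar> * A" using XA by (intro mult_left_mono) (auto simp: Y\<tau> x0_def)
    finally show ?thesis by (simp add: Q_def algebra_simps)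
  qed
  (* Times on different sides of the junction: the remainder is the sum of the two one-sided
     remainders and of the change of the vector field between the junction and t. *)
  have cross: "nJ (Y s - Y t - (s - t) *\<^sub>R flow_field (Y t)) \<le> (2 * K2 + L * Q) * (s - t)\<^sup>2"
    if s: "s \<in> {0..\<tau> + h}" and t: "t \<in> {0..\<tau> + h}" and opp: "s \<le> \<tau> \<and> \<tau> \<le> t \<or> t \<le> \<tau> \<and> \<tau> \<le> s" for s t
  proof -
    have \<tau>I: "\<tau> \<in> {0..\<tau> + h}" using \<tau> h by simp
    note d = Ydom[OF s] Ydom[OF t] Ydom[OF \<tau>I]
    have le: "\<bar>s - \<tau>\<bar> \<le> \<bar>s - t\<bar>" "\<bar>\<tau> - t\<bar> \<le> \<bar>s - t\<bar>" using opp by auto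
    have sq: "(s - \<tau>)\<^sup>2 \<le> (s - t)\<^sup>2" "(\<tau> - t)\<^sup>2 \<le> (s - t)\<^sup>2" using le by (simp_all add: abs_le_square_iff)
    have m: "Y s - Y \<tau> - (s - \<tau>) *\<^sub>R flow_field (Y \<tau>) \<in> J" "Y \<tau> - Y t - (\<tau> - t) *\<^sub>R flow_field (Y t) \<in> J"
      "(s - \<tau>) *\<^sub>R (flow_field (Y \<tau>) - flow_field (Y t)) \<in> J"
      using d by (auto intro!: remainder_mem scale_mem field_lipschitz)
    have "Y s - Y t - (s - t) *\<^sub>R flow_field (Y t) = (Y s - Y \<tau> - (s - \<tau>) *\<^sub>R flow_field (Y \<tau>))
        + (Y \<tau> - Y t - (\<tau> - t) *\<^sub>R flow_field (Y t)) + (s - \<tau>) *\<^sub>R (flow_field (Y \<tau>) - flow_field (Y t))"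
      by (simp add: algebra_simps)
    also have "nJ \<dots> \<le> nJ (Y s - Y \<tau> - (s - \<tau>) *\<^sub>R flow_field (Y \<tau>))
        + nJ (Y \<tau> - Y t - (\<tau> - t) *\<^sub>R flow_field (Y t)) + nJ ((s - \<tau>) *\<^sub>R (flow_field (Y \<tau>) - flow_field (Y t)))"
      by (rule order_trans[OF triangle[OF add_mem[OF m(1,2)] m(3)] add_right_mono[OF triangle[OF m(1,2)]]])
    also have "nJ (Y s - Y \<tau> - (s - \<tau>) *\<^sub>R flow_field (Y \<tau>)) \<le> K2 * (s - \<tau>)\<^sup>2"
      using s \<tau> h by (intro same) auto
    also have "\<dots> \<le> K2 * (s - t)\<^sup>2" by (intro mult_left_mono sq K2)
    also have "nJ (Y \<tau> - Y t - (\<tau> - t) *\<^sub>R flow_field (Y t)) \<le> K2 * (\<tau> - t)\<^sup>2"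
      using t \<tau> h by (intro same) auto
    also have "\<dots> \<le> K2 * (s - t)\<^sup>2" by (intro mult_left_mono sq K2)
    also have "nJ ((s - \<tau>) *\<^sub>R (flow_field (Y \<tau>) - flow_field (Y t))) = \<bar>s - \<tau>\<bar> * nJ (flow_field (Y \<tau>) - flow_field (Y t))"
      using d by (intro nK_scale field_lipschitz)
    also have "\<dots> \<le> \<bar>s - \<tau>\<bar> * (L * (Q * \<bar>\<tau> - t\<bar>))"
      using order_trans[OF field_lipschitz(2)[OF d(3,2)] mult_left_mono[OF Yinc[OF t] L_nonneg]]
      by (intro mult_left_mono) auto
    also have "\<dots> \<le> \<bar>s - t\<bar> * (L * (Q * \<bar>s - t\<bar>))"
      using le L_nonneg Q by (intro mult_mono mult_left_mono) (auto intro!: mult_nonneg_nonneg)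
    also have "\<dots> = L * Q * (s - t)\<^sup>2" by (simp add: power2_eq_square abs_if algebra_simps)
    finally show ?thesis by (simp add: algebra_simps)
  qed
  have LQ: "0 \<le> L * Q" using L_nonneg Q by simp
  have "nJ (Y s - Y t - (s - t) *\<^sub>R flow_field (Y t)) \<le> (2 * K2 + L * Q) * (s - t)\<^sup>2"
    if s: "s \<in> {0..\<tau> + h}" and t: "t \<in> {0..\<tau> + h}" for s t
  proof (cases "s \<in> {0..\<tau>} \<and> t \<in> {0..\<tau>} \<or> s \<in> {\<tau>..\<tau> + h} \<and> t \<in> {\<tau>..\<tau> + h}")
    case True
    have "K2 * (s - t)\<^sup>2 \<le> (2 * K2 + L * Q) * (s - t)\<^sup>2" using K2 LQ by (intro mult_right_mono) auto
    with same[OF True] show ?thesis by linarith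
  next
    case False
    with s t show ?thesis by (intro cross) auto
  qed
  moreover have "Y 0 = T" using sol_0[OF sol] \<tau> by (simp add: Y_def)
  ultimately have "sol (\<tau> + h) Y"
    unfolding sol_def using Ydom K2 LQ by (intro conjI exI[of _ "2 * K2 + L * Q"]) auto
  then show ?thesis by blast
qed

lemma sol_exists: "\<exists>X. sol \<tau> X"
proof (cases "0 \<le> \<tau>")
  case True
  obtain m M where mM: "a < m" "M < b" "m \<le> M" "\<And>x. m * norm x \<le> norm (T x)" "\<And>x. norm (T x) \<le> M * norm x"
    using T_interior by blast
  define r where "r = min (m - a) (b - M)"
  have r: "0 < r" "a + r \<le> m" "M + r \<le> b" using mM by (auto simp: r_def)
  (* A bounds the vector field along every solution up to time \<tau>, so one step size h serves for
     all restarts at times n h \<le> \<tau>. *)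
  define A where "A = exp (L * \<tau>) * nJ (flow_field T)"
  have A: "0 \<le> A" using nJ_ge_0[OF field_mem[OF T_dom]] by (simp add: A_def)
  define h where "h = min (r / (A + L * r + 1)) (1 / (2 * L + 1))"
  have pos: "0 < A + L * r + 1" "0 < 2 * L + 1"
    using A r L_nonneg by (auto intro!: add_nonneg_pos)
  have h: "0 < h" "h * (A + L * r) \<le> r" "h * L \<le> 1 / 2"
  proof -
    show "0 < h" using r pos by (simp add: h_def)
    have "h * (A + L * r + 1) \<le> r" "h * (2 * L + 1) \<le> 1"
      using pos by (auto simp: h_def min_le_iff_disj simp flip: pos_le_divide_eq)
    then show "h * (A + L * r) \<le> r" "h * L \<le> 1 / 2"
      using \<open>0 < h\<close> by (auto simp: algebra_simps)
  qed
  have "real n * h \<le> \<tau> + h \<Longrightarrow> \<exists>X. sol (real n * h) X" for n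
  proof (induction n)
    case 0
    have "sol 0 (\<lambda>_. T)" using T_dom nK_zero by (auto simp: sol_def)
    then show ?case by auto
  next
    case (Suc n)
    then have n: "real n * h \<le> \<tau>" by (simp add: algebra_simps)
    with Suc.IH h obtain X where X: "sol (real n * h) X" by auto
    have nh: "0 \<le> real n * h" using h by simp
    have "nJ (flow_field (X (real n * h))) \<le> exp (L * (real n * h)) * nJ (flow_field T)"
      by (rule sol_growth[OF X nh])
    also have "\<dots> \<le> A"
      unfolding A_def using n L_nonneg nJ_ge_0[OF field_mem[OF T_dom]]
      by (intro mult_right_mono) (auto intro: mult_left_mono)
    finally have XA: "nJ (flow_field (X (real n * h))) \<le> A" .
    have "\<exists>Y. sol (real n * h + h) Y"
      by (rule sol_extend[OF mM(4,5) _ _ r(2,3) A _ h(2,3) X nh XA]) (use mM ab r h in auto)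
    then show ?case by (simp add: algebra_simps)
  qed
  moreover define n where "n = nat \<lceil>\<tau> / h\<rceil>"
  have "\<tau> / h \<le> real n" "real n \<le> \<tau> / h + 1"
    using True h by (auto simp: n_def)
  then have n: "\<tau> \<le> real n * h" "real n * h \<le> \<tau> + h" using h by (auto simp: field_simps)
  ultimately obtain X where "sol (real n * h) X" by blast
  with n sol_mono show ?thesis by blast
next
  case False
  then show ?thesis by (auto simp: sol_def)
qed

text \<open>
  Solutions with mere differentiability in the norm of \<open>J\<close>: the class in which uniqueness is proved, wide
  enough for every solution of class \<open>C\<^sup>1\<close> in \<open>J\<close>.
\<close>

definition ideal_sol :: "real \<Rightarrow> (real \<Rightarrow> 'h \<Rightarrow>\<^sub>L 'h) \<Rightarrow> bool" where
  "ideal_sol \<tau> X \<longleftrightarrow> X 0 = T \<and> (\<forall>t\<in>{0..\<tau>}. X t \<in> flow_domain \<and>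
    (\<forall>e>0. \<exists>d>0. \<forall>s\<in>{0..\<tau>}. \<bar>s - t\<bar> < d \<longrightarrow>
      nJ (X s - X t - (s - t) *\<^sub>R flow_field (X t)) \<le> e * \<bar>s - t\<bar>))"

lemma sol_ideal_sol:
  assumes "sol \<tau> X"
  shows "ideal_sol \<tau> X"
proof -
  obtain K where K: "0 \<le> K"
    "\<And>s t. s \<in> {0..\<tau>} \<Longrightarrow> t \<in> {0..\<tau>} \<Longrightarrow> nJ (X s - X t - (s - t) *\<^sub>R flow_field (X t)) \<le> K * (s - t)\<^sup>2"
    by (rule sol_remainder[OF assms], rule that)
  have "\<exists>d>0. \<forall>s\<in>{0..\<tau>}. \<bar>s - t\<bar> < d \<longrightarrow> nJ (X s - X t - (s - t) *\<^sub>R flow_field (X t)) \<le> e * \<bar>s - t\<bar>"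
    if t: "t \<in> {0..\<tau>}" and e: "0 < e" for t e
  proof (intro exI[of _ "e / (K + 1)"] conjI ballI impI)
    fix s assume s: "s \<in> {0..\<tau>}" "\<bar>s - t\<bar> < e / (K + 1)"
    have "(K + 1) * \<bar>s - t\<bar> \<le> e" using s(2) K(1) by (simp add: field_simps)
    then have "K * \<bar>s - t\<bar> \<le> e" by (simp add: algebra_simps)
    then have "K * \<bar>s - t\<bar> * \<bar>s - t\<bar> \<le> e * \<bar>s - t\<bar>" by (intro mult_right_mono) auto
    then have "K * (s - t)\<^sup>2 \<le> e * \<bar>s - t\<bar>" by (simp add: power2_eq_square mult.assoc)
    with K(2)[OF s(1) t] show "nJ (X s - X t - (s - t) *\<^sub>R flow_field (X t)) \<le> e * \<bar>s - t\<bar>" by linarith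
  qed (use e K in simp)
  then show ?thesis using assms unfolding ideal_sol_def sol_def by blast
qed

text \<open>
  Gronwall's inequality for \<open>\<parallel>X(t) - Y(t)\<parallel>\<close> in the norm of \<open>J\<close>, for which the vector field is Lipschitz.
\<close>

lemma ideal_sol_unique:
  assumes X: "ideal_sol \<tau> X" and Y: "ideal_sol \<tau> Y" and \<tau>: "0 \<le> \<tau>"
  shows "X \<tau> = Y \<tau>"
proof -
  have d: "X t \<in> flow_domain" "Y t \<in> flow_domain" if "t \<in> {0..\<tau>}" for t using X Y that by (auto simp: ideal_sol_def)
  define u where "u t = nJ (X t - Y t)" for t
  have step: "\<exists>d>0. \<forall>s\<in>{0..\<tau>}. \<bar>s - t\<bar> < d \<longrightarrow>
      nJ ((X s - Y s) - (X t - Y t) - (s - t) *\<^sub>R (flow_field (X t) - flow_field (Y t))) \<le> e * \<bar>s - t\<bar>"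
    if t: "t \<in> {0..\<tau>}" and e: "0 < e" for t e
  proof -
    have e2: "0 < e / 2" using e by simp
    obtain p where p: "0 < p" "\<forall>s\<in>{0..\<tau>}. \<bar>s - t\<bar> < p \<longrightarrow> nJ (X s - X t - (s - t) *\<^sub>R flow_field (X t)) \<le> e / 2 * \<bar>s - t\<bar>"
      using X t e2 unfolding ideal_sol_def by blast
    obtain q where q: "0 < q" "\<forall>s\<in>{0..\<tau>}. \<bar>s - t\<bar> < q \<longrightarrow> nJ (Y s - Y t - (s - t) *\<^sub>R flow_field (Y t)) \<le> e / 2 * \<bar>s - t\<bar>"
      using Y t e2 unfolding ideal_sol_def by blast
    show ?thesis
    proof (intro exI[of _ "min p q"] conjI ballI impI)
      fix s assume s: "s \<in> {0..\<tau>}" "\<bar>s - t\<bar> < min p q"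
      have "(X s - Y s) - (X t - Y t) - (s - t) *\<^sub>R (flow_field (X t) - flow_field (Y t))
          = (X s - X t - (s - t) *\<^sub>R flow_field (X t)) - (Y s - Y t - (s - t) *\<^sub>R flow_field (Y t))"
        by (simp add: algebra_simps)
      also have "nJ \<dots> \<le> nJ (X s - X t - (s - t) *\<^sub>R flow_field (X t)) + nJ (Y s - Y t - (s - t) *\<^sub>R flow_field (Y t))"
        using s t d by (intro triangle_diff remainder_mem)
      also have "\<dots> \<le> e / 2 * \<bar>s - t\<bar> + e / 2 * \<bar>s - t\<bar>" using p(2) q(2) s by (intro add_mono) auto
      finally show "nJ ((X s - Y s) - (X t - Y t) - (s - t) *\<^sub>R (flow_field (X t) - flow_field (Y t))) \<le> e * \<bar>s - t\<bar>" by simp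
    qed (use p q in simp)
  qed
  have u_step: "\<exists>d>0. \<forall>s\<in>{0..\<tau>}. \<bar>s - t\<bar> < d \<longrightarrow> \<bar>u s - u t\<bar> \<le> \<bar>s - t\<bar> * (L * u t + e)"
    if t: "t \<in> {0..\<tau>}" and e: "0 < e" for t e
  proof -
    obtain p where p: "0 < p" "\<forall>s\<in>{0..\<tau>}. \<bar>s - t\<bar> < p \<longrightarrow>
      nJ ((X s - Y s) - (X t - Y t) - (s - t) *\<^sub>R (flow_field (X t) - flow_field (Y t))) \<le> e * \<bar>s - t\<bar>" using step[OF t e] by blast
    show ?thesis
    proof (intro exI[of _ p] conjI ballI impI)
      fix s assume s: "s \<in> {0..\<tau>}" "\<bar>s - t\<bar> < p"
      let ?Z = "(X s - Y s) - (X t - Y t)" and ?F = "flow_field (X t) - flow_field (Y t)"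
      have F: "?F \<in> J" "nJ ?F \<le> L * u t" using field_lipschitz d t by (auto simp: u_def)
      have Z: "?Z \<in> J" using s t d by (intro diff_mem dom_diff)
      have "\<bar>u s - u t\<bar> \<le> nJ ?Z" unfolding u_def using s t d by (intro nK_reverse_triangle dom_diff)
      also have "\<dots> \<le> nJ (?Z - (s - t) *\<^sub>R ?F) + nJ ((s - t) *\<^sub>R ?F)"
        using triangle[OF diff_mem[OF Z scale_mem[OF F(1)]] scale_mem[OF F(1)], of "s - t" "s - t"] by simp
      also have "\<dots> \<le> e * \<bar>s - t\<bar> + \<bar>s - t\<bar> * (L * u t)"
        using p(2) s F by (intro add_mono) (auto simp: nK_scale intro: mult_left_mono)
      finally show "\<bar>u s - u t\<bar> \<le> \<bar>s - t\<bar> * (L * u t + e)" by (simp add: algebra_simps)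
    qed (rule p(1))
  qed
  have "u \<tau> \<le> exp (L * \<tau>) * u 0"
  proof (rule gronwall_dini[OF _ \<tau> L_nonneg])
    show "continuous_on {0..\<tau>} u"
      unfolding continuous_on_def
    proof
      fix t assume t: "t \<in> {0..\<tau>}"
      obtain p where p: "0 < p" "\<forall>s\<in>{0..\<tau>}. \<bar>s - t\<bar> < p \<longrightarrow> \<bar>u s - u t\<bar> \<le> \<bar>s - t\<bar> * (L * u t + 1)"
        using u_step[OF t, of 1] by auto
      have "((\<lambda>s. u s - u t) \<longlongrightarrow> 0) (at t within {0..\<tau>})"
      proof (rule Lim_null_comparison)
        show "\<forall>\<^sub>F s in at t within {0..\<tau>}. norm (u s - u t) \<le> \<bar>s - t\<bar> * (L * u t + 1)"
          unfolding eventually_at using p by (intro exI[of _ p]) (auto simp: dist_real_def)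
        show "((\<lambda>s. \<bar>s - t\<bar> * (L * u t + 1)) \<longlongrightarrow> 0) (at t within {0..\<tau>})"
          by (rule tendsto_eq_intros refl | simp)+
      qed
      then show "(u \<longlongrightarrow> u t) (at t within {0..\<tau>})" by (simp add: LIM_zero_iff)
    qed
    show "0 \<le> u t" if "0 \<le> t" "t \<le> \<tau>" for t
      unfolding u_def using d[of t] that by (intro nJ_ge_0 dom_diff) auto
    fix t e :: real assume t: "0 \<le> t" "t < \<tau>" and e: "0 < e"
    obtain p where p: "0 < p" "\<forall>s\<in>{0..\<tau>}. \<bar>s - t\<bar> < p \<longrightarrow> \<bar>u s - u t\<bar> \<le> \<bar>s - t\<bar> * (L * u t + e)"
      using u_step[of t e] t e by auto
    show "\<exists>d>0. \<forall>s. t < s \<longrightarrow> s < t + d \<longrightarrow> s \<le> \<tau> \<longrightarrow> u s \<le> u t + (s - t) * (L * u t + e)"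
    proof (intro exI[of _ p] conjI allI impI p(1))
      fix s assume s: "t < s" "s < t + p" "s \<le> \<tau>"
      then have "s \<in> {0..\<tau>}" "\<bar>s - t\<bar> < p" using t by auto
      with p(2) have "\<bar>u s - u t\<bar> \<le> \<bar>s - t\<bar> * (L * u t + e)" by blast
      then show "u s \<le> u t + (s - t) * (L * u t + e)" using s by auto
    qed
  qed
  moreover have "u 0 = 0" using X Y by (simp add: u_def ideal_sol_def nK_zero)
  moreover have "X \<tau> - Y \<tau> \<in> J" using d \<tau> by (intro dom_diff) auto
  ultimately have "norm (X \<tau> - Y \<tau>) \<le> 0" using norm_le[of "X \<tau> - Y \<tau>"] by (simp add: u_def del: norm_le_zero_iff)
  then show ?thesis by simp
qed

lemma global_solution: "\<exists>X. \<forall>\<tau>. sol \<tau> X"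
proof -
  have "\<forall>n. \<exists>X. sol (real n) X" using sol_exists by blast
  from choice[OF this] obtain Xs where Xs: "\<And>n. sol (real n) (Xs n)" by blast
  define X where "X t = Xs (nat \<lceil>t\<rceil>) t" for t
  have eq: "X t = Xs n t" if "0 \<le> t" "t \<le> real n" for t n
  proof -
    have "t \<le> real (nat \<lceil>t\<rceil>)" by linarith
    then show ?thesis
      unfolding X_def using that
      by (intro ideal_sol_unique[of t] sol_ideal_sol sol_mono[OF Xs]) auto
  qed
  have "sol \<tau> X" for \<tau>
  proof -
    define n where "n = nat \<lceil>\<tau>\<rceil>"
    have n: "\<tau> \<le> real n" unfolding n_def by linarith
    have "X 0 = Xs n 0" by (rule eq) auto
    moreover have "sol \<tau> (Xs n)" using sol_mono[OF Xs n] .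
    moreover have "X t = Xs n t" if "t \<in> {0..\<tau>}" for t using that n by (intro eq) auto
    ultimately show ?thesis unfolding sol_def by simp
  qed
  then show ?thesis by blast
qed

end

section \<open>Lax equations and similarity orbits\<close>

text \<open>
  Makes similarity by arbitrary invertible operators the case \<open>J = \<B>(H)\<close> of similarity by operators in
  \<open>1 + J\<close>.
\<close>

lemma normed_ideal_BH: "normed_ideal (BH :: ('h::chilbert_space \<Rightarrow>\<^sub>L 'h) set) norm"
proof -
  have scalar_le: "norm (scalar_op z o\<^sub>L X) \<le> cmod z * norm X" for z and X :: "'h \<Rightarrow>\<^sub>L 'h"
  proof (rule norm_blinfun_bound)
    show "norm ((scalar_op z o\<^sub>L X) x) \<le> cmod z * norm X * norm x" for x
      using mult_left_mono[OF norm_blinfun[of X x], of "cmod z"]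
      by (simp add: scalar_op.rep_eq norm_scaleC mult.assoc)
  qed simp
  have scalar: "norm (scalar_op z o\<^sub>L X) = cmod z * norm X" for z and X :: "'h \<Rightarrow>\<^sub>L 'h"
  proof (cases "z = 0")
    case False
    have "X = scalar_op (inverse z) o\<^sub>L (scalar_op z o\<^sub>L X)"
      using False by (simp flip: compose_assoc scalar_op_mult)
    then have "norm X \<le> cmod (inverse z) * norm (scalar_op z o\<^sub>L X)" by (metis scalar_le)
    then have "cmod z * norm X \<le> cmod z * (cmod (inverse z) * norm (scalar_op z o\<^sub>L X))"
      by (rule mult_left_mono) simp
    moreover have "cmod z * (cmod (inverse z) * norm (scalar_op z o\<^sub>L X)) = norm (scalar_op z o\<^sub>L X)"
      using False by (simp add: norm_inverse)
    ultimately show ?thesis using scalar_le[of z X] by linarith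
  qed simp
  have complete: "\<exists>L\<in>BH. (\<lambda>n. norm (S n - L)) \<longlonglongrightarrow> 0"
    if S: "\<forall>n. S n \<in> BH" "\<forall>e>0. \<exists>N. \<forall>m\<ge>N. \<forall>n\<ge>N. norm (S m - S n) < e" for S :: "nat \<Rightarrow> 'h \<Rightarrow>\<^sub>L 'h"
  proof -
    have "Cauchy S" using S(2) by (intro CauchyI) blast
    then obtain l where l: "S \<longlonglongrightarrow> l" using Cauchy_convergent convergent_def by blast
    have "l \<in> BH" using closed_sequentially[OF closed_BH _ l] S(1) by blast
    moreover have "(\<lambda>n. norm (S n - l)) \<longlonglongrightarrow> 0" using l by (simp add: LIM_zero tendsto_norm_zero)
    ultimately show ?thesis by blast
  qed
  have sandwich: "norm (Y o\<^sub>L X o\<^sub>L Z) \<le> norm Y * norm X * norm Z" for X Y Z :: "'h \<Rightarrow>\<^sub>L 'h"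
    by (meson norm_blinfun_compose order_trans mult_right_mono norm_ge_zero)
  have rank: "X \<in> BH" if "rank_one_op X" for X :: "'h \<Rightarrow>\<^sub>L 'h" using that by (simp add: rank_one_op_def)
  show ?thesis
    unfolding normed_ideal_def
    by (intro conjI ballI allI impI) (auto simp: BH_add BH_compose scalar sandwich rank norm_triangle_ineq intro: complete[rule_format])
qed

lemma invertible_near_id:
  assumes g: "g \<in> BH" "norm (g - id_blinfun) \<le> 1 / 2"
  shows "invertible_op g"
proof -
  have below: "1 / 2 * norm x \<le> norm (k x)" if "norm (k - id_blinfun) \<le> 1 / 2" for k :: "'a \<Rightarrow>\<^sub>L 'a" and x
  proof -
    have "norm x - norm (k x) \<le> norm ((k - id_blinfun) x)"
      using norm_triangle_ineq2[of x "k x"] by (simp add: blinfun.diff_left norm_minus_commute)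
    also have "\<dots> \<le> 1 / 2 * norm x"
      using that by (meson norm_blinfun mult_right_mono norm_ge_zero order_trans)
    finally show ?thesis by simp
  qed
  have "adj_op id_blinfun = (id_blinfun :: 'a \<Rightarrow>\<^sub>L 'a)"
    using selfadjoint_id by (simp add: selfadjoint_op_def)
  then have "norm (adj_op g - id_blinfun) \<le> 1 / 2"
    using adj_norm_le[OF BH_diff[OF g(1) BH_id]] g by (simp add: adj_diff)
  with g show ?thesis by (intro invertible_from_below[of g "1 / 2" "1 / 2"] below) auto
qed

text \<open>
  The intertwining form is linear in \<open>g\<close> and avoids differentiating an inverse.
\<close>

lemma (in operator_ideal) ideal_orbit_iff:
  "Z \<in> ideal_orbit J X \<longleftrightarrow> (\<exists>g\<in>ideal_group J. Z o\<^sub>L g = g o\<^sub>L X)"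
proof
  assume "Z \<in> ideal_orbit J X"
  then obtain g where g: "g \<in> ideal_group J" "Z = g o\<^sub>L X o\<^sub>L inverse_op g" by (auto simp: ideal_orbit_def)
  then have "inverse_op g o\<^sub>L g = id_blinfun" by (intro inverse_op_props) (simp add: ideal_group_def)
  then have "Z o\<^sub>L g = g o\<^sub>L X" by (simp add: g(2) compose_assoc)
  with g show "\<exists>g\<in>ideal_group J. Z o\<^sub>L g = g o\<^sub>L X" by blast
next
  assume "\<exists>g\<in>ideal_group J. Z o\<^sub>L g = g o\<^sub>L X"
  then obtain g where g: "g \<in> ideal_group J" "Z o\<^sub>L g = g o\<^sub>L X" by blast
  then have "g o\<^sub>L inverse_op g = id_blinfun" by (intro inverse_op_props) (simp add: ideal_group_def)
  then have "Z = Z o\<^sub>L g o\<^sub>L inverse_op g" by (simp add: compose_assoc)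
  with g show "Z \<in> ideal_orbit J X" by (auto simp: ideal_orbit_def)
qed

lemma (in operator_ideal) ideal_orbit_refl: "X \<in> ideal_orbit J X"
  unfolding ideal_orbit_iff
  by (rule bexI[of _ id_blinfun]) (auto simp: ideal_group_def J_zero intro: invertible_near_id)

lemma (in operator_ideal) ideal_orbit_trans:
  assumes "Z \<in> ideal_orbit J Y" "Y \<in> ideal_orbit J X"
  shows "Z \<in> ideal_orbit J X"
proof -
  obtain g k where g: "invertible_op g" "g - id_blinfun \<in> J" "Z o\<^sub>L g = g o\<^sub>L Y"
    and k: "invertible_op k" "k - id_blinfun \<in> J" "Y o\<^sub>L k = k o\<^sub>L X"
    using assms unfolding ideal_orbit_iff ideal_group_def by blast
  have "Z o\<^sub>L (g o\<^sub>L k) = (g o\<^sub>L k) o\<^sub>L X"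
    using g(3) k(3) by (metis compose_assoc)
  moreover have eq: "(g o\<^sub>L k) - id_blinfun = ((g - id_blinfun) o\<^sub>L k) + (k - id_blinfun)"
    by (simp add: op_compose.diff_left)
  have "(g o\<^sub>L k) - id_blinfun \<in> J"
    unfolding eq using g(2) k(1,2) by (intro add_mem J_right) (auto simp: invertible_op_def)
  ultimately show ?thesis
    unfolding ideal_orbit_iff ideal_group_def using invertible_compose[OF g(1) k(1)] by blast
qed

lemma linear_ode_zero:
  fixes E :: "real \<Rightarrow> 'h::real_normed_vector \<Rightarrow>\<^sub>L 'h"
  assumes \<tau>: "0 \<le> \<tau>" and E0: "E 0 = 0" and \<beta>: "0 \<le> \<beta>"
    and deriv: "\<And>t. t \<in> {0..\<tau>} \<Longrightarrow> (E has_vector_derivative (B t o\<^sub>L E t)) (at t within {0..\<tau>})"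
    and bound: "\<And>t. t \<in> {0..\<tau>} \<Longrightarrow> norm (B t) \<le> \<beta>"
  shows "E \<tau> = 0"
proof -
  have "norm (E \<tau>) \<le> exp (\<beta> * \<tau>) * norm (E 0)"
  proof (rule gronwall_dini[where u = "\<lambda>t. norm (E t)", OF _ \<tau> \<beta>])
    show "continuous_on {0..\<tau>} (\<lambda>t. norm (E t))"
      using deriv by (intro continuous_on_norm continuous_on_vector_derivative)
    fix t e :: real assume t: "0 \<le> t" "t < \<tau>" and e: "0 < e"
    then have tI: "t \<in> {0..\<tau>}" by simp
    have "(E has_derivative (\<lambda>h. h *\<^sub>R (B t o\<^sub>L E t))) (at t within {0..\<tau>})"
      using deriv[OF tI] by (simp add: has_vector_derivative_def)
    then obtain d where d: "0 < d" "\<And>s. s \<in> {0..\<tau>} \<Longrightarrow> norm (s - t) < d \<Longrightarrow>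
        norm (E s - E t - (s - t) *\<^sub>R (B t o\<^sub>L E t)) \<le> e * norm (s - t)"
      using e unfolding has_derivative_within_alt by meson
    show "\<exists>d>0. \<forall>s. t < s \<longrightarrow> s < t + d \<longrightarrow> s \<le> \<tau> \<longrightarrow>
        norm (E s) \<le> norm (E t) + (s - t) * (\<beta> * norm (E t) + e)"
    proof (intro exI[of _ d] conjI allI impI d(1))
      fix s assume s: "t < s" "s < t + d" "s \<le> \<tau>"
      have "norm (E s - E t - (s - t) *\<^sub>R (B t o\<^sub>L E t)) \<le> e * (s - t)"
        using d(2)[of s] s t by simp
      moreover have "norm ((s - t) *\<^sub>R (B t o\<^sub>L E t)) \<le> (s - t) * (\<beta> * norm (E t))"
      proof -
        have "norm (B t o\<^sub>L E t) \<le> norm (B t) * norm (E t)" by (rule norm_blinfun_compose)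
        also have "\<dots> \<le> \<beta> * norm (E t)" using bound[OF tI] by (intro mult_right_mono) auto
        finally show ?thesis using s by (simp add: mult_left_mono)
      qed
      moreover have "norm (E s) \<le> norm (E s - E t - (s - t) *\<^sub>R (B t o\<^sub>L E t)) + norm ((s - t) *\<^sub>R (B t o\<^sub>L E t)) + norm (E t)"
        using norm_triangle_ineq[of "E s - E t - (s - t) *\<^sub>R (B t o\<^sub>L E t)" "(s - t) *\<^sub>R (B t o\<^sub>L E t)"]
          norm_triangle_ineq2[of "E s" "E t"] by simp
      ultimately show "norm (E s) \<le> norm (E t) + (s - t) * (\<beta> * norm (E t) + e)"
        by (simp add: algebra_simps)
    qed
  qed simp
  then show ?thesis by (simp add: E0)
qed

text \<open>
  Let \<open>g\<close> solve \<open>g' = B g\<close> in \<open>1 + J\<close> with \<open>g(t0) = 1\<close>. Then \<open>E(t) = X(t) g(t) - g(t) X(t0)\<close> satisfies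
  \<open>E' = [B, X] g + X B g - B g X(t0) = B E\<close> and vanishes at \<open>t0\<close>, hence everywhere. The interval is so short
  that \<open>g\<close> stays within \<open>1/2\<close> of the identity and is invertible.
\<close>

lemma (in operator_ideal) lax_orbit_step:
  fixes X B :: "real \<Rightarrow> 'h \<Rightarrow>\<^sub>L 'h"
  assumes h: "0 \<le> h" "h * (3 * \<beta>) \<le> 1" and N: "0 \<le> N"
    and deriv: "\<And>t. t \<in> {t0..t0 + h} \<Longrightarrow>
      (X has_vector_derivative commutator (B t) (X t)) (at t within {t0..t0 + h})"
    and B: "\<And>t. t \<in> {t0..t0 + h} \<Longrightarrow> B t \<in> J \<and> nJ (B t) \<le> \<beta>"
    and lip: "\<And>s t. s \<in> {t0..t0 + h} \<Longrightarrow> t \<in> {t0..t0 + h} \<Longrightarrow> nJ (B s - B t) \<le> N * \<bar>s - t\<bar>"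
  shows "X (t0 + h) \<in> ideal_orbit J (X t0)"
proof -
  let ?I = "{t0..t0 + h}"
  define D where "D = {g. g - id_blinfun \<in> J \<and> nJ (g - id_blinfun) \<le> 1 / 2}"
  have \<beta>: "0 \<le> \<beta>" using B[of t0] nJ_ge_0[of "B t0"] h(1) by (auto intro: order_trans)
  have D_BH: "g \<in> BH" and D_norm: "norm g \<le> 3 / 2" and D_near: "norm (g - id_blinfun) \<le> 1 / 2" if "g \<in> D" for g
  proof -
    have J: "g - id_blinfun \<in> J" using that by (simp add: D_def)
    show n: "norm (g - id_blinfun) \<le> 1 / 2" using norm_le[OF J] that by (simp add: D_def)
    show "g \<in> BH" using BH_add[OF J_BH[OF J] BH_id] by simp
    show "norm g \<le> 3 / 2"
      using norm_triangle_ineq2[of g id_blinfun] n norm_id_blinfun_le[where 'a = 'h] by linarith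
  qed
  have D_diff: "g - k \<in> J" if "g \<in> D" "k \<in> D" for g k
    using diff_mem[of "g - id_blinfun" "k - id_blinfun"] that by (auto simp: D_def)
  have "\<exists>g. g t0 = id_blinfun \<and> (\<forall>t\<in>?I. g t \<in> {g. g - id_blinfun \<in> J \<and> nJ (g - id_blinfun) \<le> 1 / 2}) \<and>
    (\<forall>s\<in>?I. \<forall>t\<in>?I. nJ (g s - g t - (s - t) *\<^sub>R (B t o\<^sub>L g t)) \<le> 2 * (N * (3 / 2) + \<beta> * (\<beta> * (3 / 2))) * (s - t)\<^sup>2)"
  proof (rule picard_local; (fold D_def)?)
    show "B t o\<^sub>L g \<in> J" if "t \<in> ?I" "g \<in> D" for t g using B that D_BH by (intro J_right) auto
    show "nJ (B t o\<^sub>L g) \<le> \<beta> * (3 / 2)" if "t \<in> ?I" "g \<in> D" for t g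
    proof -
      have "nJ (B t o\<^sub>L g) \<le> nJ (B t) * norm g" using B that D_BH by (intro nJ_right) auto
      also have "\<dots> \<le> \<beta> * (3 / 2)" using B[OF that(1)] D_norm[OF that(2)] \<beta> by (intro mult_mono) auto
      finally show ?thesis .
    qed
    show "nJ ((B t o\<^sub>L g) - (B t o\<^sub>L k)) \<le> \<beta> * nJ (g - k)" if "t \<in> ?I" "g \<in> D" "k \<in> D" for t g k
    proof -
      have "nJ (B t o\<^sub>L (g - k)) \<le> norm (B t) * nJ (g - k)"
        using B that by (intro nJ_left D_diff) (auto intro: J_BH)
      also have "\<dots> \<le> \<beta> * nJ (g - k)"
        using B[OF that(1)] norm_le[of "B t"] nJ_ge_0[OF D_diff[OF that(2,3)]] by (intro mult_right_mono) auto
      finally show ?thesis by (simp add: op_compose.diff_right)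
    qed
    show "nJ ((B s o\<^sub>L g) - (B t o\<^sub>L g)) \<le> N * (3 / 2) * \<bar>s - t\<bar>" if st: "s \<in> ?I" "t \<in> ?I" and g: "g \<in> D" for s t g
    proof -
      have BJ: "B s - B t \<in> J" using B st by (intro diff_mem) auto
      have "nJ ((B s - B t) o\<^sub>L g) \<le> nJ (B s - B t) * norm g" by (intro nJ_right BJ D_BH g)
      also have "\<dots> \<le> (N * \<bar>s - t\<bar>) * (3 / 2)"
        using lip[OF st] D_norm[OF g] N by (intro mult_mono) auto
      finally show ?thesis by (simp add: op_compose.diff_left mult_ac)
    qed
  qed (use h N \<beta> in \<open>auto simp: algebra_simps\<close>)
  then obtain g where g: "g t0 = id_blinfun" "\<And>t. t \<in> ?I \<Longrightarrow> g t \<in> D"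
    "\<And>s t. s \<in> ?I \<Longrightarrow> t \<in> ?I \<Longrightarrow>
      nJ (g s - g t - (s - t) *\<^sub>R (B t o\<^sub>L g t)) \<le> 2 * (N * (3 / 2) + \<beta> * (\<beta> * (3 / 2))) * (s - t)\<^sup>2"
    unfolding D_def by blast
  have g_deriv: "(g has_vector_derivative (B t o\<^sub>L g t)) (at t within ?I)" if t: "t \<in> ?I" for t
  proof (rule quadratic_remainder_derivative)
    fix s assume s: "s \<in> ?I"
    have "g s - g t - (s - t) *\<^sub>R (B t o\<^sub>L g t) \<in> J"
      using s t g B by (intro diff_mem[OF D_diff scale_mem] J_right D_BH) auto
    from norm_le[OF this] g(3)[OF s t]
    show "norm (g s - g t - (s - t) *\<^sub>R (B t o\<^sub>L g t)) \<le> 2 * (N * (3 / 2) + \<beta> * (\<beta> * (3 / 2))) * (s - t)\<^sup>2" by linarith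
  qed
  define E where "E t = (X t o\<^sub>L g t) - (g t o\<^sub>L X t0)" for t
  have E_deriv: "(E has_vector_derivative (B t o\<^sub>L E t)) (at t within ?I)" if t: "t \<in> ?I" for t
  proof -
    have 1: "((\<lambda>t. X t o\<^sub>L g t) has_vector_derivative ((X t o\<^sub>L (B t o\<^sub>L g t)) + (commutator (B t) (X t) o\<^sub>L g t))) (at t within ?I)"
      by (rule bounded_bilinear.has_vector_derivative[OF bounded_bilinear_blinfun_compose deriv[OF t] g_deriv[OF t]])
    have 2: "((\<lambda>t. g t o\<^sub>L X t0) has_vector_derivative ((g t o\<^sub>L 0) + ((B t o\<^sub>L g t) o\<^sub>L X t0))) (at t within ?I)"
      by (rule bounded_bilinear.has_vector_derivative[OF bounded_bilinear_blinfun_compose g_deriv[OF t] has_vector_derivative_const])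
    have "B t o\<^sub>L E t = ((X t o\<^sub>L (B t o\<^sub>L g t)) + (commutator (B t) (X t) o\<^sub>L g t)) - ((g t o\<^sub>L 0) + ((B t o\<^sub>L g t) o\<^sub>L X t0))"
      by (simp add: E_def commutator_def op_compose.diff_left op_compose.diff_right compose_assoc)
    then show ?thesis
      using has_vector_derivative_diff[OF 1 2] by (simp add: E_def[abs_def])
  qed
  have "E (t0 + h) = 0"
  proof -
    have "(\<lambda>s. E (t0 + s)) h = 0"
    proof (rule linear_ode_zero[where B = "\<lambda>s. B (t0 + s)", OF h(1) _ \<beta>])
      show "E (t0 + 0) = 0" by (simp add: E_def g(1))
      fix s assume s: "s \<in> {0..h}"
      have "(E has_vector_derivative (B (t0 + s) o\<^sub>L E (t0 + s))) (at (t0 + s) within (\<lambda>s. t0 + s) ` {0..h})"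
        using E_deriv[of "t0 + s"] s by (simp add: add.commute[of h])
      moreover have "((\<lambda>s. t0 + s) has_vector_derivative 1) (at s within {0..h})"
        by (auto intro!: derivative_eq_intros simp flip: has_real_derivative_iff_has_vector_derivative)
      ultimately show "((\<lambda>s. E (t0 + s)) has_vector_derivative (B (t0 + s) o\<^sub>L E (t0 + s))) (at s within {0..h})"
        using vector_diff_chain_within[of "\<lambda>s. t0 + s" 1 s "{0..h}" E] by (simp add: o_def)
      show "norm (B (t0 + s)) \<le> \<beta>"
        using B[of "t0 + s"] norm_le[of "B (t0 + s)"] s by auto
    qed
    then show ?thesis by simp
  qed
  moreover have last: "t0 + h \<in> ?I" using h by simp
  ultimately show ?thesis
    unfolding ideal_orbit_iff ideal_group_def
    using g(2)[OF last] D_BH D_near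
    by (intro bexI[of _ "g (t0 + h)"]) (auto simp: E_def D_def intro: invertible_near_id)
qed

text \<open>
  The step length is uniform on \<open>[0,\<tau>]\<close> because the Lipschitz function \<open>B\<close> is bounded there, and orbits
  compose.
\<close>

lemma (in operator_ideal) lax_orbit:
  fixes X B :: "real \<Rightarrow> 'h \<Rightarrow>\<^sub>L 'h"
  assumes \<tau>: "0 \<le> \<tau>" and N: "0 \<le> N"
    and deriv: "\<And>t. t \<in> {0..\<tau>} \<Longrightarrow>
      (X has_vector_derivative commutator (B t) (X t)) (at t within {0..\<tau>})"
    and B: "\<And>t. t \<in> {0..\<tau>} \<Longrightarrow> B t \<in> J"
    and lip: "\<And>s t. s \<in> {0..\<tau>} \<Longrightarrow> t \<in> {0..\<tau>} \<Longrightarrow> nJ (B s - B t) \<le> N * \<bar>s - t\<bar>"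
  shows "X \<tau> \<in> ideal_orbit J (X 0)"
proof -
  define \<beta> where "\<beta> = nJ (B 0) + N * \<tau>"
  have B_bound: "nJ (B t) \<le> \<beta>" if t: "t \<in> {0..\<tau>}" for t
  proof -
    have "nJ (B t) \<le> nJ (B t - B 0) + nJ (B 0)"
      using triangle[of "B t - B 0" "B 0"] B t \<tau> by (simp add: diff_mem)
    also have "nJ (B t - B 0) \<le> N * \<tau>"
      using lip[OF t, of 0] t \<tau> mult_left_mono[of t \<tau> N] N by simp
    finally show ?thesis by (simp add: \<beta>_def)
  qed
  have \<beta>: "0 \<le> \<beta>" using nJ_ge_0[OF B, of 0] N \<tau> by (simp add: \<beta>_def)
  obtain n :: nat where n: "\<tau> * (3 * \<beta>) < real n" using reals_Archimedean2 by blast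
  moreover have "0 \<le> \<tau> * (3 * \<beta>)" using \<tau> \<beta> by simp
  ultimately have n0: "0 < real n" by linarith
  define h where "h = \<tau> / real n"
  have h: "0 \<le> h" "h * (3 * \<beta>) \<le> 1" "real n * h = \<tau>"
    using n n0 \<tau> by (auto simp: h_def field_simps)
  have "k \<le> n \<Longrightarrow> X (real k * h) \<in> ideal_orbit J (X 0)" for k
  proof (induction k)
    case (Suc k)
    have sub: "{real k * h..real k * h + h} \<subseteq> {0..\<tau>}"
    proof -
      have "real (Suc k) * h \<le> real n * h" using Suc.prems h by (intro mult_right_mono) auto
      then show ?thesis using h by (auto simp: algebra_simps intro: order_trans[OF mult_nonneg_nonneg])
    qed
    have "X (real k * h + h) \<in> ideal_orbit J (X (real k * h))"
    proof (rule lax_orbit_step[OF h(1,2) N])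
      fix t assume t: "t \<in> {real k * h..real k * h + h}"
      with sub have "t \<in> {0..\<tau>}" by blast
      then show "(X has_vector_derivative commutator (B t) (X t)) (at t within {real k * h..real k * h + h})"
        "B t \<in> J \<and> nJ (B t) \<le> \<beta>"
        using has_vector_derivative_within_subset[OF deriv sub] B B_bound by auto
    qed (use sub lip in blast)
    with Suc show ?case by (auto simp: algebra_simps intro: ideal_orbit_trans)
  qed (simp add: ideal_orbit_refl)
  from this[of n] show ?thesis by (simp add: h)
qed

lemma ideal_orbit_BH: "ideal_orbit BH T = similarity_orbit T"
proof -
  have "ideal_group BH = {g :: 'a \<Rightarrow>\<^sub>L 'a. invertible_op g}"
    by (auto simp: ideal_group_def invertible_op_def intro: BH_diff)
  then show ?thesis by (simp add: ideal_orbit_def similarity_orbit_def)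
qed

section \<open>The flow as a solution of the stated problem\<close>

context ideal_flow begin

text \<open>
  The derivative in \<open>J\<close> that the class \<open>C\<^sup>1\<close> provides must be the vector field: it is also a derivative in
  operator norm, where derivatives are unique.
\<close>

lemma flow_ideal_sol:
  assumes flow: "flow_solution a b \<phi> T Y" and C1: "C1_ideal J nJ (\<lambda>t. Y t - T)"
  shows "ideal_sol \<tau> Y"
proof -
  from C1 obtain D where YT: "\<And>t. 0 \<le> t \<Longrightarrow> Y t - T \<in> J"
    and D: "\<And>t. 0 \<le> t \<Longrightarrow> D t \<in> J"
    and lim: "\<And>t. 0 \<le> t \<Longrightarrow> ((\<lambda>s. nJ (((Y s - T) - (Y t - T)) /\<^sub>R (s - t) - D t)) \<longlongrightarrow> 0) (at t within {0..})"
    unfolding C1_ideal_def by blast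
  have Y: "Y 0 = T" "\<And>t. 0 \<le> t \<Longrightarrow> Y t \<in> BH" "\<And>t. 0 \<le> t \<Longrightarrow> spectrum_op (abs_op (Y t)) \<subseteq> complex_of_real ` {a..b}"
    "\<And>t. 0 \<le> t \<Longrightarrow> (Y has_vector_derivative commutator (cfc \<phi> (abs_op (Y t))) (Y t)) (at t within {0..})"
    using flow unfolding flow_solution_def by blast+
  have flow_domain: "Y t \<in> flow_domain" if "0 \<le> t" for t using dom_iff[OF Y(2) YT] Y(3) that by blast
  have diffJ: "Y s - Y t \<in> J" if "0 \<le> s" "0 \<le> t" for s t using flow_domain that by (intro dom_diff)
  have small: "\<exists>d>0. \<forall>s\<in>{0..}. \<bar>s - t\<bar> < d \<longrightarrow> nJ (Y s - Y t - (s - t) *\<^sub>R D t) \<le> e * \<bar>s - t\<bar>"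
    if t: "0 \<le> t" and e: "0 < e" for t e
  proof -
    from lim[OF t] e have "\<forall>\<^sub>F s in at t within {0..}. nJ ((Y s - Y t) /\<^sub>R (s - t) - D t) < e"
      by (simp add: order_tendsto_iff)
    then obtain d where d: "0 < d" "\<And>s. 0 \<le> s \<Longrightarrow> s \<noteq> t \<Longrightarrow> dist s t < d \<Longrightarrow> nJ ((Y s - Y t) /\<^sub>R (s - t) - D t) < e"
      unfolding eventually_at by auto
    show ?thesis
    proof (intro exI[of _ d] conjI ballI impI d(1))
      fix s assume s: "s \<in> {0..}" "\<bar>s - t\<bar> < d"
      show "nJ (Y s - Y t - (s - t) *\<^sub>R D t) \<le> e * \<bar>s - t\<bar>"
      proof (cases "s = t")
        case False
        have m: "(Y s - Y t) /\<^sub>R (s - t) - D t \<in> J" using s t by (intro diff_mem scale_mem diffJ D) auto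
        have "Y s - Y t - (s - t) *\<^sub>R D t = (s - t) *\<^sub>R ((Y s - Y t) /\<^sub>R (s - t) - D t)"
          using False by (simp add: scaleR_diff_right)
        also have "nJ \<dots> = \<bar>s - t\<bar> * nJ ((Y s - Y t) /\<^sub>R (s - t) - D t)" by (rule nK_scale[OF m])
        also have "\<dots> \<le> \<bar>s - t\<bar> * e"
          using d(2)[of s] s False by (intro mult_left_mono) (auto simp: dist_real_def)
        finally show ?thesis by (simp add: mult.commute)
      qed (simp add: nK_zero)
    qed
  qed
  have D_eq: "D t = flow_field (Y t)" if t: "0 \<le> t" for t
  proof (rule vector_derivative_unique_within)
    show "at t within {0..} \<noteq> bot"
    proof
      assume "at t within {0..} = bot"
      moreover have "at_right t \<le> at t within {0..}" using t by (intro at_le) auto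
      ultimately have "at_right t = bot" by (simp add: bot_unique)
      then show False using trivial_limit_at_right_real[of t] by simp
    qed
    show "(Y has_vector_derivative flow_field (Y t)) (at t within {0..})"
      using Y(4)[OF t] by (simp add: flow_field_def generator_def)
    show "(Y has_vector_derivative D t) (at t within {0..})"
      unfolding has_vector_derivative_def has_derivative_within_alt
    proof (intro conjI allI impI bounded_linear_scaleR_left)
      fix e :: real assume "0 < e"
      from small[OF t this] obtain d where d: "0 < d"
        "\<forall>s\<in>{0..}. \<bar>s - t\<bar> < d \<longrightarrow> nJ (Y s - Y t - (s - t) *\<^sub>R D t) \<le> e * \<bar>s - t\<bar>" by blast
      show "\<exists>d>0. \<forall>s\<in>{0..}. norm (s - t) < d \<longrightarrow> norm (Y s - Y t - (s - t) *\<^sub>R D t) \<le> e * norm (s - t)"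
      proof (intro exI[of _ d] conjI ballI impI d(1))
        fix s assume s: "s \<in> {0..}" "norm (s - t) < d"
        have "Y s - Y t - (s - t) *\<^sub>R D t \<in> J" using s t by (intro diff_mem scale_mem diffJ D) auto
        from norm_le[OF this] d(2) s show "norm (Y s - Y t - (s - t) *\<^sub>R D t) \<le> e * norm (s - t)" by force
      qed
    qed
  qed
  show ?thesis
    unfolding ideal_sol_def
  proof (intro conjI ballI allI impI Y(1))
    fix t e :: real assume t: "t \<in> {0..\<tau>}"
    then show "Y t \<in> flow_domain" by (simp add: flow_domain)
    assume "0 < e"
    with small[of t e] t obtain d where "0 < d"
      "\<forall>s\<in>{0..}. \<bar>s - t\<bar> < d \<longrightarrow> nJ (Y s - Y t - (s - t) *\<^sub>R D t) \<le> e * \<bar>s - t\<bar>" by auto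
    then show "\<exists>d>0. \<forall>s\<in>{0..\<tau>}. \<bar>s - t\<bar> < d \<longrightarrow> nJ (Y s - Y t - (s - t) *\<^sub>R flow_field (Y t)) \<le> e * \<bar>s - t\<bar>"
      using t D_eq[of t] by (intro exI[of _ d]) auto
  qed
qed

lemma sol_flow:
  assumes X: "\<And>\<tau>. sol \<tau> X"
  shows "flow_solution a b \<phi> T X" "C1_ideal J nJ (\<lambda>t. X t - T)"
proof -
  have flow_domain: "X t \<in> flow_domain" if "0 \<le> t" for t using sol_dom[OF X that order_refl] .
  have near: "\<forall>\<^sub>F s in at t within {0..}. s \<in> {0..t + 1} \<and> s \<noteq> t" if "0 \<le> t" for t :: real
    unfolding eventually_at by (intro exI[of _ 1]) (auto simp: dist_real_def)
  have local: "\<exists>K\<ge>0. \<forall>s\<in>{0..t + 1}.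
      nJ (X s - X t - (s - t) *\<^sub>R flow_field (X t)) \<le> K * (s - t)\<^sup>2 \<and>
      nJ (X s - X t) \<le> \<bar>s - t\<bar> * nJ (flow_field (X t)) + K * (s - t)\<^sup>2" if t: "0 \<le> t" for t
  proof -
    obtain K where K: "0 \<le> K"
      "\<And>s t'. s \<in> {0..t + 1} \<Longrightarrow> t' \<in> {0..t + 1} \<Longrightarrow> nJ (X s - X t' - (s - t') *\<^sub>R flow_field (X t')) \<le> K * (s - t')\<^sup>2"
      "\<And>s t'. s \<in> {0..t + 1} \<Longrightarrow> t' \<in> {0..t + 1} \<Longrightarrow> nJ (X s - X t') \<le> \<bar>s - t'\<bar> * nJ (flow_field (X t')) + K * (s - t')\<^sup>2"
      by (rule sol_remainder[OF X], rule that)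
    with t show ?thesis by (intro exI[of _ K]) auto
  qed
  show "flow_solution a b \<phi> T X"
    unfolding flow_solution_def
  proof (intro conjI allI impI)
    show "X 0 = T" by (rule sol_0[OF X])
    fix t :: real assume t: "0 \<le> t"
    show "X t \<in> BH" by (rule dom_BH[OF flow_domain[OF t]])
    show "spectrum_op (abs_op (X t)) \<subseteq> complex_of_real ` {a..b}"
      using dom_iff[OF dom_BH[OF flow_domain[OF t]] dom_J[OF flow_domain[OF t]]] flow_domain[OF t] by simp
    have "(X has_vector_derivative flow_field (X t)) (at t within {0..t + 1})"
      by (rule sol_derivative[OF X]) (use t in simp)
    moreover have "at t within {0..t + 1} = at t within {0..}"
      by (rule at_within_nhd[of _ "{..<t + 1}"]) auto
    ultimately show "(X has_vector_derivative commutator (cfc \<phi> (abs_op (X t))) (X t)) (at t within {0..})"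
      by (simp add: flow_field_def generator_def)
  qed
  show "C1_ideal J nJ (\<lambda>t. X t - T)"
    unfolding C1_ideal_def
  proof (intro conjI allI impI exI[of _ "\<lambda>t. flow_field (X t)"])
    fix t :: real assume t: "0 \<le> t"
    show "X t - T \<in> J" by (rule dom_J[OF flow_domain[OF t]])
    show "flow_field (X t) \<in> J" by (rule field_mem[OF flow_domain[OF t]])
    obtain K where K: "0 \<le> K"
      "\<And>s. s \<in> {0..t + 1} \<Longrightarrow> nJ (X s - X t - (s - t) *\<^sub>R flow_field (X t)) \<le> K * (s - t)\<^sup>2"
      "\<And>s. s \<in> {0..t + 1} \<Longrightarrow> nJ (X s - X t) \<le> \<bar>s - t\<bar> * nJ (flow_field (X t)) + K * (s - t)\<^sup>2"
      using local[OF t] by blast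
    show "((\<lambda>s. nJ ((X s - T - (X t - T)) /\<^sub>R (s - t) - flow_field (X t))) \<longlongrightarrow> 0) (at t within {0..})"
    proof (rule Lim_null_comparison)
      show "((\<lambda>s. K * \<bar>s - t\<bar>) \<longlongrightarrow> 0) (at t within {0..})"
        by (rule tendsto_eq_intros refl | simp)+
      show "\<forall>\<^sub>F s in at t within {0..}. norm (nJ ((X s - T - (X t - T)) /\<^sub>R (s - t) - flow_field (X t))) \<le> K * \<bar>s - t\<bar>"
        using near[OF t]
      proof eventually_elim
        case (elim s)
        then have s: "0 \<le> s" "s \<in> {0..t + 1}" "s \<noteq> t" by auto
        have m: "X s - X t - (s - t) *\<^sub>R flow_field (X t) \<in> J" by (intro remainder_mem flow_domain s t)
        have "(X s - T - (X t - T)) /\<^sub>R (s - t) - flow_field (X t) = (X s - X t - (s - t) *\<^sub>R flow_field (X t)) /\<^sub>R (s - t)"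
          using s(3) by (simp add: scaleR_diff_right)
        then have e: "nJ ((X s - T - (X t - T)) /\<^sub>R (s - t) - flow_field (X t))
            = nJ (X s - X t - (s - t) *\<^sub>R flow_field (X t)) / \<bar>s - t\<bar>"
          using nK_scale[OF m, of "inverse (s - t)"] by (simp add: divide_inverse mult.commute)
        also have "\<dots> \<le> K * (s - t)\<^sup>2 / \<bar>s - t\<bar>" using K(2)[OF s(2)] by (intro divide_right_mono) auto
        also have "\<dots> = K * \<bar>s - t\<bar>"
          using nonzero_mult_div_cancel_right[of "\<bar>s - t\<bar>" "K * \<bar>s - t\<bar>"] s(3) by (simp add: power2_eq_square mult.assoc)
        finally have "nJ ((X s - T - (X t - T)) /\<^sub>R (s - t) - flow_field (X t)) \<le> K * \<bar>s - t\<bar>" .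
        then show ?case unfolding e using nJ_ge_0[OF m] by simp
      qed
    qed
    show "((\<lambda>s. nJ (flow_field (X s) - flow_field (X t))) \<longlongrightarrow> 0) (at t within {0..})"
    proof (rule Lim_null_comparison)
      show "((\<lambda>s. L * (\<bar>s - t\<bar> * nJ (flow_field (X t)) + K * (s - t)\<^sup>2)) \<longlongrightarrow> 0) (at t within {0..})"
        by (rule tendsto_eq_intros refl | simp)+
      show "\<forall>\<^sub>F s in at t within {0..}. norm (nJ (flow_field (X s) - flow_field (X t)))
          \<le> L * (\<bar>s - t\<bar> * nJ (flow_field (X t)) + K * (s - t)\<^sup>2)"
        using near[OF t]
      proof eventually_elim
        case (elim s)
        then have s: "0 \<le> s" "s \<in> {0..t + 1}" by auto
        have "nJ (flow_field (X s) - flow_field (X t)) \<le> L * nJ (X s - X t)" by (intro field_lipschitz flow_domain s t)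
        also have "\<dots> \<le> L * (\<bar>s - t\<bar> * nJ (flow_field (X t)) + K * (s - t)\<^sup>2)"
          by (intro mult_left_mono K L_nonneg s)
        finally show ?case using nJ_ge_0[OF field_lipschitz(1)[OF flow_domain flow_domain], OF s(1) t] by simp
      qed
    qed
  qed
qed

lemma gen_sol_lipschitz:
  assumes X: "sol \<tau> X" and \<tau>: "0 \<le> \<tau>"
  obtains N where "0 \<le> N" "\<And>s t. s \<in> {0..\<tau>} \<Longrightarrow> t \<in> {0..\<tau>} \<Longrightarrow> nJ (generator (X s) - generator (X t)) \<le> N * \<bar>s - t\<bar>"
proof -
  obtain K where K: "0 \<le> K"
    "\<And>s t. s \<in> {0..\<tau>} \<Longrightarrow> t \<in> {0..\<tau>} \<Longrightarrow> nJ (X s - X t) \<le> \<bar>s - t\<bar> * nJ (flow_field (X t)) + K * (s - t)\<^sup>2"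
    by (rule sol_remainder[OF X], rule that)
  define A where "A = exp (L * \<tau>) * nJ (flow_field T)"
  have A0: "0 \<le> A" using nJ_ge_0[OF field_mem[OF T_dom]] by (simp add: A_def)
  have A: "nJ (flow_field (X t)) \<le> A" if t: "t \<in> {0..\<tau>}" for t
  proof -
    have "nJ (flow_field (X t)) \<le> exp (L * t) * nJ (flow_field T)"
      using t by (intro sol_growth sol_mono[OF X]) auto
    also have "\<dots> \<le> A"
      unfolding A_def using t L_nonneg nJ_ge_0[OF field_mem[OF T_dom]]
      by (intro mult_right_mono) (auto intro: mult_left_mono)
    finally show ?thesis .
  qed
  show ?thesis
  proof (rule that[of "LB * (A + K * \<tau>)"])
    show "0 \<le> LB * (A + K * \<tau>)" using LB_nonneg A0 K \<tau> by simp
    fix s t assume st: "s \<in> {0..\<tau>}" "t \<in> {0..\<tau>}"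
    have "nJ (generator (X s) - generator (X t)) \<le> LB * nJ (X s - X t)"
      using st sol_dom[OF X] by (intro gen_lipschitz) auto
    also have "nJ (X s - X t) \<le> \<bar>s - t\<bar> * A + (K * \<tau>) * \<bar>s - t\<bar>"
    proof -
      have "\<bar>s - t\<bar> * nJ (flow_field (X t)) \<le> \<bar>s - t\<bar> * A" by (intro mult_left_mono A st) simp
      moreover have "K * \<bar>s - t\<bar> * \<bar>s - t\<bar> \<le> K * \<tau> * \<bar>s - t\<bar>"
        using st K(1) by (intro mult_right_mono mult_left_mono) (auto simp: abs_le_iff)
      ultimately show ?thesis using K(2)[OF st] by (simp add: power2_eq_square mult.assoc)
    qed
    then have "LB * nJ (X s - X t) \<le> LB * (\<bar>s - t\<bar> * A + (K * \<tau>) * \<bar>s - t\<bar>)"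
      using LB_nonneg by (rule mult_left_mono)
    finally show "nJ (generator (X s) - generator (X t)) \<le> LB * (A + K * \<tau>) * \<bar>s - t\<bar>" by (simp add: algebra_simps)
  qed
qed

lemma sol_orbit:
  assumes X: "sol \<tau> X" and \<tau>: "0 \<le> \<tau>"
  shows "X \<tau> \<in> similarity_orbit T"
    and "generator T \<in> J \<Longrightarrow> X \<tau> \<in> ideal_orbit J T"
proof -
  obtain N where N: "0 \<le> N" "\<And>s t. s \<in> {0..\<tau>} \<Longrightarrow> t \<in> {0..\<tau>} \<Longrightarrow> nJ (generator (X s) - generator (X t)) \<le> N * \<bar>s - t\<bar>"
    by (rule gen_sol_lipschitz[OF X \<tau>], rule that)
  have flow_domain: "X t \<in> flow_domain" if "t \<in> {0..\<tau>}" for t using sol_dom[OF X] that by simp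
  have deriv: "(X has_vector_derivative commutator (generator (X t)) (X t)) (at t within {0..\<tau>})" if "t \<in> {0..\<tau>}" for t
    using sol_derivative[OF X that] by (simp add: flow_field_def)
  interpret BH: operator_ideal BH "norm :: ('h \<Rightarrow>\<^sub>L 'h) \<Rightarrow> real"
    by unfold_locales (rule normed_ideal_BH)
  have "X \<tau> \<in> ideal_orbit BH (X 0)"
  proof (rule BH.lax_orbit[OF \<tau> N(1) deriv])
    show "generator (X t) \<in> BH" if "t \<in> {0..\<tau>}" for t using flow_domain[OF that] by (rule gen_BH)
    show "norm (generator (X s) - generator (X t)) \<le> N * \<bar>s - t\<bar>" if "s \<in> {0..\<tau>}" "t \<in> {0..\<tau>}" for s t
      using norm_le[OF gen_lipschitz(1)[OF flow_domain flow_domain], OF that] N(2)[OF that] by linarith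
  qed
  then show "X \<tau> \<in> similarity_orbit T" by (simp add: ideal_orbit_BH sol_0[OF X])
  assume T: "generator T \<in> J"
  have "X \<tau> \<in> ideal_orbit J (X 0)"
  proof (rule lax_orbit[OF \<tau> N(1) deriv])
    show "generator (X t) \<in> J" if "t \<in> {0..\<tau>}" for t
      using add_mem[OF gen_lipschitz(1)[OF flow_domain[OF that] T_dom] T] by simp
  qed (use N(2) in auto)
  then show "X \<tau> \<in> ideal_orbit J T" by (simp add: sol_0[OF X])
qed

end

theorem theorem4p7:
  fixes T :: "'h::chilbert_space \<Rightarrow>\<^sub>L 'h"
    and J :: "('h \<Rightarrow>\<^sub>L 'h) set" and nJ :: "('h \<Rightarrow>\<^sub>L 'h) \<Rightarrow> real"
    and a b :: real and \<phi>\<^sub>1 :: "real \<Rightarrow> real"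
  assumes separable: "separable_space (euclidean :: 'h topology)"
    and infinite_dim: "\<not> (\<exists>B::'h set. finite B \<and> module.span scaleC B = UNIV)"
    and ab: "0 < a" "a < b"
    and phi: "continuous_on {a..b} \<phi>\<^sub>1" "strict_mono_on {a..b} \<phi>\<^sub>1"
    and T: "T \<in> BH" "spectrum_op (abs_op T) \<subseteq> complex_of_real ` {a<..<b}"
    and ideal: "normed_ideal J nJ"
    and comm: "commutator (cfc \<phi>\<^sub>1 (abs_op T)) T \<in> J"
    and lip: "ideal_lipschitz J nJ a b \<phi>\<^sub>1"
  shows "\<exists>X. (flow_solution a b \<phi>\<^sub>1 T X \<and> C1_ideal J nJ (\<lambda>t. X t - T)) \<and>
           (\<forall>Y. flow_solution a b \<phi>\<^sub>1 T Y \<and> C1_ideal J nJ (\<lambda>t. Y t - T) \<longrightarrow>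
                (\<forall>t\<ge>0. Y t = X t)) \<and>
           (\<forall>t\<ge>0. X t \<in> similarity_orbit T) \<and>
           (cfc \<phi>\<^sub>1 (abs_op T) \<in> J \<longrightarrow> (\<forall>t\<ge>0. X t \<in> ideal_orbit J T))"
proof -
  (* In the zero space the empty set spans. *)
  have nontrivial: "\<exists>x::'h. x \<noteq> 0"
  proof (rule ccontr)
    assume "\<nexists>x::'h. x \<noteq> 0"
    then have "(UNIV :: 'h set) = {0}" by auto
    moreover interpret vector_space "scaleC :: complex \<Rightarrow> 'h \<Rightarrow> 'h" by (rule vector_space_scaleC)
    have "0 \<in> module.span scaleC ({} :: 'h set)" by (rule span_zero)
    ultimately have "module.span scaleC ({} :: 'h set) = UNIV" by auto
    with infinite_dim show False by blast
  qed
  have "\<exists>\<Phi>. \<forall>s\<in>{a..b}. \<bar>\<phi>\<^sub>1 s\<bar> \<le> \<Phi>"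
    using compact_imp_bounded[OF compact_continuous_image[OF phi(1) compact_Icc]]
    by (simp add: bounded_iff)
  then obtain \<Phi> where Phi: "\<And>s. s \<in> {a..b} \<Longrightarrow> \<bar>\<phi>\<^sub>1 s\<bar> \<le> \<Phi>" by blast
  obtain C where C: "0 \<le> C" "\<And>A1 A2. selfadjoint_op A1 \<Longrightarrow> selfadjoint_op A2 \<Longrightarrow>
      spectrum_op A1 \<subseteq> complex_of_real ` {a..b} \<Longrightarrow> spectrum_op A2 \<subseteq> complex_of_real ` {a..b} \<Longrightarrow> A1 - A2 \<in> J \<Longrightarrow>
      cfc \<phi>\<^sub>1 A1 - cfc \<phi>\<^sub>1 A2 \<in> J \<and> nJ (cfc \<phi>\<^sub>1 A1 - cfc \<phi>\<^sub>1 A2) \<le> C * nJ (A1 - A2)"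
    using lip unfolding ideal_lipschitz_def by (meson less_imp_le)
  interpret ideal_flow J nJ T a b C \<Phi> \<phi>\<^sub>1
  proof unfold_locales
    show "real_spectrum (abs_op T) \<subseteq> {a<..<b}"
      using T(2) spectrum_subset_iff[OF abs_op_selfadjoint[OF T(1)]] by blast
    show "mono_on {a..b} \<phi>\<^sub>1" using phi(2) by (rule strict_mono_on_imp_mono_on)
    show "cfc \<phi>\<^sub>1 A1 - cfc \<phi>\<^sub>1 A2 \<in> J \<and> nJ (cfc \<phi>\<^sub>1 A1 - cfc \<phi>\<^sub>1 A2) \<le> C * nJ (A1 - A2)"
      if "selfadjoint_op A1" "selfadjoint_op A2" "real_spectrum A1 \<subseteq> {a..b}" "real_spectrum A2 \<subseteq> {a..b}" "A1 - A2 \<in> J" for A1 A2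
      using that(3,4) by (intro C(2) that(1,2,5)) (simp_all add: spectrum_subset_iff that(1,2))
  qed (fact ideal nontrivial ab phi(1) Phi T(1) comm C(1))+
  obtain X where X: "\<And>\<tau>. sol \<tau> X" using global_solution by blast
  show ?thesis
  proof (intro exI[of _ X] conjI allI impI sol_flow[OF X])
    fix Y and t :: real assume "flow_solution a b \<phi>\<^sub>1 T Y \<and> C1_ideal J nJ (\<lambda>t. Y t - T)" "0 \<le> t"
    then show "Y t = X t" by (intro ideal_sol_unique[of t] flow_ideal_sol sol_ideal_sol X) auto
  next
    fix t :: real assume t: "0 \<le> t"
    show "X t \<in> similarity_orbit T" by (rule sol_orbit(1)[OF X t])
    assume "cfc \<phi>\<^sub>1 (abs_op T) \<in> J"
    then show "X t \<in> ideal_orbit J T" by (intro sol_orbit(2)[OF X t]) (simp add: generator_def)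
  qed
qed

end
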